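(* Let $\mathcal{M}$ be a finite-horizon, time-inhomogeneous random MDP with finite set $\mathcal{X}$, finite action set $\mathcal{A}$, horizon $H$ and rewards in $\{0,1\}$, as described in the context. Assume that the outcome distributions $\mathcal{P}_{h,x,a}$ are drawn independently over $(h,x,a)$ from Dirichlet priors, $\mathcal{P}_{h,x,a}\sim\mathrm{Dirichlet}(\boldsymbol{\alpha}^0_{h,x,a})$ with $\boldsymbol{\alpha}^0_{h,x,a}\in\mathbb{R}_+^{2|\mathcal{X}|}$, and that there is $\beta\ge 3$ with $\mathbf{1}^T\boldsymbol{\alpha}^0_{h,x,a}=\beta$ for all $(h,x,a)$. Run the algorithm $\mathsf{WTD}$ (Tabular Wasserstein TD, described in the context; infinite buffer, greedy actions) with parameters $\sigma^2=3H^2$, $\bar\theta=H$ and $\sigma^2/\sigma_0^2=\beta$. Then for every number of episodes $L\in\mathbb{N}$, $$\mathrm{BayesRegret}(\mathsf{WTD},L)\le 5H^2\sqrt{\beta|\mathcal{X}||\mathcal{A}|L\,\log_+\!\big(2|\mathcal{X}||\mathcal{A}|HL\big)}\;\log_+\!\Big(1+\frac{L}{|\mathcal{X}||\mathcal{A}|}\Big)=\widetilde{O}\big(H^2\sqrt{|\mathcal{X}||\mathcal{A}|L}\big),$$ where $\log_+(x)=\max\{1,\log x\}$ and $\widetilde{O}(\cdot)$ ignores all poly-logarithmic factors (with $\beta$ regarded as a constant).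
   Context: MDP. $\mathcal{M}=(\mathcal{S},\mathcal{A},H,R,\mathbb{P},\rho)$ with $\mathcal{S}=\mathcal{S}_0\cup\dots\cup\mathcal{S}_{H-1}$, where each $s_h\in\mathcal{S}_h$ is a pair $(h,x)$ with $x\in\mathcal{X}$, $|\mathcal{X}|<\infty$, $|\mathcal{A}|<\infty$. From a state in $\mathcal{S}_h$ with $h<H-1$ the process moves with probability 1 to a state in $\mathcal{S}_{h+1}$, and it terminates after action $a_{H-1}$. Rewards lie in $\{0,1\}$. Taking action $a$ in state $(h,x)$ produces an outcome $(r,x')\in\{0,1\}\times\mathcal{X}$ (reward and next element of $\mathcal{X}$) with distribution $\mathcal{P}_{h,x,a}$, a probability vector over the $2|\mathcal{X}|$ outcomes; for $h=H-1$ the component $x'=x_H$ is a dummy with no effect on values. In each episode $l$ the initial $x_0^l$ is drawn from $\rho$, independently of everything else. Given $\mathcal{M}$, transitions are drawn independently from the $\mathcal{P}_{h,x,a}$. Values. For a policy $\pi$ (a map from states to distributions over $\mathcal{A}$), $V^\pi_{\mathcal{M},h}(x)=\mathbb{E}_{\mathcal{M},\pi}[\sum_{t=h}^{H-1}r_{t+1}\mid x_h=x]$, and $V^*_{\mathcal{M},h}(x)=\max_\pi V^\pi_{\mathcal{M},h}(x)$. Algorithm $\mathsf{WTD}$ with parameters $\bar\theta\in\mathbb{R}$, $\sigma,\sigma_0>0$, and $\beta=\sigma^2/\sigma_0^2$. Let $\mathcal{D}^{l-1}_{h,x,a}$ be the collection (with multiplicity) of all outcomes $(r,x')$ observed after taking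 action $a$ in state $(h,x)$ during episodes $1,\dots,l-1$, and $n^l(h,x,a)=|\mathcal{D}^{l-1}_{h,x,a}|$. At the start of episode $l=1,\dots,L$, sample $\tilde z_{h,x,a}\sim\mathcal{N}(0,1)$ independently for all $(h,x,a)$ with $0\le h\le H-1$, fresh in each episode. Set $Q^l_{\tilde z,H}\equiv 0$ and, for $h=H-1,\dots,0$ and all $(x,a)$, set $Q^l_{\tilde z,h}(x,a)=\nu^l(h,x,a)+m^l(h,x,a)\,\tilde z_{h,x,a}$ with $$\nu^l(h,x,a)=\frac{\sum_{(r,x')\in\mathcal{D}^{l-1}_{h,x,a}}\big(r+\max_{a'\in\mathcal{A}}Q^l_{\tilde z,h+1}(x',a')\big)+\beta\bar\theta}{n^l(h,x,a)+\beta},\qquad m^l(h,x,a)=\frac{\sqrt{n^l(h,x,a)}\,\sigma+\beta\sigma_0}{n^l(h,x,a)+\beta}.$$ Then in episode $l$, starting from $x_0^l$, at each step $h=0,\dots,H-1$ take the greedy action $a_h^l\in\arg\max_{a}Q^l_{\tilde z,h}(x_h^l,a)$, observe $(r^l_{h+1},x^l_{h+1})$ and add it to the data for $(h,x_h^l,a_h^l)$. Let $\pi^l$ denote this greedy policy. Bayesian regret. $\mathrm{BayesRegret}(\mathsf{WTD},L)=\mathbb{E}\big[\sum_{l=1}^L\big(V^*_{\mathcal{M},0}(x_0^l)-V^{\pi^l}_{\mathcal{M},0}(x_0^l)\big)\big]$, the expectation being over the random MDP $\mathcal{M}$, the initial states, the transitions and the algorithm's randomness. *)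

theory Defs
  imports "HOL-Probability.Probability"
begin

(* Rewards in {0,1} are booleans: an outcome (r, x') ranges over exactly 2 * CARD('x) values. *)

type_synonym ('x, 'a) sa = "nat \<times> 'x \<times> 'a"
type_synonym 'x outcome = "bool \<times> 'x"
type_synonym ('x, 'a) transition = "('x, 'a) sa \<times> 'x outcome"
type_synonym ('x, 'a) model = "('x, 'a) sa \<Rightarrow> 'x outcome \<Rightarrow> real"
type_synonym ('x, 'a) policy = "nat \<Rightarrow> 'x \<Rightarrow> 'a pmf"

definition log_plus :: "real \<Rightarrow> real" where
  "log_plus x = max 1 (ln x)"

(* Gamma law with shape a and unit rate; shape 0 is the point mass at 0. *)
definition gamma_dist :: "real \<Rightarrow> real measure" where
  "gamma_dist a =
     (if a = 0 then return borel 0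
      else density lborel (\<lambda>x. ennreal (if x > 0 then x powr (a - 1) * exp (- x) / Gamma a else 0)))"

(* Dirichlet law on a finite outcome type: independent Gamma(alpha_i, 1) variables divided by
   their sum.  Shape 0 makes the coordinate almost surely zero, so that alpha may have zero
   entries (not all of them), in which case the law lives on a face of the simplex. *)
definition dirichlet :: "('o::finite \<Rightarrow> real) \<Rightarrow> ('o \<Rightarrow> real) measure" where
  "dirichlet \<alpha> =
     distr (\<Pi>\<^sub>M i\<in>UNIV. gamma_dist (\<alpha> i)) (\<Pi>\<^sub>M i\<in>UNIV. borel)
       (\<lambda>g i. g i / (\<Sum>j\<in>UNIV. g j))"

definition sa_space :: "nat \<Rightarrow> ('x, 'a) sa set" where
  "sa_space H = {..<H} \<times> UNIV \<times> UNIV"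

definition dirichlet_prior ::
    "nat \<Rightarrow> (('x::finite, 'a) sa \<Rightarrow> 'x outcome \<Rightarrow> real) \<Rightarrow> ('x, 'a) model measure" where
  "dirichlet_prior H \<alpha> = (\<Pi>\<^sub>M s\<in>sa_space H. dirichlet (\<alpha> s))"

(* The distribution with probability vector p.  Vectors outside the simplex form a null set of the
   Dirichlet laws; fixing the value there keeps all maps below measurable in p, which the
   unspecified values of embed_pmf would not guarantee. *)
definition outcome_pmf :: "('o::finite \<Rightarrow> real) \<Rightarrow> 'o pmf" where
  "outcome_pmf p =
     (if (\<forall>i. 0 \<le> p i) \<and> (\<Sum>i\<in>UNIV. p i) = 1 then embed_pmf p else pmf_of_set UNIV)"

(* Law of the transitions over the k steps h, ..., h + k - 1, starting with x at step h. *)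
primrec rollout ::
    "('x::finite, 'a) model \<Rightarrow> ('x, 'a) policy \<Rightarrow> nat \<Rightarrow> nat \<Rightarrow> 'x \<Rightarrow> ('x, 'a) transition list pmf" where
  "rollout P \<pi> 0 h x = return_pmf []"
| "rollout P \<pi> (Suc k) h x =
     bind_pmf (\<pi> h x) (\<lambda>a.
     bind_pmf (outcome_pmf (P (h, x, a))) (\<lambda>(r, x').
     map_pmf (\<lambda>\<tau>. ((h, x, a), (r, x')) # \<tau>) (rollout P \<pi> k (Suc h) x')))"

definition total_reward :: "('x, 'a) transition list \<Rightarrow> real" where
  "total_reward \<tau> = (\<Sum>(s, r, x')\<leftarrow>\<tau>. of_bool r)"

definition val :: "nat \<Rightarrow> ('x::finite, 'a) model \<Rightarrow> ('x, 'a) policy \<Rightarrow> nat \<Rightarrow> 'x \<Rightarrow> real" where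
  "val H P \<pi> h x = measure_pmf.expectation (rollout P \<pi> (H - h) h x) total_reward"

definition opt_val :: "nat \<Rightarrow> ('x::finite, 'a) model \<Rightarrow> nat \<Rightarrow> 'x \<Rightarrow> real" where
  "opt_val H P h x = (SUP \<pi>. val H P \<pi> h x)"

(* The multiset of outcomes recorded for s in the flattened history D of past transitions. *)
definition buffer :: "('x, 'a) transition list \<Rightarrow> ('x, 'a) sa \<Rightarrow> 'x outcome multiset" where
  "buffer D s = image_mset snd {# t \<in># mset D. fst t = s #}"

definition wtd_mean ::
    "real \<Rightarrow> real \<Rightarrow> ('x, 'a::finite) transition list \<Rightarrow> ('x \<Rightarrow> 'a \<Rightarrow> real) \<Rightarrow> ('x, 'a) sa \<Rightarrow> real" where
  "wtd_mean \<beta> \<theta> D Qnext s =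
     ((\<Sum>(r, x')\<in>#buffer D s. of_bool r + (MAX a'. Qnext x' a')) + \<beta> * \<theta>)
       / (real (size (buffer D s)) + \<beta>)"

definition wtd_scale ::
    "real \<Rightarrow> real \<Rightarrow> real \<Rightarrow> ('x, 'a) transition list \<Rightarrow> ('x, 'a) sa \<Rightarrow> real" where
  "wtd_scale \<beta> \<sigma> \<sigma>0 D s =
     (sqrt (real (size (buffer D s))) * \<sigma> + \<beta> * \<sigma>0) / (real (size (buffer D s)) + \<beta>)"

function wtd_Q ::
    "nat \<Rightarrow> real \<Rightarrow> real \<Rightarrow> real \<Rightarrow> ('x, 'a::finite) transition list \<Rightarrow> (('x, 'a) sa \<Rightarrow> real)
       \<Rightarrow> nat \<Rightarrow> 'x \<Rightarrow> 'a \<Rightarrow> real" where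
  "wtd_Q H \<theta> \<sigma> \<sigma>0 D z h =
     (if h < H then
        (\<lambda>x a. wtd_mean (\<sigma>\<^sup>2 / \<sigma>0\<^sup>2) \<theta> D (wtd_Q H \<theta> \<sigma> \<sigma>0 D z (Suc h)) (h, x, a)
             + wtd_scale (\<sigma>\<^sup>2 / \<sigma>0\<^sup>2) \<sigma> \<sigma>0 D (h, x, a) * z (h, x, a))
      else (\<lambda>x a. 0))"
  by pat_completeness auto
termination
  by (relation "Wellfounded.measure (\<lambda>(H, \<theta>, \<sigma>, \<sigma>0, D, z, h). H - h)") auto

declare wtd_Q.simps [simp del]

(* Tie-breaking is left open: given the past data, the step and the current element, it selects an
   action from the set of maximizers. *)
type_synonym ('x, 'a) tie_rule = "('x, 'a) transition list \<Rightarrow> nat \<Rightarrow> 'x \<Rightarrow> 'a set \<Rightarrow> 'a"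

definition wtd_greedy ::
    "nat \<Rightarrow> real \<Rightarrow> real \<Rightarrow> real \<Rightarrow> ('x, 'a::finite) tie_rule \<Rightarrow> ('x, 'a) transition list
       \<Rightarrow> (('x, 'a) sa \<Rightarrow> real) \<Rightarrow> nat \<Rightarrow> 'x \<Rightarrow> 'a" where
  "wtd_greedy H \<theta> \<sigma> \<sigma>0 sel D z h x =
     sel D h x {a. \<forall>a'. wtd_Q H \<theta> \<sigma> \<sigma>0 D z h x a' \<le> wtd_Q H \<theta> \<sigma> \<sigma>0 D z h x a}"

definition wtd_noise :: "nat \<Rightarrow> (('x, 'a) sa \<Rightarrow> real) measure" where
  "wtd_noise H = (\<Pi>\<^sub>M s\<in>sa_space H. std_normal_distribution)"

(* An episode is recorded by its greedy policy, its initial element and its transitions. *)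
type_synonym ('x, 'a) episode = "(nat \<Rightarrow> 'x \<Rightarrow> 'a) \<times> 'x \<times> ('x, 'a) transition list"

(* Every measure on episodes or lists of episodes has all sets measurable.  For fixed D the greedy
   policy takes only finitely many values (Q vanishes for h >= H), so no measurability is lost. *)
definition wtd_episode ::
    "nat \<Rightarrow> real \<Rightarrow> real \<Rightarrow> real \<Rightarrow> ('x::finite, 'a::finite) tie_rule \<Rightarrow> 'x pmf \<Rightarrow> ('x, 'a) model
       \<Rightarrow> ('x, 'a) transition list \<Rightarrow> ('x, 'a) episode measure" where
  "wtd_episode H \<theta> \<sigma> \<sigma>0 sel \<rho> P D =
     wtd_noise H \<bind> (\<lambda>z. let g = wtd_greedy H \<theta> \<sigma> \<sigma>0 sel D z in
       measure_pmf (bind_pmf \<rho> (\<lambda>x0.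
         map_pmf (\<lambda>\<tau>. (g, x0, \<tau>)) (rollout P (\<lambda>h x. return_pmf (g h x)) H 0 x0))))"

primrec wtd_run ::
    "nat \<Rightarrow> real \<Rightarrow> real \<Rightarrow> real \<Rightarrow> ('x::finite, 'a::finite) tie_rule \<Rightarrow> 'x pmf \<Rightarrow> ('x, 'a) model
       \<Rightarrow> nat \<Rightarrow> ('x, 'a) episode list measure" where
  "wtd_run H \<theta> \<sigma> \<sigma>0 sel \<rho> P 0 = return (count_space UNIV) []"
| "wtd_run H \<theta> \<sigma> \<sigma>0 sel \<rho> P (Suc l) =
     wtd_run H \<theta> \<sigma> \<sigma>0 sel \<rho> P l \<bind> (\<lambda>es.
       wtd_episode H \<theta> \<sigma> \<sigma>0 sel \<rho> P (concat (map (\<lambda>(g, x0, \<tau>). \<tau>) es)) \<bind> (\<lambda>e.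
         return (count_space UNIV) (es @ [e])))"

definition cum_regret :: "nat \<Rightarrow> ('x::finite, 'a) model \<Rightarrow> ('x, 'a) episode list \<Rightarrow> real" where
  "cum_regret H P es =
     (\<Sum>(g, x0, \<tau>)\<leftarrow>es. opt_val H P 0 x0 - val H P (\<lambda>h x. return_pmf (g h x)) 0 x0)"

(* The joint expectation, written as the expectation over the model of the expectation over the
   initial elements, the noise and the transitions given the model. *)
definition wtd_bayes_regret ::
    "nat \<Rightarrow> real \<Rightarrow> real \<Rightarrow> real \<Rightarrow> ('x::finite, 'a::finite) tie_rule \<Rightarrow> 'x pmf
       \<Rightarrow> (('x, 'a) sa \<Rightarrow> 'x outcome \<Rightarrow> real) \<Rightarrow> nat \<Rightarrow> real" where
  "wtd_bayes_regret H \<theta> \<sigma> \<sigma>0 sel \<rho> \<alpha> L =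
     (\<integral>P. (\<integral>es. cum_regret H P es \<partial>wtd_run H \<theta> \<sigma> \<sigma>0 sel \<rho> P L) \<partial>dirichlet_prior H \<alpha>)"

definition regret_bound :: "real \<Rightarrow> nat \<Rightarrow> nat \<Rightarrow> nat \<Rightarrow> nat \<Rightarrow> real" where
  "regret_bound \<beta> H X A L =
     5 * (real H)\<^sup>2 * sqrt (\<beta> * real X * real A * real L * log_plus (2 * real X * real A * real H * real L))
       * log_plus (1 + real L / (real X * real A))"

(* f is O-tilde of g as a function of (H, X, A, L): uniformly over all positive values of the four
   parameters, f is at most a constant times g times a power of the logarithm of the parameters. *)
definition soft_bigo ::
    "(nat \<Rightarrow> nat \<Rightarrow> nat \<Rightarrow> nat \<Rightarrow> real) \<Rightarrow> (nat \<Rightarrow> nat \<Rightarrow> nat \<Rightarrow> nat \<Rightarrow> real) \<Rightarrow> bool" where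
  "soft_bigo f g \<longleftrightarrow>
     (\<exists>k::nat. (\<lambda>(H, X, A, L). f H X A L)
        \<in> O[principal {(H, X, A, L). 0 < H \<and> 0 < X \<and> 0 < A \<and> 0 < L}](\<lambda>(H, X, A, L). g H X A L * log_plus (real H * real X * real A * real L) ^ k))"

end

theory Submission
  imports Defs "HOL-Real_Asymp.Real_Asymp"
begin

text \<open>
  Given the data of the past episodes the posterior is again a product of Dirichlet laws. Backward
  induction is convex and nondecreasing in the backup at each triple \<open>(h, x, a)\<close>, and the Dirichlet mean
  of a vector with entries in \<open>[0, H]\<close> is dominated, in the increasing convex order, by the Gaussian
  that the algorithm samples. Exchanging the laws triple by triple yields optimism: the expected
  posterior optimal value is at most the expected maximum of \<open>Q\<close> at the initial state.

  The regret of an episode is therefore at most the expected gap between that maximum and the value of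
  the greedy policy. Since a trajectory visits each triple at most once, integrating out the model
  amounts to rolling out the posterior mean model, in which the gap telescopes into one term per visited
  triple: the scaled noise, of order \<open>H \<surd>log / \<surd>(n + \<beta>)\<close>, and the bias of the prior \<open>\<theta>\<close>, of order
  \<open>\<beta> / (n + \<beta>)\<close> times a lower bound on the values of \<open>Q\<close>. Summing over the visits gives a leading term
  \<open>H\<^sup>2 \<surd>(L |X| |A| log)\<close> and terms of lower order in \<open>L\<close>, which the trivial bound \<open>H L\<close> absorbs.
\<close>

text \<open>The comparison of a Dirichlet mean with a Gaussian is tested on Lipschitz convex
  functions and rests on conjugacy alone: weighting by a coordinate raises its shape by one. A
  Dirichlet law is thus a mixture of Dirichlet laws with one more unit of mass, and iterating this
  yields bounded centered increments and a vanishing remainder. A centered bounded law costs the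
  factor \<open>pi / 2\<close> in variance against a Gaussian, which the 3 in
  \<open>\<sigma>\<^sup>2 = 3 * H\<^sup>2\<close> covers. Optimism holds only in expectation,
  whereas the gap between \<open>Q\<close> and the greedy policy is bounded pointwise in the noise.
  The two combine because, given the data, the noise is independent of the model. Unbounded noise is
  treated without a good event: the parts of all |z| above \<open>\<kappa> = sqrt (2 * l)\<close>
  are summed over all triples, and over all episodes they cost in expectation a term free of L. In
  the final constant 5, the leading term takes 4, and the lower-order terms take 1/5, 2/5 and
  2/5.\<close>

section \<open>Finite products of probability measures\<close>

lemma product_sigma_finite_if:
  assumes "\<And>j. j \<in> I \<Longrightarrow> prob_space (M j)"
  shows "product_sigma_finite (\<lambda>j. if j \<in> I then M j else return (count_space UNIV) undefined)"
  by (intro product_sigma_finite.intro)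
     (auto intro!: prob_space_imp_sigma_finite assms prob_space_return)

lemma nn_integral_PiM_insert:
  assumes "finite I" "i \<notin> I" and M: "\<And>j. j \<in> insert i I \<Longrightarrow> prob_space (M j)"
    and f: "f \<in> borel_measurable (PiM (insert i I) M)"
  shows "integral\<^sup>N (PiM (insert i I) M) f = (\<integral>\<^sup>+ x. (\<integral>\<^sup>+ y. f (x(i := y)) \<partial>(M i)) \<partial>(PiM I M))"
proof -
  \<comment> \<open>The locale \<open>product_sigma_finite\<close> speaks of all indices, while only
    those of the product are controlled here. A point mass elsewhere leaves the product
    unchanged.\<close>
  define N where "N = (\<lambda>j. if j \<in> insert i I then M j else return (count_space UNIV) undefined)"
  interpret product_sigma_finite N
    unfolding N_def by (intro product_sigma_finite_if M)
  have *: "PiM (insert i I) M = PiM (insert i I) N" "PiM I M = PiM I N" "M i = N i"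
    using assms(2) by (auto intro!: PiM_cong simp: N_def)
  show ?thesis
    using f unfolding * by (intro product_nn_integral_insert assms)
qed

lemma integral_PiM_insert:
  fixes f :: "_ \<Rightarrow> real"
  assumes "finite I" "i \<notin> I" and M: "\<And>j. j \<in> insert i I \<Longrightarrow> prob_space (M j)"
    and f: "integrable (PiM (insert i I) M) f"
  shows "integral\<^sup>L (PiM (insert i I) M) f = (\<integral> x. (\<integral> y. f (x(i := y)) \<partial>(M i)) \<partial>(PiM I M))"
proof -
  define N where "N = (\<lambda>j. if j \<in> insert i I then M j else return (count_space UNIV) undefined)"
  interpret product_sigma_finite N
    unfolding N_def by (intro product_sigma_finite_if M)
  have *: "PiM (insert i I) M = PiM (insert i I) N" "PiM I M = PiM I N" "M i = N i"
    using assms(2) by (auto intro!: PiM_cong simp: N_def)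
  show ?thesis
    using f unfolding * by (intro product_integral_insert assms)
qed

text \<open>Lifts a change of measure in one coordinate to the product by integrating that
  coordinate first. It is applied to a gamma coordinate inside a Dirichlet law, and again to a
  Dirichlet coordinate inside the prior on models.\<close>

lemma nn_integral_PiM_change_component:
  assumes I: "finite I" "i \<in> I"
    and M: "\<And>j. j \<in> I \<Longrightarrow> prob_space (M j)" and M': "prob_space M'"
    and [measurable_cong]: "sets M' = sets (M i)"
    and w [measurable]: "w \<in> borel_measurable (M i)"
    and ch: "\<And>f. f \<in> borel_measurable (M i) \<Longrightarrow> (\<integral>\<^sup>+ y. f y * w y \<partial>M i) = r * (\<integral>\<^sup>+ y. f y \<partial>M')"
    and F: "F \<in> borel_measurable (PiM I M)"
  shows "(\<integral>\<^sup>+ x. F x * w (x i) \<partial>PiM I M) = r * (\<integral>\<^sup>+ x. F x \<partial>PiM I (M(i := M')))"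
proof -
  define J where "J = I - {i}"
  have I_eq: "I = insert i J" "i \<notin> J" "finite J" using I by (auto simp: J_def)
  have F [measurable]: "F \<in> borel_measurable (PiM (insert i J) M)" using F by (simp add: I_eq)
  have J_eq: "PiM J (M(i := M')) = PiM J M"
    using I_eq by (intro PiM_cong) auto
  have sM: "sets (PiM (insert i J) (M(i := M'))) = sets (PiM (insert i J) M)"
    by (intro sets_PiM_cong) (auto simp: assms(5))
  have F' : "F \<in> borel_measurable (PiM (insert i J) (M(i := M')))"
    using F measurable_cong_sets[OF sM refl] by blast
  have Fx: "(\<lambda>y. F (x(i := y))) \<in> borel_measurable (M i)" if "x \<in> space (PiM J M)" for x
    using measurable_comp[OF measurable_component_update F, OF that \<open>i \<notin> J\<close>] by (simp add: comp_def fun_upd_def)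
  have Mi: "prob_space (M i)" using M I by auto
  have sp: "sigma_finite_measure (M i)" "sigma_finite_measure M'"
    using Mi M' by (simp_all add: prob_space_imp_sigma_finite)
  have m1: "(\<lambda>x. \<integral>\<^sup>+ y. F (x(i := y)) \<partial>M') \<in> borel_measurable (PiM J M)"
  proof -
    interpret sigma_finite_measure M' by (rule sp)
    show ?thesis by measurable
  qed
  have "(\<integral>\<^sup>+ x. F x * w (x i) \<partial>PiM I M) = (\<integral>\<^sup>+ x. (\<integral>\<^sup>+ y. F (x(i := y)) * w y \<partial>M i) \<partial>PiM J M)"
    unfolding I_eq(1) using I_eq M by (subst nn_integral_PiM_insert) auto
  also have "\<dots> = (\<integral>\<^sup>+ x. r * (\<integral>\<^sup>+ y. F (x(i := y)) \<partial>M') \<partial>PiM J M)"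
    by (intro nn_integral_cong ch Fx)
  also have "\<dots> = r * (\<integral>\<^sup>+ x. (\<integral>\<^sup>+ y. F (x(i := y)) \<partial>M') \<partial>PiM J M)"
    by (intro nn_integral_cmult m1)
  also have "(\<integral>\<^sup>+ x. (\<integral>\<^sup>+ y. F (x(i := y)) \<partial>M') \<partial>PiM J M) = (\<integral>\<^sup>+ x. F x \<partial>PiM I (M(i := M')))"
    unfolding I_eq(1) using I_eq M M' F' by (subst nn_integral_PiM_insert) (auto simp: J_eq)
  finally show ?thesis .
qed

subsection \<open>Gamma laws\<close>

lemma sets_gamma_dist [simp, measurable_cong]: "sets (gamma_dist a) = sets borel"
  by (simp add: gamma_dist_def)

lemma space_gamma_dist [simp]: "space (gamma_dist a) = UNIV"
  by (simp add: gamma_dist_def)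

lemma nn_integral_gamma_dist:
  assumes "0 < a" and [measurable]: "f \<in> borel_measurable borel"
  shows "(\<integral>\<^sup>+ x. f x \<partial>gamma_dist a) =
    (\<integral>\<^sup>+ x. ennreal (if x > 0 then x powr (a - 1) * exp (- x) / Gamma a else 0) * f x \<partial>lborel)"
  using assms(1) unfolding gamma_dist_def by (simp add: nn_integral_density)

lemma prob_space_gamma_dist:
  assumes "0 \<le> a"
  shows "prob_space (gamma_dist a)"
proof (cases "a = 0")
  case True
  then show ?thesis by (simp add: gamma_dist_def prob_space_return)
next
  case False
  with assms have a: "0 < a" by simp
  have "(\<integral>\<^sup>+ x. 1 \<partial>gamma_dist a) =
      (\<integral>\<^sup>+ x. ennreal (1 / Gamma a) * ennreal (indicator {0..} x * x powr (a - 1) / exp x) \<partial>lborel)"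
  proof (subst nn_integral_gamma_dist[OF a], simp, intro nn_integral_cong_AE AE_I[of _ _ "{0}"])
    have "ennreal (if x > 0 then x powr (a - 1) * exp (- x) / Gamma a else 0) * 1 =
        ennreal (1 / Gamma a) * ennreal (indicator {0..} x * x powr (a - 1) / exp x)" if "x \<noteq> 0" for x
      using that Gamma_real_pos[OF a]
      by (cases "0 < x") (auto simp: exp_minus field_simps ennreal_mult'[symmetric])
    then show "{x \<in> space lborel. ennreal (if x > 0 then x powr (a - 1) * exp (- x) / Gamma a else 0) * 1 \<noteq>
        ennreal (1 / Gamma a) * ennreal (indicator {0..} x * x powr (a - 1) / exp x)} \<subseteq> {0}"
      by blast
  qed simp_all
  also have "\<dots> = ennreal (1 / Gamma a) * ennreal (Gamma a)"
    using a by (subst nn_integral_cmult) (auto simp: Gamma_conv_nn_integral_real)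
  also have "\<dots> = 1"
    using Gamma_real_pos[OF a] by (simp add: ennreal_mult'[symmetric])
  finally show ?thesis
    by (intro prob_spaceI) simp
qed

lemma AE_gamma_dist_pos:
  assumes "0 < a"
  shows "AE x in gamma_dist a. 0 < x"
  using assms unfolding gamma_dist_def by (simp add: AE_density)

lemma AE_gamma_dist_nonneg:
  assumes "0 \<le> a"
  shows "AE x in gamma_dist a. 0 \<le> x"
proof (cases "a = 0")
  case True
  have "AE x in return borel (0::real). 0 \<le> x"
    by (subst AE_return) auto
  then show ?thesis unfolding True gamma_dist_def by simp
next
  case False
  then show ?thesis using AE_gamma_dist_pos[of a] assms by (auto elim!: eventually_mono)
qed

text \<open>Exponential tilting changes the unit rate to rate \<open>t\<close>, which is a
  rescaling; the factor \<open>t powr (- a)\<close> is the Laplace transform of the gamma law. At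
  shape 0 the point mass at 0 is untouched by both.\<close>

lemma nn_integral_gamma_dist_scale:
  assumes "0 \<le> a" "0 < t" and [measurable]: "f \<in> borel_measurable borel"
  shows "(\<integral>\<^sup>+ x. f x * ennreal (exp (- (t - 1) * x)) \<partial>gamma_dist a) =
    ennreal (t powr (- a)) * (\<integral>\<^sup>+ x. f (x / t) \<partial>gamma_dist a)"
proof (cases "a = 0")
  case True
  then show ?thesis using assms
    by (simp add: gamma_dist_def nn_integral_return)
next
  case False
  with assms have a: "0 < a" by simp
  have G: "Gamma a > 0" using a by (rule Gamma_real_pos)
  let ?d = "\<lambda>x. if x > 0 then x powr (a - 1) * exp (- x) / Gamma a else 0"
  have "ennreal (t powr (- a)) * (\<integral>\<^sup>+ x. f (x / t) \<partial>gamma_dist a)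
      = ennreal (t powr (- a)) * (\<integral>\<^sup>+ x. ennreal (?d x) * f (x / t) \<partial>lborel)"
    by (subst nn_integral_gamma_dist[OF a]) auto
  also have "\<dots> = ennreal (t powr (- a)) * (ennreal t * (\<integral>\<^sup>+ y. ennreal (?d (t * y)) * f y \<partial>lborel))"
    using \<open>0 < t\<close> by (subst nn_integral_real_affine[of _ t 0]) (auto cong: if_cong)
  also have "\<dots> = (\<integral>\<^sup>+ y. ennreal (t powr (- a)) * (ennreal t * (ennreal (?d (t * y)) * f y)) \<partial>lborel)"
    by (simp add: nn_integral_cmult)
  also have "\<dots> = (\<integral>\<^sup>+ y. ennreal (?d y) * (f y * ennreal (exp (- (t - 1) * y))) \<partial>lborel)"
  proof (intro nn_integral_cong)
    fix y
    have ac: "A * (B * (C * u)) = D * (u * E)" if "A * (B * C) = D * E" for A B C D E u :: ennreal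
      using arg_cong[OF that, of "\<lambda>v. v * u"] by (simp add: mult_ac)
    have "t powr (- a) * (t * ?d (t * y)) = ?d y * exp (- (t - 1) * y)"
    proof (cases "0 < y")
      case True
      have "t powr (- a) * t * (t * y) powr (a - 1) = y powr (a - 1)"
      proof -
        have "t powr (- a) * t * (t * y) powr (a - 1) = (t powr (- a) * t powr 1 * t powr (a - 1)) * y powr (a - 1)"
          using True \<open>0 < t\<close> by (simp add: powr_mult)
        also have "t powr (- a) * t powr 1 * t powr (a - 1) = 1"
          using \<open>0 < t\<close> by (simp only: powr_add[symmetric]) simp
        finally show ?thesis by simp
      qed
      then have A: "t powr (- a) * t * (t * y) powr (a - 1) = y powr (a - 1)" .
      have B: "exp (- (t * y)) = exp (- y) * exp (- (t - 1) * y)"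
        by (simp add: exp_add[symmetric] algebra_simps)
      have "0 < t * y" using True \<open>0 < t\<close> by simp
      then have "t powr (- a) * (t * ?d (t * y)) = (t powr (- a) * t * (t * y) powr (a - 1)) * exp (- (t * y)) / Gamma a"
        by simp
      also have "\<dots> = ?d y * exp (- (t - 1) * y)"
        unfolding A B using True by simp
      finally show ?thesis .
    next
      case False
      then show ?thesis using \<open>0 < t\<close> by (simp add: zero_less_mult_iff)
    qed
    moreover have "0 \<le> ?d (t * y)" "0 \<le> ?d y" using G by auto
    moreover have "ennreal (p * (t * q)) = ennreal p * (ennreal t * ennreal q)" if "0 \<le> p" "0 \<le> q" for p q
      using that \<open>0 < t\<close> by (simp add: ennreal_mult)
    ultimately have "ennreal (t powr (- a)) * (ennreal t * ennreal (?d (t * y))) = ennreal (?d y) * ennreal (exp (- (t - 1) * y))"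
      by (metis ennreal_mult exp_ge_zero powr_ge_zero)
    then show "ennreal (t powr (- a)) * (ennreal t * (ennreal (?d (t * y)) * f y)) =
        ennreal (?d y) * (f y * ennreal (exp (- (t - 1) * y)))"
      by (rule ac)
  qed
  also have "\<dots> = (\<integral>\<^sup>+ x. f x * ennreal (exp (- (t - 1) * x)) \<partial>gamma_dist a)"
    by (subst nn_integral_gamma_dist[OF a]) auto
  finally show ?thesis ..
qed

text \<open>Size biasing of a gamma law: the factor \<open>x\<close> is absorbed into the power of
  the density, and \<open>Gamma (a + 1) = a * Gamma a\<close> corrects the normalization.\<close>

lemma nn_integral_gamma_dist_shape:
  assumes a: "0 < a" and [measurable]: "f \<in> borel_measurable borel"
  shows "(\<integral>\<^sup>+ x. f x * ennreal x \<partial>gamma_dist a) = ennreal a * (\<integral>\<^sup>+ x. f x \<partial>gamma_dist (a + 1))"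
proof -
  have G: "Gamma a > 0" using a by (rule Gamma_real_pos)
  have G1: "Gamma (a + 1) = a * Gamma a" using a by (intro Gamma_plus1) auto
  let ?d = "\<lambda>a x. if x > 0 then x powr (a - 1) * exp (- x) / Gamma a else 0"
  have "(\<integral>\<^sup>+ x. f x * ennreal x \<partial>gamma_dist a) = (\<integral>\<^sup>+ x. ennreal (?d a x) * (f x * ennreal x) \<partial>lborel)"
    by (subst nn_integral_gamma_dist[OF a]) auto
  also have "\<dots> = (\<integral>\<^sup>+ x. ennreal a * (ennreal (?d (a + 1) x) * f x) \<partial>lborel)"
  proof (intro nn_integral_cong)
    fix x :: real
    have ac: "A * (u * B) = C * (D * u)" if "A * B = C * D" for A B C D u :: ennreal
      using arg_cong[OF that, of "\<lambda>v. v * u"] by (simp add: mult_ac)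
    have "ennreal (?d a x) * ennreal x = ennreal a * ennreal (?d (a + 1) x)"
    proof (cases "0 < x")
      case True
      have "x powr a = x powr (a - 1) * x" using True by (simp add: powr_mult_base[symmetric] mult.commute powr_diff)
      then have "?d a x * x = a * ?d (a + 1) x" using True a by (simp add: G1)
      then show ?thesis using True a by (metis ennreal_mult'' ennreal_mult' less_imp_le)
    qed simp
    then show "ennreal (?d a x) * (f x * ennreal x) = ennreal a * (ennreal (?d (a + 1) x) * f x)"
      by (rule ac)
  qed
  also have "\<dots> = ennreal a * (\<integral>\<^sup>+ x. f x \<partial>gamma_dist (a + 1))"
    using a by (subst nn_integral_gamma_dist) (auto simp: nn_integral_cmult)
  finally show ?thesis .
qed

text \<open>The weight factorizes over independent coordinates, so all are tilted at the same rate
  and the exponents add. The restriction to \<open>J\<close> keeps the rescaled vector extensional,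
  as the product space demands.\<close>

lemma nn_integral_PiM_gamma_scale:
  assumes "finite J" "0 < t" "\<And>j. j \<in> J \<Longrightarrow> 0 \<le> a j" and "f \<in> borel_measurable (PiM J (\<lambda>_. borel))"
  shows "(\<integral>\<^sup>+ g. f g * ennreal (exp (- (t - 1) * (\<Sum>j\<in>J. g j))) \<partial>PiM J (\<lambda>j. gamma_dist (a j))) =
    ennreal (t powr (- (\<Sum>j\<in>J. a j))) * (\<integral>\<^sup>+ g. f (\<lambda>j\<in>J. g j / t) \<partial>PiM J (\<lambda>j. gamma_dist (a j)))"
  using assms(1,3,4)
proof (induction J arbitrary: f rule: finite_induct)
  case empty
  then show ?case using \<open>0 < t\<close> by (simp add: PiM_empty nn_integral_count_space_finite)
next
  case (insert i J)
  have sf: "sigma_finite_measure (gamma_dist (a i))"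
    using insert.hyps insert.prems by (intro prob_space_imp_sigma_finite prob_space_gamma_dist) auto
  have pj: "prob_space (gamma_dist (a j))" if "j \<in> insert i J" for j
    using insert.hyps insert.prems that by (intro prob_space_gamma_dist) auto
  have sets_eq: "sets (PiM K (\<lambda>j. gamma_dist (a j))) = sets (PiM K (\<lambda>_. borel))" for K
    by (intro sets_PiM_cong) auto
  note [measurable_cong] = sets_eq
  have [measurable]: "f \<in> borel_measurable (PiM (insert i J) (\<lambda>_. borel))" by (rule insert.prems)
  have upd: "(\<lambda>y. x(i := y)) \<in> measurable borel (PiM (insert i J) (\<lambda>_. borel))"
    if "x \<in> space (PiM J (\<lambda>_. borel))" for x :: "_ \<Rightarrow> real"
    by (rule measurable_component_update[OF that insert.hyps(2)])
  have fx: "(\<lambda>y. f (x(i := y))) \<in> borel_measurable borel" if "x \<in> space (PiM J (\<lambda>_. borel))" for x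
    by (rule measurable_compose[OF upd[OF that] insert.prems(2)])
  have sp: "space (PiM J (\<lambda>j. gamma_dist (a j))) = space (PiM J (\<lambda>_. borel))"
    by (intro sets_eq_imp_space_eq sets_eq)
  define F where "F = (\<lambda>x. \<integral>\<^sup>+ y. f (x(i := y / t)) \<partial>gamma_dist (a i))"
  have F_meas [measurable]: "F \<in> borel_measurable (PiM J (\<lambda>_. borel))"
  proof -
    interpret sigma_finite_measure "gamma_dist (a i)" by (rule sf)
    show ?thesis unfolding F_def by measurable
  qed
  have "(\<integral>\<^sup>+ g. f g * ennreal (exp (- (t - 1) * (\<Sum>j\<in>insert i J. g j))) \<partial>PiM (insert i J) (\<lambda>j. gamma_dist (a j)))
    = (\<integral>\<^sup>+ x. \<integral>\<^sup>+ y. f (x(i := y)) * ennreal (exp (- (t - 1) * (\<Sum>j\<in>insert i J. (x(i := y)) j))) \<partial>gamma_dist (a i) \<partial>PiM J (\<lambda>j. gamma_dist (a j)))"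
    using insert.hyps insert.prems pj by (intro nn_integral_PiM_insert) (auto intro!: prob_space_gamma_dist, measurable)
  also have "\<dots> = (\<integral>\<^sup>+ x. ennreal (exp (- (t - 1) * (\<Sum>j\<in>J. x j))) * (ennreal (t powr (- a i)) * F x) \<partial>PiM J (\<lambda>j. gamma_dist (a j)))"
  proof (intro nn_integral_cong)
    fix x assume x: "x \<in> space (PiM J (\<lambda>j. gamma_dist (a j)))"
    then have x': "x \<in> space (PiM J (\<lambda>_. borel))" by (simp add: sp)
    have s: "(\<Sum>j\<in>insert i J. (x(i := y)) j) = y + (\<Sum>j\<in>J. x j)" for y
    proof -
      have "(\<Sum>j\<in>J. (x(i := y)) j) = (\<Sum>j\<in>J. x j)"
        using insert.hyps insert.prems by (intro sum.cong) auto
      then show ?thesis using insert.hyps insert.prems by simp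
    qed
    define h where "h = (\<lambda>y. f (x(i := y)))"
    have hm [measurable]: "h \<in> borel_measurable borel" unfolding h_def by (rule fx[OF x'])
    have Fx: "F x = (\<integral>\<^sup>+ y. h (y / t) \<partial>gamma_dist (a i))" by (simp add: F_def h_def)
    have "(\<integral>\<^sup>+ y. h y * ennreal (exp (- (t - 1) * (\<Sum>j\<in>insert i J. (x(i := y)) j))) \<partial>gamma_dist (a i))
      = (\<integral>\<^sup>+ y. ennreal (exp (- (t - 1) * (\<Sum>j\<in>J. x j))) * (h y * ennreal (exp (- (t - 1) * y))) \<partial>gamma_dist (a i))"
    proof (intro nn_integral_cong)
      fix y
      have "exp (- (t - 1) * (y + (\<Sum>j\<in>J. x j))) = exp (- (t - 1) * (\<Sum>j\<in>J. x j)) * exp (- (t - 1) * y)"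
        by (simp add: exp_add[symmetric] algebra_simps)
      then show "h y * ennreal (exp (- (t - 1) * (\<Sum>j\<in>insert i J. (x(i := y)) j))) =
         ennreal (exp (- (t - 1) * (\<Sum>j\<in>J. x j))) * (h y * ennreal (exp (- (t - 1) * y)))"
        unfolding s by (simp add: ennreal_mult' mult_ac)
    qed
    also have "\<dots> = ennreal (exp (- (t - 1) * (\<Sum>j\<in>J. x j))) * (\<integral>\<^sup>+ y. h y * ennreal (exp (- (t - 1) * y)) \<partial>gamma_dist (a i))"
      by (intro nn_integral_cmult) measurable
    also have "(\<integral>\<^sup>+ y. h y * ennreal (exp (- (t - 1) * y)) \<partial>gamma_dist (a i)) = ennreal (t powr (- a i)) * F x"
      unfolding Fx using insert.prems(1) hm \<open>0 < t\<close>
      by (intro nn_integral_gamma_dist_scale) auto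
    finally show "(\<integral>\<^sup>+ y. f (x(i := y)) * ennreal (exp (- (t - 1) * (\<Sum>j\<in>insert i J. (x(i := y)) j))) \<partial>gamma_dist (a i)) =
      ennreal (exp (- (t - 1) * (\<Sum>j\<in>J. x j))) * (ennreal (t powr (- a i)) * F x)"
      by (simp add: h_def)
  qed
  also have "\<dots> = ennreal (t powr (- a i)) * (\<integral>\<^sup>+ x. F x * ennreal (exp (- (t - 1) * (\<Sum>j\<in>J. x j))) \<partial>PiM J (\<lambda>j. gamma_dist (a j)))"
    by (subst nn_integral_cmult[symmetric]) (auto simp: mult_ac)
  also have "(\<integral>\<^sup>+ x. F x * ennreal (exp (- (t - 1) * (\<Sum>j\<in>J. x j))) \<partial>PiM J (\<lambda>j. gamma_dist (a j)))
    = ennreal (t powr (- (\<Sum>j\<in>J. a j))) * (\<integral>\<^sup>+ g. F (\<lambda>j\<in>J. g j / t) \<partial>PiM J (\<lambda>j. gamma_dist (a j)))"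
    using insert.hyps insert.prems by (intro insert.IH) auto
  also have "(\<integral>\<^sup>+ g. F (\<lambda>j\<in>J. g j / t) \<partial>PiM J (\<lambda>j. gamma_dist (a j))) =
      (\<integral>\<^sup>+ x. \<integral>\<^sup>+ y. f (\<lambda>j\<in>insert i J. (x(i := y)) j / t) \<partial>gamma_dist (a i) \<partial>PiM J (\<lambda>j. gamma_dist (a j)))"
    unfolding F_def using insert
    by (intro nn_integral_cong arg_cong[where f = f]) (auto simp: fun_eq_iff restrict_def)
  also have "\<dots> = (\<integral>\<^sup>+ g. f (\<lambda>j\<in>insert i J. g j / t) \<partial>PiM (insert i J) (\<lambda>j. gamma_dist (a j)))"
    using insert.hyps insert.prems pj by (intro nn_integral_PiM_insert[symmetric]) (auto intro!: prob_space_gamma_dist, measurable)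
  finally show ?case
    using insert.hyps insert.prems \<open>0 < t\<close> by (simp add: mult.assoc[symmetric] ennreal_mult'[symmetric] powr_add[symmetric] restrict_def)
qed

lemma nn_integral_exp_tail:
  assumes "0 < S"
  shows "(\<integral>\<^sup>+ t. ennreal (exp (- (t - 1) * S)) * indicator {1..} t \<partial>lborel) = ennreal (1 / S)"
proof -
  have "(\<integral>\<^sup>+ t. ennreal (exp (- (t - 1) * S)) * indicator {1..} t \<partial>lborel) = ennreal (0 - (- exp (- (1 - 1) * S) / S))"
  proof (rule nn_integral_FTC_atLeast[where F = "\<lambda>t. - exp (- (t - 1) * S) / S"])
    show "((\<lambda>t. - exp (- (t - 1) * S) / S) \<longlongrightarrow> 0) at_top"
      using assms by real_asymp
    show "((\<lambda>t. - exp (- (t - 1) * S) / S) has_real_derivative exp (- (t - 1) * S)) (at t)" for t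
      using assms by (auto intro!: derivative_eq_intros)
  qed auto
  then show ?thesis using assms by simp
qed

lemma nn_integral_powr_tail:
  fixes c :: real
  assumes "1 < c"
  shows "(\<integral>\<^sup>+ t. ennreal (t powr (- c)) * indicator {1..} t \<partial>lborel) = ennreal (1 / (c - 1))"
proof -
  have "(\<integral>\<^sup>+ t. ennreal (t powr (- c)) * indicator {1..} t \<partial>lborel) = ennreal (0 - (- (1 powr (1 - c) / (c - 1))))"
  proof (rule nn_integral_FTC_atLeast[where F = "\<lambda>t. - (t powr (1 - c) / (c - 1))"])
    show "((\<lambda>t. - (t powr (1 - c) / (c - 1))) \<longlongrightarrow> 0) at_top"
      using assms by real_asymp
    show "((\<lambda>t. - (t powr (1 - c) / (c - 1))) has_real_derivative t powr (- c)) (at t)" if "1 \<le> t" for t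
    proof -
      have "((\<lambda>t. - (t powr (1 - c) / (c - 1))) has_real_derivative - ((1 - c) * t powr (1 - c - 1) / (c - 1))) (at t)"
        using that by (intro DERIV_minus DERIV_cdivide has_real_derivative_powr) auto
      moreover have "- ((1 - c) * t powr (1 - c - 1) / (c - 1)) = t powr (- c)"
        using assms by (simp add: field_simps)
      ultimately show ?thesis by simp
    qed
  qed auto
  then show ?thesis by simp
qed

subsection \<open>Dirichlet laws\<close>

lemma sets_PiM_gamma: "sets (PiM UNIV (\<lambda>i. gamma_dist (a i))) = sets (PiM UNIV (\<lambda>_. borel))"
  by (intro sets_PiM_cong) auto

lemma measurable_normalize [measurable]:
  "(\<lambda>g i. g i / sum g UNIV) \<in> measurable (PiM UNIV (\<lambda>_. borel)) (PiM UNIV (\<lambda>_::'o. borel :: real measure))"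
  by (rule measurable_PiM_single') (auto simp: space_PiM)

lemma measurable_normalize_gamma:
  "(\<lambda>g i. g i / sum g UNIV) \<in> measurable (PiM UNIV (\<lambda>i. gamma_dist (a i))) (PiM UNIV (\<lambda>_::'o::finite. borel))"
  using measurable_normalize measurable_cong_sets[OF sets_PiM_gamma refl] by blast

context
  fixes a :: "'o::finite \<Rightarrow> real"
  assumes a_nonneg: "\<And>i. 0 \<le> a i" and a_pos: "0 < sum a UNIV"
begin

lemma prob_space_PiM_gamma: "prob_space (PiM UNIV (\<lambda>i. gamma_dist (a i)))"
  by (intro prob_space_PiM prob_space_gamma_dist a_nonneg)

lemma AE_gamma_nonneg: "AE g in PiM UNIV (\<lambda>i. gamma_dist (a i)). \<forall>i. 0 \<le> g i"
proof -
  have "AE g in PiM UNIV (\<lambda>i. gamma_dist (a i)). \<forall>i\<in>UNIV. 0 \<le> g i"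
    by (intro eventually_ball_finite ballI AE_PiM_component prob_space_gamma_dist a_nonneg AE_gamma_dist_nonneg) auto
  then show ?thesis by simp
qed

lemma AE_gamma_sum_pos: "AE g in PiM UNIV (\<lambda>i. gamma_dist (a i)). 0 < sum g UNIV"
proof -
  obtain k where k: "0 < a k"
    using a_pos a_nonneg by (metis less_irrefl linorder_not_less nle_le sum_nonpos)
  have "AE g in PiM UNIV (\<lambda>i. gamma_dist (a i)). 0 < g k"
    by (intro AE_PiM_component prob_space_gamma_dist a_nonneg AE_gamma_dist_pos k) auto
  then show ?thesis using AE_gamma_nonneg
  proof eventually_elim
    case (elim g)
    then show ?case by (intro sum_pos2[of _ k]) auto
  qed
qed

text \<open>For maps that are homogeneous of degree 0, writing \<open>1/S\<close> as \<open>\<integral>\<^sub>1\<^sup>\<infinity> exp (-(t - 1) S) dt\<close> and scaling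
  by \<open>t\<close> separates the sum \<open>S\<close> from the normalized vector without a change to polar coordinates.\<close>
lemma nn_integral_PiM_gamma_div_sum:
  assumes K [measurable]: "K \<in> borel_measurable (PiM UNIV (\<lambda>_. borel))"
    and hom: "\<And>t g. 0 < t \<Longrightarrow> K (\<lambda>i. g i / t) = K g"
    and c: "1 < sum a UNIV"
  shows "(\<integral>\<^sup>+ g. K g * ennreal (1 / sum g UNIV) \<partial>PiM UNIV (\<lambda>i. gamma_dist (a i)))
    = ennreal (1 / (sum a UNIV - 1)) * (\<integral>\<^sup>+ g. K g \<partial>PiM UNIV (\<lambda>i. gamma_dist (a i)))"
proof -
  let ?G = "PiM UNIV (\<lambda>i. gamma_dist (a i))"
  let ?c = "\<Sum>i\<in>UNIV. a i"
  note [measurable_cong] = sets_PiM_gamma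
  interpret G: prob_space ?G by (rule prob_space_PiM_gamma)
  interpret pair_sigma_finite lborel ?G ..
  have "(\<integral>\<^sup>+ g. K g * ennreal (1 / sum g UNIV) \<partial>?G)
      = (\<integral>\<^sup>+ g. (\<integral>\<^sup>+ t. K g * (ennreal (exp (- (t - 1) * sum g UNIV)) * indicator {1..} t) \<partial>lborel) \<partial>?G)"
    using AE_gamma_sum_pos
  proof (intro nn_integral_cong_AE, eventually_elim)
    case (elim g)
    show ?case
      unfolding nn_integral_exp_tail[OF elim(2), symmetric] by (intro nn_integral_cmult[symmetric]) measurable
  qed
  also have "\<dots> = (\<integral>\<^sup>+ t. (\<integral>\<^sup>+ g. K g * (ennreal (exp (- (t - 1) * sum g UNIV)) * indicator {1..} t) \<partial>?G) \<partial>lborel)"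
    by (intro Fubini') measurable
  also have "\<dots> = (\<integral>\<^sup>+ t. (\<integral>\<^sup>+ g. K g \<partial>?G) * (ennreal (t powr (- ?c)) * indicator {1..} t) \<partial>lborel)"
  proof (intro nn_integral_cong)
    fix t :: real
    show "(\<integral>\<^sup>+ g. K g * (ennreal (exp (- (t - 1) * sum g UNIV)) * indicator {1..} t) \<partial>?G)
        = (\<integral>\<^sup>+ g. K g \<partial>?G) * (ennreal (t powr (- ?c)) * indicator {1..} t)"
    proof (cases "1 \<le> t")
      case True
      then have "(\<integral>\<^sup>+ g. K g * ennreal (exp (- (t - 1) * sum g UNIV)) \<partial>?G)
          = ennreal (t powr (- ?c)) * (\<integral>\<^sup>+ g. K (\<lambda>i\<in>UNIV. g i / t) \<partial>?G)"
        using a_nonneg by (intro nn_integral_PiM_gamma_scale) auto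
      with True hom[of t] show ?thesis by (simp add: mult.commute restrict_def)
    qed simp
  qed
  also have "\<dots> = (\<integral>\<^sup>+ g. K g \<partial>?G) * ennreal (1 / (?c - 1))"
    using c by (simp add: nn_integral_cmult nn_integral_powr_tail)
  finally show ?thesis by (simp add: mult.commute)
qed

lemma prob_space_dirichlet: "prob_space (dirichlet a)"
  unfolding dirichlet_def
  by (intro prob_space.prob_space_distr prob_space_PiM_gamma)
     (rule measurable_normalize_gamma)

lemma AE_dirichlet_simplex:
  "AE p in dirichlet a. (\<forall>i. 0 \<le> p i) \<and> sum p UNIV = 1"
proof -
  have "AE g in PiM UNIV (\<lambda>i. gamma_dist (a i)).
      (\<forall>i. 0 \<le> g i / sum g UNIV) \<and> (\<Sum>i\<in>UNIV. g i / sum g UNIV) = 1"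
    using AE_gamma_nonneg AE_gamma_sum_pos
    by eventually_elim (auto simp: sum_divide_distrib[symmetric] sum_nonneg)
  then show ?thesis
    unfolding dirichlet_def
    using measurable_normalize_gamma[of a]
    by (subst AE_distr_iff) simp_all
qed

end

lemma sets_dirichlet [simp, measurable_cong]: "sets (dirichlet a) = sets (PiM UNIV (\<lambda>_. borel))"
  by (simp add: dirichlet_def)

lemma space_dirichlet [simp]: "space (dirichlet a) = UNIV"
  by (simp add: dirichlet_def space_PiM)

lemma nn_integral_dirichlet:
  assumes [measurable]: "f \<in> borel_measurable (PiM UNIV (\<lambda>_. borel))"
  shows "(\<integral>\<^sup>+ p. f p \<partial>dirichlet a) =
    (\<integral>\<^sup>+ g. f (\<lambda>i. g i / sum g UNIV) \<partial>PiM UNIV (\<lambda>i. gamma_dist (a i)))"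
  unfolding dirichlet_def
  using measurable_normalize_gamma[of a]
  by (subst nn_integral_distr) simp_all

text \<open>Conjugacy. With independent gammas \<open>g\<close> and their sum S, the weight is
  \<open>g y\<close> times 1/S: the first factor raises the shape at \<open>y\<close>, and the
  second decouples from the normalized vector because the remaining integrand is homogeneous of
  degree 0.\<close>

lemma nn_integral_dirichlet_mult:
  fixes a :: "'o::finite \<Rightarrow> real"
  assumes a_nonneg: "\<And>i. 0 \<le> a i" and a_pos: "0 < sum a UNIV"
    and f [measurable]: "f \<in> borel_measurable (PiM UNIV (\<lambda>_. borel))"
  shows "(\<integral>\<^sup>+ p. f p * ennreal (p y) \<partial>dirichlet a) =
    ennreal (a y / sum a UNIV) * (\<integral>\<^sup>+ p. f p \<partial>dirichlet (a(y := a y + 1)))"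
proof -
  let ?c = "\<Sum>i\<in>UNIV. a i" and ?G = "PiM UNIV (\<lambda>i. gamma_dist (a i))"
  let ?K = "\<lambda>g. f (\<lambda>i. g i / sum g UNIV)"
  note [measurable_cong] = sets_PiM_gamma
  have K [measurable]: "?K \<in> borel_measurable (PiM UNIV (\<lambda>_. borel))"
    by measurable
  have "(\<integral>\<^sup>+ p. f p * ennreal (p y) \<partial>dirichlet a) = (\<integral>\<^sup>+ g. ?K g * ennreal (g y / sum g UNIV) \<partial>?G)"
    by (subst nn_integral_dirichlet) auto
  also have "\<dots> = ennreal (a y / ?c) * (\<integral>\<^sup>+ p. f p \<partial>dirichlet (a(y := a y + 1)))"
  proof (cases "a y = 0")
    case True
    \<comment> \<open>Size biasing requires a positive shape. At shape 0 the coordinate is almost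
      surely 0 and both sides vanish.\<close>
    have "AE x in gamma_dist (a y). x = 0"
      unfolding True gamma_dist_def by (simp, subst AE_return) auto
    then have "AE g in ?G. g y = 0"
      by (intro AE_PiM_component prob_space_gamma_dist a_nonneg) auto
    then have "(\<integral>\<^sup>+ g. ?K g * ennreal (g y / sum g UNIV) \<partial>?G) = (\<integral>\<^sup>+ g. 0 \<partial>?G)"
      by (intro nn_integral_cong_AE) (auto elim!: eventually_mono)
    then show ?thesis by (simp add: True)
  next
    case False
    with a_nonneg[of y] have ay: "0 < a y" by simp
    define b where "b = a(y := a y + 1)"
    have b_nonneg: "0 \<le> b i" for i using a_nonneg by (simp add: b_def add_nonneg_nonneg)
    have b_sum: "sum b UNIV = ?c + 1"
    proof -
      have "sum b UNIV = (\<Sum>i\<in>UNIV. a i + (if i = y then 1 else 0))"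
        by (intro sum.cong) (auto simp: b_def)
      then show ?thesis by (simp add: sum.distrib)
    qed
    let ?Kb = "\<lambda>g. ?K g * ennreal (1 / sum g UNIV)"
    have "(\<integral>\<^sup>+ g. ?K g * ennreal (g y / sum g UNIV) \<partial>?G) = (\<integral>\<^sup>+ g. ?Kb g * ennreal (g y) \<partial>?G)"
      using AE_gamma_nonneg[OF a_nonneg a_pos]
    proof (intro nn_integral_cong_AE, eventually_elim)
      case (elim g)
      have "ennreal (g y / sum g UNIV) = ennreal (1 / sum g UNIV) * ennreal (g y)"
        using elim by (subst ennreal_mult'[symmetric]) (auto simp: sum_nonneg)
      then show ?case by (simp add: mult.assoc)
    qed
    also have "\<dots> = ennreal (a y) * (\<integral>\<^sup>+ g. ?Kb g \<partial>PiM UNIV ((\<lambda>i. gamma_dist (a i))(y := gamma_dist (a y + 1))))"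
      using ay a_nonneg
      by (intro nn_integral_PiM_change_component[where w = ennreal])
         (auto intro!: prob_space_gamma_dist nn_integral_gamma_dist_shape simp: measurable_cong_sets[OF sets_gamma_dist refl])
    also have "(\<lambda>i. gamma_dist (a i))(y := gamma_dist (a y + 1)) = (\<lambda>i. gamma_dist (b i))"
      by (auto simp: b_def)
    \<comment> \<open>After the shape has been raised the total mass is \<open>?c + 1\<close>, which
      exceeds 1 whatever \<open>?c\<close> is, and the decoupling factor becomes
      \<open>1 / ?c\<close>.\<close>
    also have "(\<integral>\<^sup>+ g. ?Kb g \<partial>PiM UNIV (\<lambda>i. gamma_dist (b i))) = ennreal (1 / ?c) * (\<integral>\<^sup>+ g. ?K g \<partial>PiM UNIV (\<lambda>i. gamma_dist (b i)))"
    proof (subst nn_integral_PiM_gamma_div_sum)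
      show "f (\<lambda>i. g i / t / (\<Sum>j\<in>UNIV. g j / t)) = ?K g" if "0 < t" for t and g :: "'o \<Rightarrow> real"
        using that by (simp add: sum_divide_distrib[symmetric])
    qed (use b_nonneg b_sum a_pos in auto)
    also have "(\<integral>\<^sup>+ g. ?K g \<partial>PiM UNIV (\<lambda>i. gamma_dist (b i))) = (\<integral>\<^sup>+ p. f p \<partial>dirichlet b)"
      by (subst nn_integral_dirichlet) auto
    finally show ?thesis
      using ay a_pos by (simp add: b_def mult.assoc[symmetric] ennreal_mult'[symmetric])
  qed
  finally show ?thesis .
qed

text \<open>Tested on indicators, the identity says that two density measures coincide. Their
  Bochner integrals then agree for every measurable integrand, without separate integrability proofs
  for the two sides.\<close>

lemma integral_mult_eqI:
  fixes F w :: "'b \<Rightarrow> real"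
  assumes [measurable_cong]: "sets N = sets M"
    and [measurable]: "w \<in> borel_measurable M" "F \<in> borel_measurable M"
    and "AE x in M. 0 \<le> w x" "0 \<le> r"
    and eq: "\<And>G. G \<in> borel_measurable M \<Longrightarrow> (\<integral>\<^sup>+ x. G x * ennreal (w x) \<partial>M) = ennreal r * (\<integral>\<^sup>+ x. G x \<partial>N)"
  shows "(\<integral>x. w x * F x \<partial>M) = r * (\<integral>x. F x \<partial>N)"
proof -
  have "density M (\<lambda>x. ennreal (w x)) = density N (\<lambda>x. ennreal r)"
  proof (rule measure_eqI)
    fix A assume "A \<in> sets (density M (\<lambda>x. ennreal (w x)))"
    then have A [measurable]: "A \<in> sets M" by simp
    show "emeasure (density M (\<lambda>x. ennreal (w x))) A = emeasure (density N (\<lambda>x. ennreal r)) A"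
      using eq[of "indicator A"] by (simp add: emeasure_density mult.commute[of "ennreal _"] nn_integral_multc)
  qed (simp add: assms(1))
  then have "(\<integral>x. F x \<partial>density M (\<lambda>x. ennreal (w x))) = (\<integral>x. F x \<partial>density N (\<lambda>x. ennreal r))"
    by simp
  then show ?thesis
    using assms(4,5) by (simp add: integral_density)
qed

subsection \<open>Dirichlet priors on models\<close>

abbreviation expect :: "'b pmf \<Rightarrow> ('b \<Rightarrow> real) \<Rightarrow> real" where
  "expect p f \<equiv> measure_pmf.expectation p f"

abbreviation model_space :: "nat \<Rightarrow> ('x::finite, 'a) model measure" where
  "model_space H \<equiv> PiM (sa_space H) (\<lambda>_. PiM UNIV (\<lambda>_. borel))"

text \<open>The predictive law of the next outcome at \<open>s\<close> when the model is integrated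
  out.\<close>

definition mean_model :: "('x::finite, 'a) model \<Rightarrow> ('x, 'a) model" where
  "mean_model \<alpha> s y = \<alpha> s y / sum (\<alpha> s) UNIV"

definition observe :: "('x, 'a) model \<Rightarrow> ('x, 'a) transition \<Rightarrow> ('x, 'a) model" where
  "observe \<alpha> t = \<alpha>(fst t := (\<alpha> (fst t))(snd t := \<alpha> (fst t) (snd t) + 1))"

definition posterior :: "('x, 'a) transition list \<Rightarrow> ('x, 'a) model \<Rightarrow> ('x, 'a) model" where
  "posterior D \<alpha> s y = \<alpha> s y + real (count (buffer D s) y)"

definition admissible :: "nat \<Rightarrow> ('x::finite, 'a) model \<Rightarrow> bool" where
  "admissible H \<alpha> \<longleftrightarrow> (\<forall>s\<in>sa_space H. (\<forall>y. 0 \<le> \<alpha> s y) \<and> 0 < sum (\<alpha> s) UNIV)"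

lemma admissibleD:
  assumes "admissible H \<alpha>" "s \<in> sa_space H"
  shows "0 \<le> \<alpha> s y" "0 < sum (\<alpha> s) UNIV"
  using assms unfolding admissible_def by blast+

lemma mean_model_nonneg:
  assumes "admissible H \<alpha>" "s \<in> sa_space H"
  shows "0 \<le> mean_model \<alpha> s y"
  using admissibleD[OF assms] by (simp add: mean_model_def less_imp_le)

lemma finite_sa_space [simp]: "finite (sa_space H :: ('x::finite, 'a::finite) sa set)"
  by (simp add: sa_space_def)

lemma buffer_Nil [simp]: "buffer [] s = {#}"
  by (simp add: buffer_def)

lemma buffer_Cons [simp]: "buffer (t # D) s = (if fst t = s then add_mset (snd t) (buffer D s) else buffer D s)"
  by (simp add: buffer_def)

lemma buffer_append [simp]: "buffer (D @ D') s = buffer D s + buffer D' s"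
  by (induction D) auto

lemma posterior_Nil [simp]: "posterior [] \<alpha> = \<alpha>"
  by (simp add: posterior_def fun_eq_iff)

lemma posterior_observe: "posterior D (observe \<alpha> t) = posterior (t # D) \<alpha>"
  by (auto simp: posterior_def observe_def fun_eq_iff)

lemma posterior_posterior: "posterior D' (posterior D \<alpha>) = posterior (D @ D') \<alpha>"
  by (auto simp: posterior_def fun_eq_iff)

lemma sum_observe:
  "(\<Sum>y\<in>UNIV. observe \<alpha> t s y) = sum (\<alpha> s) UNIV + (if s = fst t then 1 else 0)"
  for \<alpha> :: "('x::finite, 'a) model"
proof -
  have "(\<Sum>y\<in>UNIV. observe \<alpha> t s y) = (\<Sum>y\<in>UNIV. \<alpha> s y + (if s = fst t \<and> y = snd t then 1 else 0))"
    by (intro sum.cong) (auto simp: observe_def)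
  then show ?thesis by (auto simp: sum.distrib)
qed

lemma sum_count_buffer: "(\<Sum>y\<in>UNIV. real (count (buffer D s) y)) = real (size (buffer D s))"
  for D :: "('x::finite, 'a) transition list"
  by (simp add: size_multiset_overloaded_eq flip: of_nat_sum)
     (intro sum.mono_neutral_right, auto simp: not_in_iff)

lemma sum_posterior:
  "(\<Sum>y\<in>UNIV. posterior D \<alpha> s y) = sum (\<alpha> s) UNIV + real (size (buffer D s))"
  for \<alpha> :: "('x::finite, 'a) model"
  by (simp add: posterior_def sum.distrib sum_count_buffer)

lemma admissible_observe:
  assumes "admissible H \<alpha>"
  shows "admissible H (observe \<alpha> t)"
  unfolding admissible_def sum_observe
proof (intro ballI conjI allI)
  fix s :: "('a, 'b) sa" and y :: "'a outcome" assume s: "s \<in> sa_space H"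
  show "0 \<le> observe \<alpha> t s y"
  proof -
    have "observe \<alpha> t s y = \<alpha> s y \<or> observe \<alpha> t s y = \<alpha> s y + 1"
      by (auto simp: observe_def)
    then show ?thesis using admissibleD(1)[OF assms s, of y] by linarith
  qed
  show "0 < sum (\<alpha> s) UNIV + (if s = fst t then 1 else 0)"
    using admissibleD(2)[OF assms s] by (intro add_pos_nonneg) auto
qed

lemma admissible_posterior: "admissible H \<alpha> \<Longrightarrow> admissible H (posterior D \<alpha>)"
  unfolding admissible_def
  by (auto simp: sum_posterior add_pos_nonneg) (auto simp: posterior_def)

lemma sets_dirichlet_prior [simp, measurable_cong]: "sets (dirichlet_prior H \<alpha>) = sets (model_space H)"
  unfolding dirichlet_prior_def by (intro sets_PiM_cong) auto

lemma prob_space_dirichlet_prior: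
  fixes \<alpha> :: "('x::finite, 'a) model"
  assumes "admissible H \<alpha>"
  shows "prob_space (dirichlet_prior H \<alpha>)"
  unfolding dirichlet_prior_def using assms
  by (intro prob_space_PiM prob_space_dirichlet) (auto simp: admissible_def)

lemma AE_dirichlet_prior_simplex:
  fixes \<alpha> :: "('x::finite, 'a) model"
  assumes "admissible H \<alpha>" "s \<in> sa_space H"
  shows "AE P in dirichlet_prior H \<alpha>. (\<forall>y. 0 \<le> P s y) \<and> sum (P s) UNIV = 1"
  unfolding dirichlet_prior_def using assms
  by (intro AE_PiM_component[of _ _ s "\<lambda>p. (\<forall>y. 0 \<le> p y) \<and> sum p UNIV = 1"]
      prob_space_dirichlet AE_dirichlet_simplex) (auto simp: admissible_def)

lemma measurable_model_component:
  assumes "s \<in> sa_space H"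
  shows "(\<lambda>P. P s y) \<in> borel_measurable (model_space H)"
proof -
  have "(\<lambda>P. P s) \<in> measurable (model_space H) (PiM UNIV (\<lambda>_. borel))"
    using assms by (rule measurable_component_singleton)
  moreover have "(\<lambda>p. p y) \<in> borel_measurable (PiM UNIV (\<lambda>_. borel))"
    by (rule measurable_component_singleton) simp
  ultimately show ?thesis by (rule measurable_compose)
qed

text \<open>Bayes' rule for one transition: \<open>s\<close> is a single coordinate of the product
  prior, so conjugacy there leaves the other coordinates alone.\<close>

lemma integral_dirichlet_prior_mult:
  fixes \<alpha> :: "('x::finite, 'a::finite) model" and F :: "_ \<Rightarrow> real"
  assumes \<alpha>: "admissible H \<alpha>" and s: "s \<in> sa_space H"
    and F [measurable]: "F \<in> borel_measurable (model_space H)"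
  shows "(\<integral>P. P s y * F P \<partial>dirichlet_prior H \<alpha>) =
    mean_model \<alpha> s y * (\<integral>P. F P \<partial>dirichlet_prior H (observe \<alpha> (s, y)))"
proof -
  let ?M = "dirichlet_prior H \<alpha>" and ?N = "dirichlet_prior H (observe \<alpha> (s, y))"
  have nn: "0 \<le> mean_model \<alpha> s y"
    using \<alpha> s by (rule mean_model_nonneg)
  note [measurable] = measurable_model_component[OF s]
  have *: "(\<integral>\<^sup>+ P. G P * ennreal (P s y) \<partial>?M) = ennreal (mean_model \<alpha> s y) * (\<integral>\<^sup>+ P. G P \<partial>?N)"
    if [measurable]: "G \<in> borel_measurable (model_space H)" for G
  proof -
    have N: "?N = PiM (sa_space H) ((\<lambda>s. dirichlet (\<alpha> s))(s := dirichlet ((\<alpha> s)(y := \<alpha> s y + 1))))"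
      unfolding dirichlet_prior_def by (intro PiM_cong) (auto simp: observe_def)
    have pr: "prob_space (dirichlet ((\<alpha> s)(y := \<alpha> s y + 1)))"
    proof -
      have "observe \<alpha> (s, y) s = (\<alpha> s)(y := \<alpha> s y + 1)" by (simp add: observe_def)
      then show ?thesis
        using admissibleD[OF admissible_observe[OF \<alpha>] s, of "(s, y)"] by (intro prob_space_dirichlet) auto
    qed
    have pj: "prob_space (dirichlet (\<alpha> j))" if "j \<in> sa_space H" for j
      using admissibleD[OF \<alpha> that] by (intro prob_space_dirichlet) auto
    have sets_eq: "sets (PiM (sa_space H) (\<lambda>s. dirichlet (\<alpha> s))) = sets (model_space H)"
      by (intro sets_PiM_cong) auto
    show ?thesis
      unfolding N unfolding dirichlet_prior_def mean_model_def using admissibleD[OF \<alpha> s] s that pr pj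
      by (intro nn_integral_PiM_change_component[where w = "\<lambda>p. ennreal (p y)"] nn_integral_dirichlet_mult)
         (auto simp: measurable_cong_sets[OF sets_dirichlet refl] measurable_cong_sets[OF sets_eq refl])
  qed
  have "AE P in ?M. 0 \<le> P s y"
    using AE_dirichlet_prior_simplex[OF \<alpha> s] by eventually_elim blast
  then show ?thesis
    using nn by (intro integral_mult_eqI *) (auto simp: measurable_cong_sets[OF sets_dirichlet_prior refl])
qed

lemma pmf_outcome_pmf:
  "pmf (outcome_pmf p) y =
    (if (\<forall>i. 0 \<le> p i) \<and> sum p UNIV = 1 then p y else 1 / real CARD('o))"
  for p :: "'o::finite \<Rightarrow> real"
proof (cases "(\<forall>i. 0 \<le> p i) \<and> sum p UNIV = 1")
  case True
  then have "(\<integral>\<^sup>+ x. ennreal (p x) \<partial>count_space UNIV) = 1"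
    by (simp add: nn_integral_count_space_finite)
  with True have "pmf (embed_pmf p) y = p y"
    by (intro pmf_embed_pmf) auto
  with True show ?thesis unfolding outcome_pmf_def by (simp only: if_True simp_thms)
next
  case False
  then show ?thesis by (simp only: outcome_pmf_def if_False) simp
qed

lemma sum_pmf_UNIV [simp]: "(\<Sum>y\<in>UNIV. pmf p y) = 1" for p :: "'o::finite pmf"
  by (intro sum_pmf_eq_1) auto

lemma measurable_pmf_outcome_pmf:
  assumes s: "s \<in> sa_space H"
  shows "(\<lambda>P. pmf (outcome_pmf (P s)) y) \<in> borel_measurable (model_space H)"
proof -
  note [measurable] = measurable_model_component[OF s]
  show ?thesis unfolding pmf_outcome_pmf by measurable
qed

lemma pmf_outcome_mean_model:
  assumes "admissible H \<alpha>" "s \<in> sa_space H"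
  shows "pmf (outcome_pmf (mean_model \<alpha> s)) y = mean_model \<alpha> s y"
  using assms unfolding pmf_outcome_pmf
  by (auto simp: mean_model_def admissible_def sum_divide_distrib[symmetric])

lemma integral_dirichlet_prior_outcome:
  fixes \<alpha> :: "('x::finite, 'a::finite) model" and F :: "_ \<Rightarrow> real"
  assumes \<alpha>: "admissible H \<alpha>" and s: "s \<in> sa_space H"
    and F [measurable]: "F \<in> borel_measurable (model_space H)"
  shows "(\<integral>P. pmf (outcome_pmf (P s)) y * F P \<partial>dirichlet_prior H \<alpha>) =
    mean_model \<alpha> s y * (\<integral>P. F P \<partial>dirichlet_prior H (observe \<alpha> (s, y)))"
proof -
  note [measurable] = measurable_model_component[OF s] measurable_pmf_outcome_pmf[OF s]
  \<comment> \<open>The prior charges only the simplex, where the fallback value of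
    \<open>outcome_pmf\<close> does not occur.\<close>
  have "(\<integral>P. pmf (outcome_pmf (P s)) y * F P \<partial>dirichlet_prior H \<alpha>) = (\<integral>P. P s y * F P \<partial>dirichlet_prior H \<alpha>)"
    using AE_dirichlet_prior_simplex[OF \<alpha> s]
  proof (intro integral_cong_AE)
    show "AE P in dirichlet_prior H \<alpha>. pmf (outcome_pmf (P s)) y * F P = P s y * F P"
      using AE_dirichlet_prior_simplex[OF \<alpha> s] by eventually_elim (simp add: pmf_outcome_pmf)
  qed measurable
  then show ?thesis using integral_dirichlet_prior_mult[OF \<alpha> s F] by simp
qed

subsection \<open>Trajectories\<close>

lemma finite_set_rollout [simp]:
  "finite (set_pmf (rollout P \<pi> k h x))" for P :: "('x::finite, 'a::finite) model"
  by (induction k arbitrary: h x) auto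

lemma length_rollout: "\<tau> \<in> set_pmf (rollout P \<pi> k h x) \<Longrightarrow> length \<tau> = k"
  by (induction k arbitrary: h x \<tau>) auto

lemma expectation_rollout_Suc:
  fixes P :: "('x::finite, 'a::finite) model" and f :: "_ \<Rightarrow> real"
  shows "expect (rollout P \<pi> (Suc k) h x) f =
    (\<Sum>a\<in>UNIV. pmf (\<pi> h x) a * (\<Sum>y\<in>UNIV. pmf (outcome_pmf (P (h, x, a))) y *
      expect (rollout P \<pi> k (Suc h) (snd y)) (\<lambda>\<tau>. f (((h, x, a), y) # \<tau>))))"
proof -
  have "expect (rollout P \<pi> (Suc k) h x) f =
    (\<Sum>a\<in>UNIV. pmf (\<pi> h x) a * expect (bind_pmf (outcome_pmf (P (h, x, a))) (\<lambda>(r, x').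
     map_pmf (\<lambda>\<tau>. ((h, x, a), (r, x')) # \<tau>) (rollout P \<pi> k (Suc h) x'))) f)"
    unfolding rollout.simps by (subst pmf_expectation_bind[where A = UNIV]) auto
  also have "\<dots> = (\<Sum>a\<in>UNIV. pmf (\<pi> h x) a * (\<Sum>y\<in>UNIV. pmf (outcome_pmf (P (h, x, a))) y *
      expect (rollout P \<pi> k (Suc h) (snd y)) (\<lambda>\<tau>. f (((h, x, a), y) # \<tau>))))"
    by (intro sum.cong refl arg_cong2[where f = "(*)"], subst pmf_expectation_bind[where A = UNIV])
       (auto simp: case_prod_unfold)
  finally show ?thesis .
qed

abbreviation determ :: "(nat \<Rightarrow> 'x \<Rightarrow> 'a) \<Rightarrow> ('x, 'a) policy" where
  "determ g \<equiv> \<lambda>h x. return_pmf (g h x)"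

lemma expectation_rollout_det_Suc:
  fixes P :: "('x::finite, 'a::finite) model" and f :: "_ \<Rightarrow> real"
  shows "expect (rollout P (determ g) (Suc k) h x) f =
    (\<Sum>y\<in>UNIV. pmf (outcome_pmf (P (h, x, g h x))) y *
      expect (rollout P (determ g) k (Suc h) (snd y)) (\<lambda>\<tau>. f (((h, x, g h x), y) # \<tau>)))"
  unfolding expectation_rollout_Suc by (simp add: indicator_def if_distrib[of "\<lambda>c. c * _"] cong: if_cong)

lemma rollout_cong:
  assumes "\<And>h' x a. h \<le> h' \<Longrightarrow> P (h', x, a) = P' (h', x, a)"
  shows "rollout P \<pi> k h x = rollout P' \<pi> k h x"
  using assms
proof (induction k arbitrary: h x)
  case (Suc k)
  have "rollout P \<pi> k (Suc h) x = rollout P' \<pi> k (Suc h) x" for x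
    by (intro Suc.IH Suc.prems) simp
  with Suc.prems[of h] show ?case by simp
qed simp

lemma abs_expectation_pmf_le:
  fixes f :: "_ \<Rightarrow> real"
  assumes "finite (set_pmf p)" "\<And>x. x \<in> set_pmf p \<Longrightarrow> \<bar>f x\<bar> \<le> C"
  shows "\<bar>expect p f\<bar> \<le> C"
proof -
  have "\<bar>expect p f\<bar> \<le> expect p (\<lambda>x. \<bar>f x\<bar>)"
    by (rule integral_abs_bound)
  also have "\<dots> \<le> expect p (\<lambda>x. C)"
    using assms by (intro integral_mono_AE integrable_measure_pmf_finite) (auto simp: AE_measure_pmf_iff)
  finally show ?thesis by simp
qed

lemma measurable_expectation_rollout:
  fixes F :: "_ \<Rightarrow> ('x::finite, 'a::finite) model \<Rightarrow> real"
  assumes "h + k \<le> H" "\<And>\<tau>. F \<tau> \<in> borel_measurable (model_space H)"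
  shows "(\<lambda>P. expect (rollout P (determ g) k h x) (\<lambda>\<tau>. F \<tau> P)) \<in> borel_measurable (model_space H)"
  using assms
proof (induction k arbitrary: h x F)
  case (Suc k)
  have s: "(h, x, g h x) \<in> sa_space H" using Suc.prems by (auto simp: sa_space_def)
  note [measurable] = measurable_pmf_outcome_pmf[OF s]
  have [measurable]: "(\<lambda>P. expect (rollout P (determ g) k (Suc h) (snd y)) (\<lambda>\<tau>. F (((h, x, g h x), y) # \<tau>) P)) \<in> borel_measurable (model_space H)" for y
    using Suc.prems by (intro Suc.IH) auto
  show ?case unfolding expectation_rollout_det_Suc by measurable
qed simp

lemma integrable_bounded_prior:
  fixes f :: "('x::finite, 'a::finite) model \<Rightarrow> real"
  assumes "admissible H \<alpha>" "f \<in> borel_measurable (model_space H)" "\<And>P. \<bar>f P\<bar> \<le> C"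
  shows "integrable (dirichlet_prior H \<alpha>) f"
proof -
  interpret prob_space "dirichlet_prior H \<alpha>" by (rule prob_space_dirichlet_prior) fact
  show ?thesis
    using assms(2,3) by (intro integrable_const_bound[of _ C]) (auto simp: measurable_cong_sets[OF sets_dirichlet_prior refl])
qed

text \<open>A trajectory visits every triple at most once, so integrating the model out amounts to rolling out
  the posterior mean model.\<close>
lemma integral_prior_rollout:
  fixes F :: "_ \<Rightarrow> ('x::finite, 'a::finite) model \<Rightarrow> real"
  assumes "admissible H \<alpha>" "h + k \<le> H" "\<And>\<tau>. F \<tau> \<in> borel_measurable (model_space H)"
    and "\<And>\<tau> P. length \<tau> = k \<Longrightarrow> \<bar>F \<tau> P\<bar> \<le> C"
  shows "(\<integral>P. expect (rollout P (determ g) k h x) (\<lambda>\<tau>. F \<tau> P) \<partial>dirichlet_prior H \<alpha>)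
    = expect (rollout (mean_model \<alpha>) (determ g) k h x) (\<lambda>\<tau>. \<integral>P. F \<tau> P \<partial>dirichlet_prior H (posterior \<tau> \<alpha>))"
  using assms
proof (induction k arbitrary: h x F \<alpha>)
  case (Suc k)
  define s where "s = (h, x, g h x)"
  have s: "s \<in> sa_space H" using Suc.prems by (auto simp: sa_space_def s_def)
  define G where "G = (\<lambda>y P. expect (rollout P (determ g) k (Suc h) (snd y)) (\<lambda>\<tau>. F ((s, y) # \<tau>) P))"
  have G [measurable]: "G y \<in> borel_measurable (model_space H)" for y
    unfolding G_def using Suc.prems by (intro measurable_expectation_rollout) auto
  have G_bd: "\<bar>G y P\<bar> \<le> C" for y P
    unfolding G_def using Suc.prems(4) by (intro abs_expectation_pmf_le) (auto dest!: length_rollout)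
  note [measurable] = measurable_pmf_outcome_pmf[OF s]
  have "(\<integral>P. expect (rollout P (determ g) (Suc k) h x) (\<lambda>\<tau>. F \<tau> P) \<partial>dirichlet_prior H \<alpha>)
     = (\<integral>P. (\<Sum>y\<in>UNIV. pmf (outcome_pmf (P s)) y * G y P) \<partial>dirichlet_prior H \<alpha>)"
    unfolding expectation_rollout_det_Suc G_def s_def ..
  also have "\<dots> = (\<Sum>y\<in>UNIV. \<integral>P. pmf (outcome_pmf (P s)) y * G y P \<partial>dirichlet_prior H \<alpha>)"
  proof (intro Bochner_Integration.integral_sum integrable_bounded_prior[of _ _ _ C] Suc.prems)
    fix y P
    have "\<bar>pmf (outcome_pmf (P s)) y * G y P\<bar> \<le> 1 * C"
      unfolding abs_mult by (intro mult_mono G_bd) (auto simp: pmf_le_1)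
    then show "\<bar>pmf (outcome_pmf (P s)) y * G y P\<bar> \<le> C" by simp
  qed measurable
  also have "\<dots> = (\<Sum>y\<in>UNIV. mean_model \<alpha> s y * (\<integral>P. G y P \<partial>dirichlet_prior H (observe \<alpha> (s, y))))"
    using Suc.prems s G by (intro sum.cong integral_dirichlet_prior_outcome) auto
  also have "\<dots> = (\<Sum>y\<in>UNIV. pmf (outcome_pmf (mean_model \<alpha> s)) y *
      expect (rollout (mean_model \<alpha>) (determ g) k (Suc h) (snd y))
        (\<lambda>\<tau>. \<integral>P. F ((s, y) # \<tau>) P \<partial>dirichlet_prior H (posterior ((s, y) # \<tau>) \<alpha>)))"
  proof (intro sum.cong refl arg_cong2[where f = "(*)"])
    fix y
    show "mean_model \<alpha> s y = pmf (outcome_pmf (mean_model \<alpha> s)) y"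
      using pmf_outcome_mean_model[OF Suc.prems(1) s] by simp
    \<comment> \<open>The observation changes the mean model only at \<open>s\<close>, in layer
      \<open>h\<close>; the remaining rollout reads layers from \<open>Suc h\<close> on.\<close>
    have "rollout (mean_model (observe \<alpha> (s, y))) (determ g) k (Suc h) (snd y) = rollout (mean_model \<alpha>) (determ g) k (Suc h) (snd y)"
      by (intro rollout_cong) (auto simp: mean_model_def fun_eq_iff sum_observe s_def observe_def)
    moreover have "(\<integral>P. G y P \<partial>dirichlet_prior H (observe \<alpha> (s, y))) =
      expect (rollout (mean_model (observe \<alpha> (s, y))) (determ g) k (Suc h) (snd y))
        (\<lambda>\<tau>. \<integral>P. F ((s, y) # \<tau>) P \<partial>dirichlet_prior H (posterior \<tau> (observe \<alpha> (s, y))))"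
      unfolding G_def using Suc.prems by (intro Suc.IH admissible_observe) auto
    ultimately show "(\<integral>P. G y P \<partial>dirichlet_prior H (observe \<alpha> (s, y))) =
      expect (rollout (mean_model \<alpha>) (determ g) k (Suc h) (snd y))
        (\<lambda>\<tau>. \<integral>P. F ((s, y) # \<tau>) P \<partial>dirichlet_prior H (posterior ((s, y) # \<tau>) \<alpha>))"
      by (simp add: posterior_observe)
  qed
  also have "\<dots> = expect (rollout (mean_model \<alpha>) (determ g) (Suc k) h x) (\<lambda>\<tau>. \<integral>P. F \<tau> P \<partial>dirichlet_prior H (posterior \<tau> \<alpha>))"
    unfolding expectation_rollout_det_Suc s_def ..
  finally show ?case .
qed simp

subsection \<open>Gaussian smoothing of convex functions\<close>

abbreviation gauss :: "real measure" where
  "gauss \<equiv> std_normal_distribution"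

interpretation gauss: prob_space gauss
  by (rule prob_space_normal_density) simp

lemma integrable_gauss_id: "integrable gauss (\<lambda>z. z)"
  using integrable_std_normal_distribution_moment[of 1] by simp

lemma integral_gauss_id: "(\<integral>z. z \<partial>gauss) = 0"
  using integral_std_normal_distribution_moment_odd[of 1] by simp

lemma integrable_gauss_abs: "integrable gauss (\<lambda>z. \<bar>z\<bar>)"
  using integrable_gauss_id by (rule integrable_abs)

lemma integral_gauss_abs: "(\<integral>z. \<bar>z\<bar> \<partial>gauss) = sqrt (2 / pi)"
  using std_normal_distribution_odd_moments_abs(1)[of 0] by simp

lemma lipschitz_on_measurable:
  fixes \<phi> :: "real \<Rightarrow> real"
  assumes "K-lipschitz_on UNIV \<phi>"
  shows "\<phi> \<in> borel_measurable borel"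
  using lipschitz_on_continuous_on[OF assms] by (rule borel_measurable_continuous_onI)

lemma lipschitz_on_abs_le:
  fixes \<phi> :: "real \<Rightarrow> real"
  assumes "K-lipschitz_on UNIV \<phi>"
  shows "\<bar>\<phi> x - \<phi> y\<bar> \<le> K * \<bar>x - y\<bar>"
  using lipschitz_onD[OF assms, of x y] by (simp add: dist_real_def)

text \<open>The integral of the test function \<open>\<phi>\<close> against the Gaussian with mean
  \<open>u\<close> and standard deviation |s|. Domination in convex order is expressed as an upper
  bound by this quantity for all Lipschitz convex \<open>\<phi>\<close>.\<close>

definition smooth :: "real \<Rightarrow> (real \<Rightarrow> real) \<Rightarrow> real \<Rightarrow> real" where
  "smooth s \<phi> u = (\<integral>z. \<phi> (u + s * z) \<partial>gauss)"

lemma integrable_smooth: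
  fixes \<phi> :: "real \<Rightarrow> real"
  assumes "K-lipschitz_on UNIV \<phi>"
  shows "integrable gauss (\<lambda>z. \<phi> (u + s * z))"
proof (rule Bochner_Integration.integrable_bound)
  show "integrable gauss (\<lambda>z. \<bar>\<phi> u\<bar> + K * \<bar>s\<bar> * \<bar>z\<bar>)"
    using integrable_gauss_abs by simp
  note [measurable] = lipschitz_on_measurable[OF assms]
  show "(\<lambda>z. \<phi> (u + s * z)) \<in> borel_measurable gauss" by measurable
  have "0 \<le> K" using assms by (rule lipschitz_on_nonneg)
  then show "AE z in gauss. norm (\<phi> (u + s * z)) \<le> norm (\<bar>\<phi> u\<bar> + K * \<bar>s\<bar> * \<bar>z\<bar>)"
  proof (intro AE_I2)
    fix z
    have "\<bar>\<phi> (u + s * z) - \<phi> u\<bar> \<le> K * \<bar>s\<bar> * \<bar>z\<bar>"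
      using lipschitz_on_abs_le[OF assms, of "u + s * z" u] by (simp add: abs_mult mult.assoc)
    then show "norm (\<phi> (u + s * z)) \<le> norm (\<bar>\<phi> u\<bar> + K * \<bar>s\<bar> * \<bar>z\<bar>)"
      unfolding real_norm_def by linarith
  qed
qed

lemma lipschitz_smooth:
  assumes \<phi>: "K-lipschitz_on UNIV \<phi>"
  shows "K-lipschitz_on UNIV (smooth s \<phi>)"
proof (rule lipschitz_onI)
  show "0 \<le> K" using \<phi> by (rule lipschitz_on_nonneg)
  fix x y :: real
  have "\<bar>smooth s \<phi> x - smooth s \<phi> y\<bar> = \<bar>\<integral>z. \<phi> (x + s * z) - \<phi> (y + s * z) \<partial>gauss\<bar>"
    unfolding smooth_def using integrable_smooth[OF \<phi>] by (subst Bochner_Integration.integral_diff) auto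
  also have "\<dots> \<le> (\<integral>z. \<bar>\<phi> (x + s * z) - \<phi> (y + s * z)\<bar> \<partial>gauss)"
    by (rule integral_abs_bound)
  also have "\<dots> \<le> (\<integral>z. K * \<bar>x - y\<bar> \<partial>gauss)"
  proof (intro integral_mono integrable_abs Bochner_Integration.integrable_diff integrable_smooth[OF \<phi>])
    show "\<bar>\<phi> (x + s * z) - \<phi> (y + s * z)\<bar> \<le> K * \<bar>x - y\<bar>" for z
      using lipschitz_on_abs_le[OF \<phi>, of "x + s * z" "y + s * z"] by simp
  qed simp
  finally show "dist (smooth s \<phi> x) (smooth s \<phi> y) \<le> K * dist x y"
    using gauss.prob_space by (simp add: dist_real_def)
qed

lemma convex_smooth:
  assumes \<phi>: "K-lipschitz_on UNIV \<phi>" and conv: "convex_on UNIV \<phi>"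
  shows "convex_on UNIV (smooth s \<phi>)"
proof (rule convex_onI)
  fix t x y :: real assume t: "0 < t" "t < 1"
  have "smooth s \<phi> ((1 - t) *\<^sub>R x + t *\<^sub>R y) \<le> (\<integral>z. (1 - t) * \<phi> (x + s * z) + t * \<phi> (y + s * z) \<partial>gauss)"
    unfolding smooth_def
  proof (intro integral_mono)
    fix z
    have "((1 - t) *\<^sub>R x + t *\<^sub>R y) + s * z = (1 - t) *\<^sub>R (x + s * z) + t *\<^sub>R (y + s * z)"
      by (simp add: algebra_simps)
    then show "\<phi> (((1 - t) *\<^sub>R x + t *\<^sub>R y) + s * z) \<le> (1 - t) * \<phi> (x + s * z) + t * \<phi> (y + s * z)"
      using convex_onD[OF conv, of t] t by simp
  qed (use integrable_smooth[OF \<phi>] in auto)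
  also have "\<dots> = (1 - t) * smooth s \<phi> x + t * smooth s \<phi> y"
    unfolding smooth_def using integrable_smooth[OF \<phi>] by simp
  finally show "smooth s \<phi> ((1 - t) *\<^sub>R x + t *\<^sub>R y) \<le> (1 - t) * smooth s \<phi> x + t * smooth s \<phi> y" .
qed simp

lemma smooth_ge:
  assumes \<phi>: "K-lipschitz_on UNIV \<phi>" and conv: "convex_on UNIV \<phi>"
  shows "\<phi> u \<le> smooth s \<phi> u"
proof -
  have "\<phi> (\<integral>z. u + s * z \<partial>gauss) \<le> (\<integral>z. \<phi> (u + s * z) \<partial>gauss)"
    using integrable_gauss_id integrable_smooth[OF \<phi>] conv
    by (intro gauss.jensens_inequality[where I = UNIV]) auto
  moreover have "(\<integral>z. u + s * z \<partial>gauss) = u"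
    using integrable_gauss_id gauss.prob_space by (simp add: integral_gauss_id)
  ultimately show ?thesis by (simp add: smooth_def)
qed

text \<open>For \<open>s = l * t\<close> the point \<open>u + s * z\<close> lies between
  \<open>u\<close> and \<open>u + t * z\<close>. Convexity splits the integrand accordingly, and
  Jensen bounds \<open>\<phi> u\<close> by the smoothed value.\<close>

lemma smooth_mono_scale:
  assumes \<phi>: "K-lipschitz_on UNIV \<phi>" and conv: "convex_on UNIV \<phi>" and st: "0 \<le> s" "s \<le> t"
  shows "smooth s \<phi> u \<le> smooth t \<phi> u"
proof (cases "t = 0")
  case False
  with st have t: "0 < t" by simp
  define l where "l = s / t"
  have l: "0 \<le> l" "l \<le> 1" "s = l * t" using st t by (auto simp: l_def)
  have "smooth s \<phi> u \<le> (\<integral>z. (1 - l) * \<phi> u + l * \<phi> (u + t * z) \<partial>gauss)"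
    unfolding smooth_def
  proof (intro integral_mono)
    fix z
    have "u + s * z = (1 - l) *\<^sub>R u + l *\<^sub>R (u + t * z)"
      using l by (simp add: algebra_simps)
    then show "\<phi> (u + s * z) \<le> (1 - l) * \<phi> u + l * \<phi> (u + t * z)"
      using convex_onD[OF conv, of l] l by simp
  qed (use integrable_smooth[OF \<phi>] in auto)
  also have "\<dots> = (1 - l) * \<phi> u + l * smooth t \<phi> u"
    unfolding smooth_def using integrable_smooth[OF \<phi>] gauss.prob_space by simp
  also have "\<dots> \<le> (1 - l) * smooth t \<phi> u + l * smooth t \<phi> u"
    using smooth_ge[OF \<phi> conv] l by (intro add_mono mult_left_mono) auto
  finally show ?thesis by (simp add: algebra_simps)
qed (use st in simp)

lemma distr_gauss_scale:
  assumes "0 < s"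
  shows "distr gauss borel (\<lambda>z. s * z) = density lborel (normal_density 0 s)"
proof -
  have "distributed gauss lborel (\<lambda>z. z) std_normal_density"
    by (simp add: distributed_def distr_id2)
  then have "distributed gauss lborel (\<lambda>z. 0 + s * z) (normal_density (0 + s * 0) (\<bar>s\<bar> * 1))"
    using assms by (intro gauss.normal_density_affine) auto
  then have "distr gauss lborel (\<lambda>z. s * z) = density lborel (normal_density 0 s)"
    using assms by (simp add: distributed_def)
  moreover have "distr gauss lborel (\<lambda>z. s * z) = distr gauss borel (\<lambda>z. s * z)"
    by (intro distr_cong) auto
  ultimately show ?thesis by simp
qed

text \<open>Variances of independent Gaussians add. This lets the steps of the urn be accumulated
  into a single Gaussian.\<close>

lemma smooth_smooth:
  assumes \<phi>: "K-lipschitz_on UNIV \<phi>" and st: "0 < s" "0 < t"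
  shows "smooth s (smooth t \<phi>) u = smooth (sqrt (s\<^sup>2 + t\<^sup>2)) \<phi> u"
proof -
  let ?D = "\<lambda>s. density lborel (normal_density 0 s)"
  let ?r = "sqrt (s\<^sup>2 + t\<^sup>2)"
  have r: "0 < ?r" using st by (simp add: add_pos_pos)
  note [measurable] = lipschitz_on_measurable[OF \<phi>] lipschitz_on_measurable[OF lipschitz_smooth[OF \<phi>]]
  have sm: "smooth s \<psi> u = (\<integral>x. \<psi> (u + x) \<partial>?D s)" if "0 < s" "\<psi> \<in> borel_measurable borel" for s \<psi> u
    unfolding smooth_def distr_gauss_scale[OF that(1), symmetric]
    using that(2) by (subst integral_distr) auto
  have pr: "prob_space (?D s)" if "0 < s" for s
    using that by (rule prob_space_normal_density)
  have conv: "?D s \<star> ?D t = ?D ?r"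
    using st pr
    by (subst convolution_density)
       (auto simp: conv_normal_density_zero_mean[OF st, symmetric] ennreal_mult'[symmetric] normal_density_nonneg
             intro!: prob_space.finite_measure)
  interpret A: prob_space "?D s" using st by (intro pr)
  interpret B: prob_space "?D t" using st by (intro pr)
  interpret AB: pair_sigma_finite "?D s" "?D t" ..
  have int_r: "integrable (?D ?r) (\<lambda>x. \<phi> (u + x))"
    unfolding distr_gauss_scale[OF r, symmetric]
    using integrable_smooth[OF \<phi>] by (subst integrable_distr_eq) auto
  have "smooth ?r \<phi> u = (\<integral>x. \<phi> (u + x) \<partial>?D ?r)" using r by (subst sm) auto
  also have "\<dots> = (\<integral>p. \<phi> (u + (fst p + snd p)) \<partial>(?D s \<Otimes>\<^sub>M ?D t))"
    unfolding conv[symmetric] convolution_def by (subst integral_distr) (auto simp: case_prod_unfold)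
  also have "\<dots> = (\<integral>x. (\<integral>y. \<phi> (u + (x + y)) \<partial>?D t) \<partial>?D s)"
  proof (subst AB.integral_fst'[symmetric])
    show "integrable (?D s \<Otimes>\<^sub>M ?D t) (\<lambda>p. \<phi> (u + (fst p + snd p)))"
      using int_r unfolding conv[symmetric] convolution_def
      by (subst (asm) integrable_distr_eq) (auto simp: case_prod_unfold)
  qed simp
  also have "\<dots> = (\<integral>x. smooth t \<phi> (u + x) \<partial>?D s)"
    using st by (subst sm) (auto simp: add.assoc)
  also have "\<dots> = smooth s (smooth t \<phi>) u"
    using st by (subst sm) auto
  finally show ?thesis ..
qed

lemma smooth_uminus:
  assumes \<phi>: "K-lipschitz_on UNIV \<phi>"
  shows "smooth (- s) \<phi> u = smooth s \<phi> u"
proof -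
  note [measurable] = lipschitz_on_measurable[OF \<phi>]
  have "smooth s \<phi> u = (\<integral>z. std_normal_density z * \<phi> (u + s * z) \<partial>lborel)"
    unfolding smooth_def by (subst integral_density) auto
  also have "\<dots> = (\<integral>z. std_normal_density (- z) * \<phi> (u + s * (- z)) \<partial>lborel)"
    by (subst lborel_integral_real_affine[of "-1" _ 0]) auto
  also have "\<dots> = smooth (- s) \<phi> u"
    unfolding smooth_def by (subst integral_density) (auto simp: std_normal_density_def)
  finally show ?thesis ..
qed

text \<open>Given its sign, \<open>r * z\<close> has mean plus or minus
  \<open>r * sqrt (2 / pi)\<close>, which equals \<open>d\<close> for
  \<open>r = sqrt (pi / 2) * d\<close>. The two-point law is therefore the conditional mean of a
  Gaussian given its sign, and Jensen applies to each sign.\<close>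

lemma two_point_le_smooth:
  assumes \<phi>: "K-lipschitz_on UNIV \<phi>" and conv: "convex_on UNIV \<phi>"
    and d: "0 \<le> d" "sqrt (pi / 2) * d \<le> s"
  shows "(\<phi> (u + d) + \<phi> (u - d)) / 2 \<le> smooth s \<phi> u"
proof -
  define r where "r = sqrt (pi / 2) * d"
  have r: "0 \<le> r" "r \<le> s" using d by (auto simp: r_def)
  have rd: "r * sqrt (2 / pi) = d"
    unfolding r_def by (simp add: real_sqrt_divide)
  have J: "\<phi> (u + q * sqrt (2 / pi)) \<le> (\<integral>z. \<phi> (u + q * \<bar>z\<bar>) \<partial>gauss)" and I: "integrable gauss (\<lambda>z. \<phi> (u + q * \<bar>z\<bar>))" for q
  proof -
    note [measurable] = lipschitz_on_measurable[OF \<phi>]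
    show I: "integrable gauss (\<lambda>z. \<phi> (u + q * \<bar>z\<bar>))"
    proof (rule Bochner_Integration.integrable_bound)
      show "integrable gauss (\<lambda>z. \<bar>\<phi> (u + q * z)\<bar> + \<bar>\<phi> (u + (- q) * z)\<bar>)"
        by (intro Bochner_Integration.integrable_add integrable_abs integrable_smooth[OF \<phi>])
      show "AE z in gauss. norm (\<phi> (u + q * \<bar>z\<bar>)) \<le> norm (\<bar>\<phi> (u + q * z)\<bar> + \<bar>\<phi> (u + (- q) * z)\<bar>)"
        by (auto simp: abs_if)
    qed measurable
    have "\<phi> (\<integral>z. u + q * \<bar>z\<bar> \<partial>gauss) \<le> (\<integral>z. \<phi> (u + q * \<bar>z\<bar>) \<partial>gauss)"
      using integrable_gauss_abs I conv
      by (intro gauss.jensens_inequality[where I = UNIV]) auto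
    moreover have "(\<integral>z. u + q * \<bar>z\<bar> \<partial>gauss) = u + q * sqrt (2 / pi)"
      using integrable_gauss_abs gauss.prob_space by (simp add: integral_gauss_abs)
    ultimately show "\<phi> (u + q * sqrt (2 / pi)) \<le> (\<integral>z. \<phi> (u + q * \<bar>z\<bar>) \<partial>gauss)" by simp
  qed
  have "\<phi> (u + d) + \<phi> (u - d) \<le> (\<integral>z. \<phi> (u + r * \<bar>z\<bar>) \<partial>gauss) + (\<integral>z. \<phi> (u + (- r) * \<bar>z\<bar>) \<partial>gauss)"
    using J[of r] J[of "- r"] by (simp add: rd)
  also have "\<dots> = (\<integral>z. \<phi> (u + r * \<bar>z\<bar>) + \<phi> (u + (- r) * \<bar>z\<bar>) \<partial>gauss)"
    using I by (intro Bochner_Integration.integral_add[symmetric])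
  also have "\<dots> = (\<integral>z. \<phi> (u + r * z) + \<phi> (u + (- r) * z) \<partial>gauss)"
    by (intro Bochner_Integration.integral_cong) (auto simp: abs_if)
  also have "\<dots> = smooth r \<phi> u + smooth (- r) \<phi> u"
    unfolding smooth_def by (intro Bochner_Integration.integral_add integrable_smooth[OF \<phi>])
  also have "\<dots> = 2 * smooth r \<phi> u"
    by (simp add: smooth_uminus[OF \<phi>])
  finally have "(\<phi> (u + d) + \<phi> (u - d)) / 2 \<le> smooth r \<phi> u" by simp
  also have "\<dots> \<le> smooth s \<phi> u"
    using r by (intro smooth_mono_scale[OF \<phi> conv])
  finally show ?thesis .
qed

text \<open>On the interval of radius \<open>d\<close> around \<open>u\<close> the convex function
  lies below its chord. The slope of the chord is weighted by the mean of \<open>D\<close>, which is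
  0, so the symmetric two-point law is the worst case.\<close>

lemma bounded_centered_le_smooth:
  fixes w D :: "'o \<Rightarrow> real"
  assumes \<phi>: "K-lipschitz_on UNIV \<phi>" and conv: "convex_on UNIV \<phi>"
    and w: "\<And>y. y \<in> A \<Longrightarrow> 0 \<le> w y" "(\<Sum>y\<in>A. w y) = 1" "(\<Sum>y\<in>A. w y * D y) = 0"
    and D: "\<And>y. y \<in> A \<Longrightarrow> \<bar>D y\<bar> \<le> d" and d: "0 < d" "sqrt (pi / 2) * d \<le> s"
  shows "(\<Sum>y\<in>A. w y * \<phi> (u + D y)) \<le> smooth s \<phi> u"
proof -
  have "\<phi> (u + D y) \<le> (1 - (d - D y) / (2 * d)) * \<phi> (u + d) + (d - D y) / (2 * d) * \<phi> (u - d)" if "y \<in> A" for y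
  proof -
    have "u + D y = (1 - (d - D y) / (2 * d)) *\<^sub>R (u + d) + ((d - D y) / (2 * d)) *\<^sub>R (u - d)"
      using d by (simp add: field_simps)
    moreover have "0 \<le> (d - D y) / (2 * d)" "(d - D y) / (2 * d) \<le> 1"
      using D[OF that] d by (auto simp: field_simps abs_le_iff)
    ultimately show ?thesis using convex_onD[OF conv, of "(d - D y) / (2 * d)" "u + d" "u - d"] by simp
  qed
  also have "(1 - (d - D y) / (2 * d)) * \<phi> (u + d) + (d - D y) / (2 * d) * \<phi> (u - d)
      = (\<phi> (u + d) + \<phi> (u - d)) / 2 + D y * ((\<phi> (u + d) - \<phi> (u - d)) / (2 * d))" for y
    using d by (simp add: field_simps)
  finally have "(\<Sum>y\<in>A. w y * \<phi> (u + D y)) \<le>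
      (\<Sum>y\<in>A. w y * ((\<phi> (u + d) + \<phi> (u - d)) / 2 + D y * ((\<phi> (u + d) - \<phi> (u - d)) / (2 * d))))"
    using w by (intro sum_mono mult_left_mono) auto
  also have "\<dots> = (\<Sum>y\<in>A. w y) * ((\<phi> (u + d) + \<phi> (u - d)) / 2) + (\<Sum>y\<in>A. w y * D y) * ((\<phi> (u + d) - \<phi> (u - d)) / (2 * d))"
    by (simp only: distrib_left sum.distrib sum_distrib_right mult.assoc)
  also have "\<dots> \<le> smooth s \<phi> u"
    using two_point_le_smooth[OF \<phi> conv] d w by simp
  finally show ?thesis .
qed

subsection \<open>Convex comparison of Dirichlet and Gaussian laws\<close>

lemma integral_dirichlet_mult:
  fixes a :: "'o::finite \<Rightarrow> real" and F :: "_ \<Rightarrow> real"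
  assumes a_nonneg: "\<And>i. 0 \<le> a i" and a_pos: "0 < sum a UNIV"
    and F [measurable]: "F \<in> borel_measurable (PiM UNIV (\<lambda>_. borel))"
  shows "(\<integral>p. p y * F p \<partial>dirichlet a) = a y / sum a UNIV * (\<integral>p. F p \<partial>dirichlet (a(y := a y + 1)))"
proof (intro integral_mult_eqI)
  show "AE p in dirichlet a. 0 \<le> p y"
    using AE_dirichlet_simplex[OF a_nonneg a_pos] by eventually_elim auto
  show "0 \<le> a y / sum a UNIV" using a_nonneg a_pos by simp
  show "(\<integral>\<^sup>+ p. G p * ennreal (p y) \<partial>dirichlet a) =
      ennreal (a y / sum a UNIV) * (\<integral>\<^sup>+ p. G p \<partial>dirichlet (a(y := a y + 1)))"
    if "G \<in> borel_measurable (dirichlet a)" for G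
    using that by (intro nn_integral_dirichlet_mult a_nonneg a_pos) (simp add: measurable_cong_sets[OF sets_dirichlet refl])
qed (auto simp: measurable_cong_sets[OF sets_dirichlet refl])

lemma sum_fun_upd_add_one:
  fixes a :: "'o::finite \<Rightarrow> real"
  shows "(\<Sum>i\<in>UNIV. (a(y := a y + 1)) i * v i) = (\<Sum>i\<in>UNIV. a i * v i) + v y"
    and "(\<Sum>i\<in>UNIV. (a(y := a y + 1)) i) = sum a UNIV + 1"
proof -
  have "(\<Sum>i\<in>UNIV. (a(y := a y + 1)) i * v i) = (\<Sum>i\<in>UNIV. a i * v i + (if i = y then v i else 0))"
    by (intro sum.cong) (auto simp: algebra_simps)
  then show "(\<Sum>i\<in>UNIV. (a(y := a y + 1)) i * v i) = (\<Sum>i\<in>UNIV. a i * v i) + v y"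
    by (simp add: sum.distrib)
  have "(\<Sum>i\<in>UNIV. (a(y := a y + 1)) i) = (\<Sum>i\<in>UNIV. a i + (if i = y then 1 else 0))"
    by (intro sum.cong) auto
  then show "(\<Sum>i\<in>UNIV. (a(y := a y + 1)) i) = sum a UNIV + 1"
    by (simp add: sum.distrib)
qed

definition wmean :: "('o::finite \<Rightarrow> real) \<Rightarrow> ('o \<Rightarrow> real) \<Rightarrow> real" where
  "wmean a v = (\<Sum>i\<in>UNIV. a i * v i) / sum a UNIV"

lemma wmean_bounds:
  assumes "\<And>i. 0 \<le> a i" "0 < sum a UNIV" "\<And>i. l \<le> v i" "\<And>i. v i \<le> u"
  shows "l \<le> wmean a v" "wmean a v \<le> u"
proof -
  have "l * sum a UNIV \<le> (\<Sum>i\<in>UNIV. a i * v i)"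
    unfolding sum_distrib_left using assms by (intro sum_mono) (metis mult.commute mult_left_mono)
  then show "l \<le> wmean a v" using assms(2) by (simp add: wmean_def le_divide_eq)
  have "(\<Sum>i\<in>UNIV. a i * v i) \<le> u * sum a UNIV"
    unfolding sum_distrib_left using assms by (intro sum_mono) (metis mult.commute mult_left_mono)
  then show "wmean a v \<le> u" using assms(2) by (simp add: wmean_def divide_le_eq)
qed

context
  fixes v :: "'o::finite \<Rightarrow> real" and B :: real
  assumes v: "\<And>y. 0 \<le> v y" "\<And>y. v y \<le> B" and B: "0 < B"
begin

lemma measurable_dot [measurable]: "(\<lambda>p. \<Sum>y\<in>UNIV. p y * v y) \<in> borel_measurable (PiM UNIV (\<lambda>_. borel))"
  by measurable

lemma AE_dirichlet_dot:
  assumes "\<And>i. 0 \<le> a i" "0 < sum a UNIV"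
  shows "AE p in dirichlet a. 0 \<le> (\<Sum>y\<in>UNIV. p y * v y) \<and> (\<Sum>y\<in>UNIV. p y * v y) \<le> B"
  using AE_dirichlet_simplex[OF assms]
proof eventually_elim
  case (elim p)
  then show ?case using wmean_bounds[of p 0 v B] v by (simp add: wmean_def)
qed

lemma integrable_dirichlet_dot:
  fixes \<phi> :: "real \<Rightarrow> real"
  assumes a: "\<And>i. 0 \<le> a i" "0 < sum a UNIV" and \<phi>: "K-lipschitz_on UNIV \<phi>"
  shows "integrable (dirichlet a) (\<lambda>p. \<phi> (\<Sum>y\<in>UNIV. p y * v y))"
proof -
  interpret prob_space "dirichlet a" by (rule prob_space_dirichlet[OF a])
  note [measurable] = lipschitz_on_measurable[OF \<phi>]
  have K: "0 \<le> K" using \<phi> by (rule lipschitz_on_nonneg)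
  show ?thesis
  proof (rule integrable_const_bound)
    show "AE p in dirichlet a. norm (\<phi> (\<Sum>y\<in>UNIV. p y * v y)) \<le> \<bar>\<phi> 0\<bar> + K * B"
      using AE_dirichlet_dot[OF a]
    proof eventually_elim
      case (elim p)
      let ?Y = "\<Sum>y\<in>UNIV. p y * v y"
      have "\<bar>\<phi> ?Y - \<phi> 0\<bar> \<le> K * \<bar>?Y\<bar>" using lipschitz_on_abs_le[OF \<phi>, of ?Y 0] by simp
      also have "\<dots> \<le> K * B" using elim K by (intro mult_left_mono) auto
      finally show ?case unfolding real_norm_def by linarith
    qed
  qed measurable
qed

text \<open>Inserting the factor \<open>\<Sum> p y = 1\<close> and applying conjugacy to each
  summand gives one draw of the Polya urn.\<close>

lemma integral_dirichlet_urn: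
  fixes \<phi> :: "real \<Rightarrow> real"
  assumes a: "\<And>i. 0 \<le> a i" "0 < sum a UNIV" and \<phi>: "K-lipschitz_on UNIV \<phi>"
  shows "(\<integral>p. \<phi> (\<Sum>y\<in>UNIV. p y * v y) \<partial>dirichlet a) =
    (\<Sum>y\<in>UNIV. a y / sum a UNIV * (\<integral>p. \<phi> (\<Sum>y\<in>UNIV. p y * v y) \<partial>dirichlet (a(y := a y + 1))))"
proof -
  let ?F = "\<lambda>p. \<phi> (\<Sum>y\<in>UNIV. p y * v y)"
  note [measurable] = lipschitz_on_measurable[OF \<phi>]
  have int: "integrable (dirichlet a) (\<lambda>p. p y * ?F p)" for y
  proof (rule Bochner_Integration.integrable_bound[OF integrable_dirichlet_dot[OF a \<phi>]])
    show "AE p in dirichlet a. norm (p y * ?F p) \<le> norm (?F p)"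
      using AE_dirichlet_simplex[OF a]
    proof eventually_elim
      case (elim p)
      then have "p y \<le> sum p UNIV" by (intro member_le_sum) auto
      with elim have "\<bar>p y\<bar> \<le> 1" by auto
      then show ?case by (simp add: abs_mult mult_left_le_one_le)
    qed
  qed measurable
  have "(\<integral>p. ?F p \<partial>dirichlet a) = (\<integral>p. (\<Sum>y\<in>UNIV. p y * ?F p) \<partial>dirichlet a)"
  proof (intro integral_cong_AE)
    show "AE p in dirichlet a. ?F p = (\<Sum>y\<in>UNIV. p y * ?F p)"
      using AE_dirichlet_simplex[OF a] by eventually_elim (simp add: sum_distrib_right[symmetric])
  qed measurable
  also have "\<dots> = (\<Sum>y\<in>UNIV. \<integral>p. p y * ?F p \<partial>dirichlet a)"
    using int by (rule Bochner_Integration.integral_sum)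
  also have "\<dots> = (\<Sum>y\<in>UNIV. a y / sum a UNIV * (\<integral>p. ?F p \<partial>dirichlet (a(y := a y + 1))))"
    by (intro sum.cong refl integral_dirichlet_mult a) measurable
  finally show ?thesis .
qed

lemma integral_dirichlet_component:
  fixes a :: "'o \<Rightarrow> real"
  assumes a: "\<And>i. 0 \<le> a i" "0 < sum a UNIV"
  shows "(\<integral>p. p y \<partial>dirichlet a) = a y / sum a UNIV"
proof -
  have "prob_space (dirichlet (a(y := a y + 1)))"
    using a sum_fun_upd_add_one(2)[of a y] by (intro prob_space_dirichlet) (auto simp: add_nonneg_nonneg simp del: fun_upd_apply, simp add: add_nonneg_nonneg)
  then have "(\<integral>p. 1 \<partial>dirichlet (a(y := a y + 1))) = (1::real)"
    using prob_space.prob_space by fastforce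
  then show ?thesis using integral_dirichlet_mult[OF a, of "\<lambda>_. 1" y] by simp
qed

lemma integrable_dirichlet_component:
  fixes a :: "'o \<Rightarrow> real"
  assumes a: "\<And>i. 0 \<le> a i" "0 < sum a UNIV"
  shows "integrable (dirichlet a) (\<lambda>p. p y)"
proof -
  interpret prob_space "dirichlet a" by (rule prob_space_dirichlet[OF a])
  have "AE p in dirichlet a. norm (p y) \<le> 1"
    using AE_dirichlet_simplex[OF a]
  proof eventually_elim
    case (elim p)
    then have "p y \<le> sum p UNIV" by (intro member_le_sum) auto
    with elim show ?case by auto
  qed
  then show ?thesis by (intro integrable_const_bound) auto
qed

lemma integral_dirichlet_dot:
  assumes a: "\<And>i. 0 \<le> a i" "0 < sum a UNIV"
  shows "(\<integral>p. (\<Sum>y\<in>UNIV. p y * v y) \<partial>dirichlet a) = wmean a v"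
  using integrable_dirichlet_component[OF a] integral_dirichlet_component[OF a]
  by (simp add: wmean_def sum_divide_distrib)

text \<open>The second moment is again computed by conjugacy: weighting by \<open>p y\<close>
  replaces the mean \<open>m\<close> by the mean after observing \<open>y\<close>, namely
  \<open>(c * m + v y) / (c + 1)\<close>. The bound serves only to show that the law concentrates as
  its mass grows.\<close>

lemma dirichlet_variance_le:
  assumes a: "\<And>i. 0 \<le> a i" "0 < sum a UNIV"
  defines "c \<equiv> \<Sum>i\<in>UNIV. a i"
  shows "integrable (dirichlet a) (\<lambda>p. ((\<Sum>y\<in>UNIV. p y * v y) - wmean a v)\<^sup>2)"
    and "(\<integral>p. ((\<Sum>y\<in>UNIV. p y * v y) - wmean a v)\<^sup>2 \<partial>dirichlet a) \<le> B\<^sup>2 / (c + 1)"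
proof -
  interpret prob_space "dirichlet a" by (rule prob_space_dirichlet[OF a])
  let ?Y = "\<lambda>p. \<Sum>y\<in>UNIV. p y * v y" and ?m = "wmean a v"
  have c: "0 < c" using a by (simp add: c_def)
  have "AE p in dirichlet a. norm ((?Y p)\<^sup>2) \<le> B\<^sup>2"
    using AE_dirichlet_dot[OF a] by eventually_elim (auto intro: power_mono)
  then have int2: "integrable (dirichlet a) (\<lambda>p. (?Y p)\<^sup>2)"
    by (intro integrable_const_bound[of _ "B\<^sup>2"]) measurable
  have int1: "integrable (dirichlet a) ?Y"
    using integrable_dirichlet_component[OF a] by simp
  have eq: "(?Y p - ?m)\<^sup>2 = (?Y p)\<^sup>2 - 2 * ?m * ?Y p + ?m\<^sup>2" for p
    by (simp add: power2_eq_square algebra_simps)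
  show "integrable (dirichlet a) (\<lambda>p. (?Y p - ?m)\<^sup>2)"
    unfolding eq using int1 int2 by auto
  have intp: "integrable (dirichlet a) (\<lambda>p. p y * ?Y p)" for y
  proof (rule Bochner_Integration.integrable_bound[OF int1])
    show "AE p in dirichlet a. norm (p y * ?Y p) \<le> norm (?Y p)"
      using AE_dirichlet_simplex[OF a]
    proof eventually_elim
      case (elim p)
      then have "p y \<le> sum p UNIV" by (intro member_le_sum) auto
      with elim have "\<bar>p y\<bar> \<le> 1" by auto
      then show ?case by (simp add: abs_mult mult_left_le_one_le)
    qed
  qed measurable
  have bump: "wmean (a(y := a y + 1)) v = (c * ?m + v y) / (c + 1)" for y
    unfolding wmean_def sum_fun_upd_add_one using c by (simp add: c_def)
  have "(\<integral>p. (?Y p)\<^sup>2 \<partial>dirichlet a) = (\<integral>p. (\<Sum>y\<in>UNIV. v y * (p y * ?Y p)) \<partial>dirichlet a)"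
    by (intro Bochner_Integration.integral_cong refl) (simp add: power2_eq_square sum_distrib_right sum_distrib_left mult_ac)
  also have "\<dots> = (\<Sum>y\<in>UNIV. v y * (\<integral>p. p y * ?Y p \<partial>dirichlet a))"
    using intp by simp
  also have "\<dots> = (\<Sum>y\<in>UNIV. v y * (a y / c * ((c * ?m + v y) / (c + 1))))"
  proof (intro sum.cong refl arg_cong2[where f = "(*)"])
    fix y
    have "(\<integral>p. p y * ?Y p \<partial>dirichlet a) = a y / c * (\<integral>p. ?Y p \<partial>dirichlet (a(y := a y + 1)))"
      unfolding c_def by (intro integral_dirichlet_mult a) measurable
    also have "(\<integral>p. ?Y p \<partial>dirichlet (a(y := a y + 1))) = wmean (a(y := a y + 1)) v"
      using a by (intro integral_dirichlet_dot) (auto simp: sum_fun_upd_add_one add_nonneg_nonneg simp del: fun_upd_apply, auto simp: add_nonneg_nonneg)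
    finally show "(\<integral>p. p y * ?Y p \<partial>dirichlet a) = a y / c * ((c * ?m + v y) / (c + 1))"
      by (simp add: bump)
  qed
  also have "\<dots> = (\<Sum>y\<in>UNIV. (a y * v y / c) * (c * ?m / (c + 1)) + (a y / c) * (v y)\<^sup>2 / (c + 1))"
    by (intro sum.cong refl) (simp add: power2_eq_square add_divide_distrib algebra_simps)
  also have "\<dots> = ?m * (c * ?m / (c + 1)) + (\<Sum>y\<in>UNIV. (a y / c) * (v y)\<^sup>2) / (c + 1)"
    by (simp add: sum.distrib sum_distrib_right[symmetric] sum_divide_distrib[symmetric] wmean_def c_def)
  also have "\<dots> \<le> ?m * (c * ?m / (c + 1)) + B\<^sup>2 / (c + 1)"
  proof -
    have "(\<Sum>y\<in>UNIV. (a y / c) * (v y)\<^sup>2) \<le> (\<Sum>y\<in>UNIV. (a y / c) * B\<^sup>2)"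
      using a c v by (intro sum_mono mult_left_mono power_mono) auto
    also have "\<dots> = B\<^sup>2"
      using c by (simp add: sum_distrib_right[symmetric] sum_divide_distrib[symmetric] c_def)
    finally show ?thesis using c by (simp add: divide_right_mono)
  qed
  also have "?m * (c * ?m / (c + 1)) \<le> ?m\<^sup>2"
    using c by (simp add: field_simps power2_eq_square)
  finally have "(\<integral>p. (?Y p)\<^sup>2 \<partial>dirichlet a) \<le> ?m\<^sup>2 + B\<^sup>2 / (c + 1)" by simp
  then show "(\<integral>p. (?Y p - ?m)\<^sup>2 \<partial>dirichlet a) \<le> B\<^sup>2 / (c + 1)"
    unfolding eq using int1 int2 integral_dirichlet_dot[OF a] prob_space
    by (simp add: power2_eq_square)
qed

text \<open>Base of the urn induction: for large mass the law is close to its mean. The elementary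
  inequality \<open>2 * q \<le> q * q / t + t\<close> passes from the mean absolute deviation to the
  variance.\<close>

lemma dirichlet_lipschitz_le:
  fixes \<phi> :: "real \<Rightarrow> real"
  assumes a: "\<And>i. 0 \<le> a i" "0 < sum a UNIV" and \<phi>: "K-lipschitz_on UNIV \<phi>"
  shows "(\<integral>p. \<phi> (\<Sum>y\<in>UNIV. p y * v y) \<partial>dirichlet a) \<le> \<phi> (wmean a v) + K * (B / sqrt (sum a UNIV + 1))"
proof -
  interpret prob_space "dirichlet a" by (rule prob_space_dirichlet[OF a])
  let ?Y = "\<lambda>p. \<Sum>y\<in>UNIV. p y * v y" and ?m = "wmean a v"
  \<comment> \<open>The value of \<open>t\<close> that balances the two terms, since
    \<open>t * t\<close> is exactly the variance bound.\<close>
  define t where "t = B / sqrt (sum a UNIV + 1)"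
  have t: "0 < t" using B a by (simp add: t_def)
  have t2: "B\<^sup>2 / (sum a UNIV + 1) = t\<^sup>2"
    using a by (simp add: t_def power_divide)
  have K: "0 \<le> K" using \<phi> by (rule lipschitz_on_nonneg)
  note var = dirichlet_variance_le[OF a]
  have "(\<integral>p. \<phi> (?Y p) \<partial>dirichlet a) \<le> (\<integral>p. \<phi> ?m + K * ((?Y p - ?m)\<^sup>2 / t + t) / 2 \<partial>dirichlet a)"
  proof (intro integral_mono integrable_dirichlet_dot[OF a \<phi>])
    fix p
    define q where "q = \<bar>?Y p - ?m\<bar>"
    have qY: "q * q = (?Y p - ?m)\<^sup>2" by (simp add: q_def power2_eq_square)
    have "0 \<le> (q - t)\<^sup>2" by simp
    then have "2 * q * t \<le> (?Y p - ?m)\<^sup>2 + t * t"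
      unfolding qY[symmetric] by (simp add: power2_eq_square algebra_simps)
    then have "2 * q \<le> ((?Y p - ?m)\<^sup>2 + t * t) / t"
      using t by (simp add: le_divide_eq)
    also have "\<dots> = (?Y p - ?m)\<^sup>2 / t + t"
      using t by (simp add: add_divide_distrib)
    finally have "K * (2 * q) \<le> K * ((?Y p - ?m)\<^sup>2 / t + t)"
      using K by (rule mult_left_mono)
    moreover have "\<phi> (?Y p) - \<phi> ?m \<le> K * q"
      using lipschitz_on_abs_le[OF \<phi>, of "?Y p" ?m] unfolding q_def by (rule abs_le_D1)
    moreover have "x \<le> y + w / 2" if "K * (2 * q) \<le> w" "x - y \<le> K * q" for x y w
      using that by simp
    ultimately show "\<phi> (?Y p) \<le> \<phi> ?m + K * ((?Y p - ?m)\<^sup>2 / t + t) / 2"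
      by blast
  qed (use var(1) in auto)
  also have "\<dots> = \<phi> ?m + K * ((\<integral>p. (?Y p - ?m)\<^sup>2 \<partial>dirichlet a) / t + t) / 2"
    using var(1) prob_space by (simp add: distrib_left)
  also have "\<dots> \<le> \<phi> ?m + K * (t\<^sup>2 / t + t) / 2"
    using var(2) t K unfolding t2 by (intro add_left_mono divide_right_mono mult_left_mono add_right_mono) auto
  also have "\<dots> = \<phi> ?m + K * t" using t by (simp add: power2_eq_square)
  finally show ?thesis by (simp add: t_def)
qed

text \<open>A draw from the Polya urn with total mass \<open>c\<close> moves the mean by a centered increment bounded by
  \<open>B / (c + 1)\<close>, which a Gaussian of standard deviation \<open>\<surd>3 B / (c + 1)\<close> dominates in convex order; the
  variances add up to at most \<open>3 B\<^sup>2 / c\<close> because \<open>1 / (c + 1)\<^sup>2 + 1 / (c + 1) \<le> 1 / c\<close>.\<close>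
lemma dirichlet_le_smooth_approx:
  assumes "\<And>i. 0 \<le> a i" "0 < sum a UNIV" and \<phi>: "K-lipschitz_on UNIV \<phi>" "convex_on UNIV \<phi>"
  shows "(\<integral>p. \<phi> (\<Sum>y\<in>UNIV. p y * v y) \<partial>dirichlet a)
    \<le> smooth (sqrt (3 / sum a UNIV) * B) \<phi> (wmean a v) + K * (B / sqrt (sum a UNIV + real n + 1))"
  using assms(1,2)
proof (induction n arbitrary: a)
  case 0
  then show ?case
    using dirichlet_lipschitz_le[OF 0 \<phi>(1)] smooth_ge[OF \<phi>, of "wmean a v" "sqrt (3 / sum a UNIV) * B"] by simp
next
  case (Suc n)
  define c where "c = sum a UNIV"
  define s where "s = sqrt (3 / (c + 1)) * B"
  define d where "d = B / (c + 1)"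
  let ?m = "wmean a v"
  have c: "0 < c" using Suc.prems by (simp add: c_def)
  have m: "0 \<le> ?m" "?m \<le> B" using wmean_bounds[OF Suc.prems v] by auto
  have d: "0 < d" using c B by (simp add: d_def)
  have s: "0 < s" using c B by (simp add: s_def)
  have nn: "0 \<le> (a(y := a y + 1)) i" for y i using Suc.prems(1) by (simp add: add_nonneg_nonneg)
  have bump: "wmean (a(y := a y + 1)) v = ?m + (v y - ?m) / (c + 1)" for y
  proof -
    have "(\<Sum>i\<in>UNIV. a i * v i) = c * ?m" using c by (simp add: wmean_def c_def)
    then show ?thesis
      unfolding wmean_def[of "a(y := a y + 1)"] sum_fun_upd_add_one c_def[symmetric] using c by (simp add: field_simps)
  qed
  \<comment> \<open>The mass goes up by one while the number of remaining draws goes down by one, so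
    the error term stays the same and passes unchanged through the average over
    \<open>y\<close>.\<close>
  have IH: "(\<integral>p. \<phi> (\<Sum>y\<in>UNIV. p y * v y) \<partial>dirichlet (a(y := a y + 1)))
      \<le> smooth s \<phi> (?m + (v y - ?m) / (c + 1)) + K * (B / sqrt (c + real (Suc n) + 1))" for y
    using Suc.IH[of "a(y := a y + 1)"] nn c
    unfolding sum_fun_upd_add_one bump c_def[symmetric] s_def by (simp add: add_ac del: fun_upd_apply)
  have w: "(\<Sum>y\<in>UNIV. a y / c) = 1"
    using c by (simp add: sum_divide_distrib[symmetric] c_def)
  have "(\<integral>p. \<phi> (\<Sum>y\<in>UNIV. p y * v y) \<partial>dirichlet a) =
      (\<Sum>y\<in>UNIV. a y / c * (\<integral>p. \<phi> (\<Sum>y\<in>UNIV. p y * v y) \<partial>dirichlet (a(y := a y + 1))))"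
    unfolding c_def by (rule integral_dirichlet_urn[OF Suc.prems \<phi>(1)])
  also have "\<dots> \<le> (\<Sum>y\<in>UNIV. a y / c * (smooth s \<phi> (?m + (v y - ?m) / (c + 1)) + K * (B / sqrt (c + real (Suc n) + 1))))"
    using Suc.prems c by (intro sum_mono mult_left_mono IH) auto
  also have "\<dots> = (\<Sum>y\<in>UNIV. a y / c * smooth s \<phi> (?m + (v y - ?m) / (c + 1))) + K * (B / sqrt (c + real (Suc n) + 1))"
    by (simp only: distrib_left sum.distrib sum_distrib_right[symmetric] w mult_1)
  also have "(\<Sum>y\<in>UNIV. a y / c * smooth s \<phi> (?m + (v y - ?m) / (c + 1))) \<le> smooth (sqrt 3 * d) (smooth s \<phi>) ?m"
  proof (rule bounded_centered_le_smooth[OF lipschitz_smooth[OF \<phi>(1)] convex_smooth[OF \<phi>]])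
    show "0 \<le> a y / c" for y using Suc.prems c by simp
    show "(\<Sum>y\<in>UNIV. a y / c) = 1" by (rule w)
    have "(\<Sum>y\<in>UNIV. a y / c * ((v y - ?m) / (c + 1))) = (\<Sum>y\<in>UNIV. a y / c * v y - a y / c * ?m) / (c + 1)"
      unfolding sum_divide_distrib by (intro sum.cong refl) (simp add: algebra_simps diff_divide_distrib)
    also have "(\<Sum>y\<in>UNIV. a y / c * v y - a y / c * ?m) = 0"
      unfolding sum_subtractf sum_distrib_right[symmetric] w by (simp add: wmean_def c_def sum_divide_distrib)
    finally show "(\<Sum>y\<in>UNIV. a y / c * ((v y - ?m) / (c + 1))) = 0" by simp
    show "\<bar>(v y - ?m) / (c + 1)\<bar> \<le> d" for y
      using m v[of y] c unfolding d_def by (auto simp: abs_le_iff divide_simps)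
    show "0 < d" by (rule d)
    \<comment> \<open>The constant 3 of the algorithm's variance absorbs the factor
      \<open>pi / 2\<close> of the two-point comparison.\<close>
    have "pi / 2 \<le> 3" using pi_less_4 by simp
    then have "sqrt (pi / 2) \<le> sqrt 3" by (rule real_sqrt_le_mono)
    then show "sqrt (pi / 2) * d \<le> sqrt 3 * d" using d by (intro mult_right_mono) auto
  qed
  also have "smooth (sqrt 3 * d) (smooth s \<phi>) ?m = smooth (sqrt ((sqrt 3 * d)\<^sup>2 + s\<^sup>2)) \<phi> ?m"
    using d s by (intro smooth_smooth[OF \<phi>(1)]) auto
  also have "\<dots> \<le> smooth (sqrt (3 / c) * B) \<phi> ?m"
  proof (rule smooth_mono_scale[OF \<phi>])
    have "(sqrt 3 * d)\<^sup>2 + s\<^sup>2 = 3 * B\<^sup>2 * (1 / (c + 1)\<^sup>2 + 1 / (c + 1))"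
      using c unfolding d_def s_def by (simp add: power_mult_distrib power_divide field_simps)
    also have "1 / (c + 1)\<^sup>2 + 1 / (c + 1) \<le> 1 / c"
      using c by (simp add: divide_simps power2_eq_square) (simp add: algebra_simps)
    then have "3 * B\<^sup>2 * (1 / (c + 1)\<^sup>2 + 1 / (c + 1)) \<le> 3 * B\<^sup>2 * (1 / c)"
      by (intro mult_left_mono) auto
    also have "3 * B\<^sup>2 * (1 / c) = (sqrt (3 / c) * B)\<^sup>2"
      using c by (simp add: power_mult_distrib)
    finally show "sqrt ((sqrt 3 * d)\<^sup>2 + s\<^sup>2) \<le> sqrt (3 / c) * B"
      using c B by (intro real_le_lsqrt) auto
  qed simp
  finally show ?case by (simp add: c_def)
qed

text \<open>The approximate bound holds for every number \<open>n\<close> of urn draws, and its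
  error vanishes as \<open>n\<close> tends to infinity.\<close>

lemma dirichlet_le_smooth:
  assumes a: "\<And>i. 0 \<le> a i" "0 < sum a UNIV" and \<phi>: "K-lipschitz_on UNIV \<phi>" "convex_on UNIV \<phi>"
  shows "(\<integral>p. \<phi> (\<Sum>y\<in>UNIV. p y * v y) \<partial>dirichlet a) \<le> smooth (sqrt (3 / sum a UNIV) * B) \<phi> (wmean a v)"
proof (rule LIMSEQ_le_const)
  let ?c = "\<Sum>i\<in>UNIV. a i"
  have "(\<lambda>n. B / sqrt (c + real n + 1)) \<longlonglongrightarrow> 0" for c
    by real_asymp
  then have "(\<lambda>n. smooth (sqrt (3 / ?c) * B) \<phi> (wmean a v) + K * (B / sqrt (?c + real n + 1)))
      \<longlonglongrightarrow> smooth (sqrt (3 / ?c) * B) \<phi> (wmean a v) + K * 0"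
    by (intro tendsto_intros)
  then show "(\<lambda>n. smooth (sqrt (3 / ?c) * B) \<phi> (wmean a v) + K * (B / sqrt (?c + real n + 1)))
      \<longlonglongrightarrow> smooth (sqrt (3 / ?c) * B) \<phi> (wmean a v)"
    by simp
  show "\<exists>N. \<forall>n\<ge>N. (\<integral>p. \<phi> (\<Sum>y\<in>UNIV. p y * v y) \<partial>dirichlet a) \<le>
      smooth (sqrt (3 / ?c) * B) \<phi> (wmean a v) + K * (B / sqrt (?c + real n + 1))"
    using dirichlet_le_smooth_approx[OF a \<phi>] by blast
qed

end

subsection \<open>Affine backward induction\<close>

text \<open>Both the Bellman backup (\<open>w\<close> the outcome probabilities, \<open>b = 0\<close>) and the update of the algorithm (\<open>w\<close> the
  counts divided by \<open>n + \<beta>\<close>, \<open>b\<close> the prior term plus the scaled noise) have the following affine form.\<close>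
definition backup ::
    "(('x::finite, 'a) sa \<Rightarrow> 'x outcome \<Rightarrow> real) \<Rightarrow> (('x, 'a) sa \<Rightarrow> real) \<Rightarrow> ('x \<Rightarrow> real) \<Rightarrow> ('x, 'a) sa \<Rightarrow> real" where
  "backup w b V s = (\<Sum>y\<in>UNIV. w s y * (of_bool (fst y) + V (snd y))) + b s"

primrec bv ::
    "(('x::finite, 'a::finite) sa \<Rightarrow> 'x outcome \<Rightarrow> real) \<Rightarrow> (('x, 'a) sa \<Rightarrow> real) \<Rightarrow> nat \<Rightarrow> nat \<Rightarrow> 'x \<Rightarrow> real" where
  "bv w b 0 h x = 0"
| "bv w b (Suc k) h x = (MAX a. backup w b (bv w b k (Suc h)) (h, x, a))"

text \<open>Mass below 1 is allowed because the counts are divided by \<open>n + \<beta>\<close>,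
  and because the row of a singled-out triple is set to zero.\<close>

definition substochastic :: "('s \<Rightarrow> 'o::finite \<Rightarrow> real) \<Rightarrow> bool" where
  "substochastic w \<longleftrightarrow> (\<forall>s. (\<forall>y. 0 \<le> w s y) \<and> sum (w s) UNIV \<le> 1)"

lemma substochasticD:
  assumes "substochastic w"
  shows "0 \<le> w s y" "sum (w s) UNIV \<le> 1"
  using assms unfolding substochastic_def by blast+

abbreviation model_bv :: "('x::finite, 'a::finite) model \<Rightarrow> nat \<Rightarrow> nat \<Rightarrow> 'x \<Rightarrow> real" where
  "model_bv P \<equiv> bv (\<lambda>s. pmf (outcome_pmf (P s))) (\<lambda>_. 0)"

lemma substochastic_outcome: "substochastic (\<lambda>s. pmf (outcome_pmf (P s)))"
  by (simp add: substochastic_def)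

lemma Max_le_iff_fun: "(MAX a. f a) \<le> c \<longleftrightarrow> (\<forall>a. f a \<le> c)"
  for f :: "'a::finite \<Rightarrow> real"
  by (subst Max_le_iff) auto

lemma le_MaxI: "c \<le> f a \<Longrightarrow> c \<le> (MAX a. f a)"
  for f :: "'a::finite \<Rightarrow> real"
  by (rule order_trans[of _ "f a"]) (auto intro: Max_ge)

lemma Max_ge_fun: "f a \<le> (MAX a. f a)"
  for f :: "'a::finite \<Rightarrow> real"
  by (auto intro: Max_ge)

lemma weighted_sum_le:
  fixes w :: "'o::finite \<Rightarrow> real"
  assumes "\<And>y. 0 \<le> w y" "sum w UNIV \<le> 1" "\<And>y. f y \<le> g y + c" "0 \<le> c"
  shows "(\<Sum>y\<in>UNIV. w y * f y) \<le> (\<Sum>y\<in>UNIV. w y * g y) + c"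
proof -
  have "(\<Sum>y\<in>UNIV. w y * f y) \<le> (\<Sum>y\<in>UNIV. w y * (g y + c))"
    using assms by (intro sum_mono mult_left_mono) auto
  also have "\<dots> = (\<Sum>y\<in>UNIV. w y * g y) + sum w UNIV * c"
    by (simp add: distrib_left sum.distrib sum_distrib_right)
  also have "sum w UNIV * c \<le> 1 * c" using assms by (intro mult_right_mono) auto
  finally show ?thesis by simp
qed

lemma bv_cong:
  assumes "\<And>h' x a. h \<le> h' \<Longrightarrow> h' < h + k \<Longrightarrow> w (h', x, a) = w' (h', x, a)"
    and "\<And>h' x a. h \<le> h' \<Longrightarrow> h' < h + k \<Longrightarrow> b (h', x, a) = b' (h', x, a)"
  shows "bv w b k h x = bv w' b' k h x"
  using assms
proof (induction k arbitrary: h x)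
  case (Suc k)
  have "bv w b k (Suc h) = bv w' b' k (Suc h)"
    by (intro ext Suc.IH Suc.prems) auto
  with Suc.prems[of h] show ?case by (simp add: backup_def)
qed simp

text \<open>A perturbation of \<open>b\<close> enters each layer once and is not amplified, since
  the weights sum to at most 1 and maxima are nonexpansive. Taking \<open>c = 0\<close> gives
  monotonicity; a \<open>c\<close> supported on one triple gives the Lipschitz bound.\<close>

lemma bv_le_add:
  assumes w: "substochastic w" and "\<And>s. b s \<le> b' s + c s" "\<And>s. 0 \<le> c s"
  shows "bv w b k h x \<le> bv w b' k h x + (\<Sum>j<k. MAX xa. c (h + j, fst xa, snd xa))"
proof (induction k arbitrary: h x)
  case (Suc k)
  let ?C = "\<lambda>h. MAX xa. c (h, fst xa, snd xa)"
  let ?S = "\<Sum>j<k. ?C (Suc h + j)"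
  have C: "c (h, x, a) \<le> ?C h" for h x a
    using Max_ge_fun[of "\<lambda>xa. c (h, fst xa, snd xa)" "(x, a)"] by simp
  have C0: "0 \<le> ?C h" for h by (rule order_trans[OF assms(3) C])
  have S: "(\<Sum>j<Suc k. ?C (h + j)) = ?C h + ?S"
    by (simp only: sum.lessThan_Suc_shift) simp
  have "backup w b (bv w b k (Suc h)) (h, x, a) \<le> (MAX a. backup w b' (bv w b' k (Suc h)) (h, x, a)) + (?C h + ?S)" for a
  proof -
    have "(\<Sum>y\<in>UNIV. w (h, x, a) y * (of_bool (fst y) + bv w b k (Suc h) (snd y)))
      \<le> (\<Sum>y\<in>UNIV. w (h, x, a) y * (of_bool (fst y) + bv w b' k (Suc h) (snd y))) + ?S"
      using Suc.IH[of "Suc h"] C0 by (intro weighted_sum_le substochasticD[OF w]) (auto simp: add.assoc intro!: sum_nonneg)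
    then have "backup w b (bv w b k (Suc h)) (h, x, a) \<le> backup w b' (bv w b' k (Suc h)) (h, x, a) + (?C h + ?S)"
      using assms(2)[of "(h, x, a)"] C[of h x a] unfolding backup_def by linarith
    then show ?thesis using Max_ge_fun[of "\<lambda>a. backup w b' (bv w b' k (Suc h)) (h, x, a)" a] by linarith
  qed
  then show ?case unfolding S by (simp add: Max_le_iff_fun)
qed simp

lemma bv_mono:
  assumes w: "substochastic w" and "\<And>s. b s \<le> b' s"
  shows "bv w b k h x \<le> bv w b' k h x"
  using bv_le_add[OF w, of b b' "\<lambda>_. 0"] assms(2) by simp

text \<open>Nonnegative weights and maxima preserve convexity, so the whole recursion is convex
  jointly in all entries of \<open>b\<close>.\<close>

lemma bv_convex:
  assumes w: "substochastic w" and t: "0 \<le> t" "t \<le> 1"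
  shows "bv w (\<lambda>s. (1 - t) * b s + t * b' s) k h x \<le> (1 - t) * bv w b k h x + t * bv w b' k h x"
proof (induction k arbitrary: h x)
  case (Suc k)
  let ?b = "\<lambda>s. (1 - t) * b s + t * b' s"
  have "backup w ?b (bv w ?b k (Suc h)) (h, x, a) \<le> (1 - t) * bv w b (Suc k) h x + t * bv w b' (Suc k) h x" for a
  proof -
    have "(\<Sum>y\<in>UNIV. w (h, x, a) y * (of_bool (fst y) + bv w ?b k (Suc h) (snd y)))
      \<le> (\<Sum>y\<in>UNIV. w (h, x, a) y * ((1 - t) * (of_bool (fst y) + bv w b k (Suc h) (snd y)) + t * (of_bool (fst y) + bv w b' k (Suc h) (snd y)))) + 0"
    proof (intro weighted_sum_le substochasticD[OF w])
      fix y
      show "of_bool (fst y) + bv w ?b k (Suc h) (snd y) \<le>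
        (1 - t) * (of_bool (fst y) + bv w b k (Suc h) (snd y)) + t * (of_bool (fst y) + bv w b' k (Suc h) (snd y)) + 0"
        using Suc.IH[of "Suc h" "snd y"] by (simp add: algebra_simps)
    qed simp
    also have "\<dots> = (1 - t) * (\<Sum>y\<in>UNIV. w (h, x, a) y * (of_bool (fst y) + bv w b k (Suc h) (snd y)))
        + t * (\<Sum>y\<in>UNIV. w (h, x, a) y * (of_bool (fst y) + bv w b' k (Suc h) (snd y)))"
      unfolding sum_distrib_left sum.distrib[symmetric] add_0_right
      by (intro sum.cong refl) (simp add: algebra_simps)
    finally have "backup w ?b (bv w ?b k (Suc h)) (h, x, a)
        \<le> (1 - t) * backup w b (bv w b k (Suc h)) (h, x, a) + t * backup w b' (bv w b' k (Suc h)) (h, x, a)"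
      unfolding backup_def by (simp add: distrib_left)
    also have "\<dots> \<le> (1 - t) * bv w b (Suc k) h x + t * bv w b' (Suc k) h x"
      using t by (intro add_mono mult_left_mono) (auto intro: Max_ge)
    finally show ?thesis .
  qed
  then show ?case by (simp add: Max_le_iff_fun)
qed simp

text \<open>The constant is 1 and not \<open>k\<close>, because the changed triple lies in a single
  layer.\<close>

lemma bv_upd_le:
  assumes w: "substochastic w"
  shows "bv w (b(s := u)) k h x \<le> bv w (b(s := u')) k h x + \<bar>u - u'\<bar>"
proof -
  let ?c = "\<lambda>s'. if s' = s then \<bar>u - u'\<bar> else 0"
  have "bv w (b(s := u)) k h x \<le> bv w (b(s := u')) k h x + (\<Sum>j<k. MAX xa. ?c (h + j, fst xa, snd xa))"
    using w by (rule bv_le_add) auto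
  \<comment> \<open>If \<open>fst s < h\<close>, the truncated difference points at
    \<open>j = 0\<close>, where the left side is 0; the bound then still holds.\<close>
  also have "(\<Sum>j<k. MAX xa. ?c (h + j, fst xa, snd xa)) \<le> (\<Sum>j<k. if j = fst s - h then \<bar>u - u'\<bar> else 0)"
    by (intro sum_mono, unfold Max_le_iff_fun) auto
  also have "\<dots> \<le> \<bar>u - u'\<bar>" by (simp add: sum.delta)
  finally show ?thesis by (simp del: fun_upd_apply)
qed

lemma lipschitz_bv_upd:
  assumes w: "substochastic w"
  shows "1-lipschitz_on UNIV (\<lambda>u. bv w (b(s := u)) k h x)"
proof (intro lipschitz_onI)
  fix u u' :: real
  show "dist (bv w (b(s := u)) k h x) (bv w (b(s := u')) k h x) \<le> 1 * dist u u'"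
    using bv_upd_le[OF w, of b s u k h x u'] bv_upd_le[OF w, of b s u' k h x u]
    by (auto simp: dist_real_def abs_le_iff abs_minus_commute[of u' u])
qed simp

lemma convex_bv_upd:
  assumes w: "substochastic w"
  shows "convex_on UNIV (\<lambda>u. bv w (b(s := u)) k h x)"
proof (rule convex_onI)
  fix t u u' :: real assume t: "0 < t" "t < 1"
  have "b(s := (1 - t) *\<^sub>R u + t *\<^sub>R u') = (\<lambda>s'. (1 - t) * (b(s := u)) s' + t * (b(s := u')) s')"
    by (auto simp: fun_eq_iff algebra_simps)
  then show "bv w (b(s := (1 - t) *\<^sub>R u + t *\<^sub>R u')) k h x \<le> (1 - t) * bv w (b(s := u)) k h x + t * bv w (b(s := u')) k h x"
    using bv_convex[OF w, of t "b(s := u)" "b(s := u')" k h x] t by simp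
qed simp

text \<open>Isolates the dependence of the value on one triple \<open>s\<close>, at which a Dirichlet law is then exchanged
  for a Gaussian one.\<close>
lemma bv_replace:
  assumes "fst s \<ge> h" "fst s < h + k"
  shows "bv w b k h x = bv (w(s := (\<lambda>_. 0))) (b(s := backup w b (bv w b (h + k - Suc (fst s)) (Suc (fst s))) s)) k h x"
  using assms
proof (induction k arbitrary: h x)
  case (Suc k)
  let ?u = "backup w b (bv w b (h + Suc k - Suc (fst s)) (Suc (fst s))) s"
  let ?w = "w(s := (\<lambda>_. 0))" and ?b = "b(s := ?u)"
  show ?case
  proof (cases "fst s = h")
    case True
    have "bv w b k (Suc h) = bv ?w ?b k (Suc h)"
      using True by (intro ext bv_cong) auto
    then have "backup w b (bv w b k (Suc h)) (h, x, a) = backup ?w ?b (bv ?w ?b k (Suc h)) (h, x, a)" for a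
      using True by (cases "(h, x, a) = s") (auto simp: backup_def)
    then show ?thesis by (simp del: fun_upd_apply)
  next
    case False
    then have eq: "bv w b k (Suc h) = bv ?w ?b k (Suc h)"
      using Suc.IH[of "Suc h"] Suc.prems by (intro ext) (simp del: fun_upd_apply)
    have "(h, x, a) \<noteq> s" for a using False by auto
    then have bk: "backup ?w ?b V (h, x, a) = backup w b V (h, x, a)" for V a
      by (simp add: backup_def)
    show ?thesis by (simp only: bv.simps eq[symmetric] bk)
  qed
qed simp

text \<open>Agreement with a true model is assumed only on the layers that the recursion reads, so
  that the lemma applies to hybrids in which earlier layers already follow the algorithm.\<close>

lemma bv_true_bounds:
  fixes P :: "('x::finite, 'a::finite) model"
  assumes "\<And>h' x a. h \<le> h' \<Longrightarrow> h' < h + k \<Longrightarrow> w (h', x, a) = pmf (outcome_pmf (P (h', x, a)))"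
    and "\<And>h' x a. h \<le> h' \<Longrightarrow> h' < h + k \<Longrightarrow> b (h', x, a) = 0"
  shows "0 \<le> bv w b k h x \<and> bv w b k h x \<le> real k"
  using assms
proof (induction k arbitrary: h x)
  case (Suc k)
  have IH: "0 \<le> bv w b k (Suc h) x \<and> bv w b k (Suc h) x \<le> real k" for x
    by (intro Suc.IH Suc.prems) auto
  have bd: "0 \<le> backup w b (bv w b k (Suc h)) (h, x, a)" "backup w b (bv w b k (Suc h)) (h, x, a) \<le> real (Suc k)" for a
  proof -
    have "(\<Sum>y\<in>UNIV. pmf (outcome_pmf (P (h, x, a))) y * (of_bool (fst y) + bv w b k (Suc h) (snd y)))
        \<le> (\<Sum>y\<in>UNIV. pmf (outcome_pmf (P (h, x, a))) y * real (Suc k))"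
    proof (intro sum_mono mult_left_mono)
      show "of_bool (fst y) + bv w b k (Suc h) (snd y) \<le> real (Suc k)" for y
        using IH[of "snd y"] by (simp add: of_bool_def)
    qed simp
    also have "\<dots> = real (Suc k)" by (simp only: sum_distrib_right[symmetric] sum_pmf_UNIV mult_1)
    finally show "backup w b (bv w b k (Suc h)) (h, x, a) \<le> real (Suc k)"
      using Suc.prems[of h x a] by (simp add: backup_def)
    show "0 \<le> backup w b (bv w b k (Suc h)) (h, x, a)"
      using IH Suc.prems[of h x a] by (auto simp: backup_def intro!: sum_nonneg mult_nonneg_nonneg add_nonneg_nonneg)
  qed
  then show ?case by (auto simp: Max_le_iff_fun intro: le_MaxI)
qed simp

text \<open>Rewards are nonnegative, so only the shifts \<open>b\<close> can push a value below 0.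
  This limits how negative the values of \<open>Q\<close> become, on which the bias caused by the
  prior depends.\<close>

lemma bv_lower:
  assumes w: "substochastic w" and "\<And>x a h'. h \<le> h' \<Longrightarrow> h' < h + k \<Longrightarrow> - c \<le> b (h', x, a)" "0 \<le> c"
  shows "- (real k * c) \<le> bv w b k h x"
  using assms(2)
proof (induction k arbitrary: h x)
  case (Suc k)
  have IH: "- (real k * c) \<le> bv w b k (Suc h) x" for x
    by (intro Suc.IH Suc.prems) auto
  obtain a :: 'b where True by simp
  have "(\<Sum>y\<in>UNIV. w (h, x, a) y * 0) \<le> (\<Sum>y\<in>UNIV. w (h, x, a) y * (of_bool (fst y) + bv w b k (Suc h) (snd y))) + real k * c"
  proof (intro weighted_sum_le substochasticD[OF w])
    show "0 \<le> of_bool (fst y) + bv w b k (Suc h) (snd y) + real k * c" for y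
      using IH[of "snd y"] by (simp add: of_bool_def)
  qed (use \<open>0 \<le> c\<close> in simp)
  then have "- (real (Suc k) * c) \<le> backup w b (bv w b k (Suc h)) (h, x, a)"
    using Suc.prems[of h x a] by (simp add: backup_def algebra_simps)
  then show ?case by (simp add: le_MaxI)
qed simp

lemma bv_abs_bound:
  assumes w: "substochastic w" and "\<And>x a h'. h \<le> h' \<Longrightarrow> h' < h + k \<Longrightarrow> \<bar>b (h', x, a)\<bar> \<le> c" "0 \<le> c"
  shows "\<bar>bv w b k h x\<bar> \<le> real k * (1 + c)"
proof -
  have "bv w b k h x \<le> real k * (1 + c)"
    using assms(2)
  proof (induction k arbitrary: h x)
    case (Suc k)
    have IH: "bv w b k (Suc h) x \<le> real k * (1 + c)" for x
      by (intro Suc.IH Suc.prems) auto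
    have "backup w b (bv w b k (Suc h)) (h, x, a) \<le> real (Suc k) * (1 + c)" for a
    proof -
      have "(\<Sum>y\<in>UNIV. w (h, x, a) y * (of_bool (fst y) + bv w b k (Suc h) (snd y))) \<le> (\<Sum>y\<in>UNIV. w (h, x, a) y * 0) + (1 + real k * (1 + c))"
      proof (intro weighted_sum_le substochasticD[OF w])
        show "of_bool (fst y) + bv w b k (Suc h) (snd y) \<le> 0 + (1 + real k * (1 + c))" for y
          using IH[of "snd y"] by (simp add: of_bool_def)
      qed (use \<open>0 \<le> c\<close> in simp)
      then show ?thesis using Suc.prems[of h x a] by (simp add: backup_def algebra_simps abs_le_iff)
    qed
    then show ?case by (simp add: Max_le_iff_fun)
  qed simp
  moreover have "- (real k * c) \<le> bv w b k h x"
    using assms by (intro bv_lower) (auto simp: abs_le_iff minus_le_iff)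
  moreover have "real k * c \<le> real k * (1 + c)" by (simp add: mult_left_mono)
  ultimately show ?thesis by (simp add: abs_le_iff)
qed

lemma measurable_bv:
  assumes "\<And>h' x a y. h \<le> h' \<Longrightarrow> h' < h + k \<Longrightarrow> (\<lambda>\<omega>. w \<omega> (h', x, a) y) \<in> borel_measurable M"
    and "\<And>h' x a. h \<le> h' \<Longrightarrow> h' < h + k \<Longrightarrow> (\<lambda>\<omega>. b \<omega> (h', x, a)) \<in> borel_measurable M"
  shows "(\<lambda>\<omega>. bv (w \<omega>) (b \<omega>) k h x) \<in> borel_measurable M"
  using assms
proof (induction k arbitrary: h x)
  case (Suc k)
  have [measurable]: "(\<lambda>\<omega>. bv (w \<omega>) (b \<omega>) k (Suc h) x) \<in> borel_measurable M" for x
    by (intro Suc.IH Suc.prems) auto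
  have [measurable]: "(\<lambda>\<omega>. w \<omega> (h, x, a) y) \<in> borel_measurable M" "(\<lambda>\<omega>. b \<omega> (h, x, a)) \<in> borel_measurable M" for a y
    by (intro Suc.prems; simp)+
  show ?case unfolding bv.simps backup_def by (intro borel_measurable_Max) measurable
qed simp

subsection \<open>Stochastic optimism\<close>

lemma distr_pair_snd:
  assumes "prob_space M" "sigma_finite_measure N"
  shows "distr (M \<Otimes>\<^sub>M N) N snd = N"
proof (rule measure_eqI)
  interpret M: prob_space M by fact
  interpret N: sigma_finite_measure N by fact
  fix A assume "A \<in> sets (distr (M \<Otimes>\<^sub>M N) N snd)"
  then have A: "A \<in> sets N" by simp
  have "snd -` A \<inter> space (M \<Otimes>\<^sub>M N) = space M \<times> A"
    using sets.sets_into_space[OF A] by (auto simp: space_pair_measure)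
  with A show "emeasure (distr (M \<Otimes>\<^sub>M N) N snd) A = emeasure N A"
    by (simp add: emeasure_distr N.emeasure_pair_measure_Times M.emeasure_space_1)
qed simp

lemma distr_PiM_compose_prob:
  assumes "finite I" "\<And>i. i \<in> I \<Longrightarrow> prob_space (K i)" "\<And>i. i \<in> I \<Longrightarrow> prob_space (M i)"
    and "\<And>i. i \<in> I \<Longrightarrow> f \<in> measurable (K i) (M i)" "\<And>i. i \<in> I \<Longrightarrow> distr (K i) (M i) f = M i"
  shows "distr (PiM I K) (PiM I M) (compose I f) = PiM I M"
  using assms by (subst distr_PiM_finite_prob_space') (auto intro!: PiM_cong)

lemma sets_wtd_noise: "sets (wtd_noise H) = sets (PiM (sa_space H) (\<lambda>_. borel))"
  unfolding wtd_noise_def by (intro sets_PiM_cong) auto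

lemma measurable_noise_component:
  assumes "s \<in> sa_space H"
  shows "(\<lambda>z. z s) \<in> borel_measurable (wtd_noise H)"
  unfolding measurable_cong_sets[OF sets_wtd_noise refl]
  using assms by (rule measurable_component_singleton)

context
  fixes H :: nat and \<alpha> :: "('x::finite, 'a::finite) model"
    and w :: "('x, 'a) sa \<Rightarrow> 'x outcome \<Rightarrow> real" and b0 m :: "('x, 'a) sa \<Rightarrow> real"
  assumes H: "0 < H" and \<alpha>: "admissible H \<alpha>" and w: "substochastic w"
    and mean_le: "\<And>s v. s \<in> sa_space H \<Longrightarrow> (\<And>y. 0 \<le> v y) \<Longrightarrow> (\<And>y. v y \<le> real H) \<Longrightarrow>
      wmean (\<alpha> s) v \<le> (\<Sum>y\<in>UNIV. w s y * v y) + b0 s"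
    and scale_le: "\<And>s. s \<in> sa_space H \<Longrightarrow> sqrt (3 / sum (\<alpha> s) UNIV) * real H \<le> m s"
begin

text \<open>Every coordinate carries both a Dirichlet and a Gaussian draw, so that all hybrids live
  on one product space. Triples in \<open>G\<close> are updated by the algorithm, the others by the
  true model.\<close>

private abbreviation (input) K where "K \<equiv> \<lambda>s. dirichlet (\<alpha> s) \<Otimes>\<^sub>M gauss"
private abbreviation (input) wG where "wG \<equiv> \<lambda>G \<eta> s. if s \<in> G then w s else pmf (outcome_pmf (fst (\<eta> s)))"
private abbreviation (input) bG where "bG \<equiv> \<lambda>G \<eta> s. if s \<in> G then b0 s + m s * snd (\<eta> s) else 0"

lemma prob_space_K: "s \<in> sa_space H \<Longrightarrow> prob_space (K s)"
  using prob_space_dirichlet[OF admissibleD[OF \<alpha>, of s]] gauss.prob_space_axioms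
  by (intro prob_space_pair) auto

lemma substochastic_wG: "substochastic (wG G \<eta>)"
  using w by (auto simp: substochastic_def)

lemma measurable_K_fst: "s \<in> sa_space H \<Longrightarrow> (\<lambda>\<eta>. fst (\<eta> s)) \<in> measurable (PiM (sa_space H) K) (PiM UNIV (\<lambda>_. borel))"
  by (rule measurable_compose[OF measurable_component_singleton[of s]])
     (auto simp: measurable_cong_sets[OF refl sets_dirichlet, symmetric])

lemma measurable_K_snd: "s \<in> sa_space H \<Longrightarrow> (\<lambda>\<eta>. snd (\<eta> s)) \<in> borel_measurable (PiM (sa_space H) K)"
  by (rule measurable_compose[OF measurable_component_singleton[of s]])
     (auto simp: measurable_cong_sets[OF refl sets_density, symmetric])

lemma measurable_outcome: "(\<lambda>p. pmf (outcome_pmf p) y) \<in> borel_measurable (PiM UNIV (\<lambda>_. borel))"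
  unfolding pmf_outcome_pmf by measurable

lemma measurable_hybrid:
  assumes "h + k \<le> H"
  shows "(\<lambda>\<eta>. bv (wG G \<eta>) (bG G \<eta>) k h x) \<in> borel_measurable (PiM (sa_space H) K)"
proof (rule measurable_bv)
  fix h' :: nat and x' :: 'x and a :: 'a and y assume "h' < h + k"
  then have s: "(h', x', a) \<in> sa_space H" using assms by (auto simp: sa_space_def)
  note [measurable] = measurable_compose[OF measurable_K_fst[OF s] measurable_outcome] measurable_K_snd[OF s]
  show "(\<lambda>\<eta>. wG G \<eta> (h', x', a) y) \<in> borel_measurable (PiM (sa_space H) K)" by (cases "(h', x', a) \<in> G") simp_all
  show "(\<lambda>\<eta>. bG G \<eta> (h', x', a)) \<in> borel_measurable (PiM (sa_space H) K)" by (cases "(h', x', a) \<in> G") simp_all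
qed

lemma integrable_hybrid: "integrable (PiM (sa_space H) K) (\<lambda>\<eta>. bv (wG G \<eta>) (bG G \<eta>) H 0 x)"
proof -
  interpret prob_space "PiM (sa_space H) K" by (intro prob_space_PiM prob_space_K)
  have int_snd: "integrable (PiM (sa_space H) K) (\<lambda>\<eta>. snd (\<eta> s))" if s: "s \<in> sa_space H" for s
  proof -
    have "integrable (distr (K s) gauss snd) (\<lambda>z. z)"
      using prob_space_dirichlet[OF admissibleD[OF \<alpha> s]] integrable_gauss_id
      by (subst distr_pair_snd) (auto intro: gauss.sigma_finite_measure_axioms)
    then have "integrable (K s) snd" by (subst (asm) integrable_distr_eq) auto
    then have "integrable (distr (PiM (sa_space H) K) (K s) (\<lambda>\<eta>. \<eta> s)) snd"
      using s by (subst distr_PiM_component) (auto intro: prob_space_K)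
    then show ?thesis using s by (subst (asm) integrable_distr_eq) auto
  qed
  let ?c = "\<lambda>\<eta>. \<Sum>s\<in>sa_space H. \<bar>b0 s\<bar> + \<bar>m s\<bar> * \<bar>snd (\<eta> s)\<bar>"
  show ?thesis
  proof (rule Bochner_Integration.integrable_bound)
    show "integrable (PiM (sa_space H) K) (\<lambda>\<eta>. real H * (1 + ?c \<eta>))"
      using int_snd by (auto intro!: integrable_abs)
    show "(\<lambda>\<eta>. bv (wG G \<eta>) (bG G \<eta>) H 0 x) \<in> borel_measurable (PiM (sa_space H) K)"
      by (rule measurable_hybrid) simp
    have c: "0 \<le> ?c \<eta>" for \<eta> by (intro sum_nonneg) auto
    have "\<bar>bv (wG G \<eta>) (bG G \<eta>) H 0 x\<bar> \<le> real H * (1 + ?c \<eta>)" for \<eta>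
    proof (intro bv_abs_bound substochastic_wG c)
      fix h' :: nat and x' :: 'x and a :: 'a assume "h' < 0 + H"
      then have s: "(h', x', a) \<in> sa_space H" by (auto simp: sa_space_def)
      have "\<bar>bG G \<eta> (h', x', a)\<bar> \<le> \<bar>b0 (h', x', a)\<bar> + \<bar>m (h', x', a)\<bar> * \<bar>snd (\<eta> (h', x', a))\<bar>"
        by (auto simp: abs_mult[symmetric] intro: abs_triangle_ineq)
      also have "\<dots> \<le> ?c \<eta>"
        using s by (intro member_le_sum[where f = "\<lambda>s. \<bar>b0 s\<bar> + \<bar>m s\<bar> * \<bar>snd (\<eta> s)\<bar>"]) auto
      finally show "\<bar>bG G \<eta> (h', x', a)\<bar> \<le> ?c \<eta>" .
    qed
    then show "AE \<eta> in PiM (sa_space H) K. norm (bv (wG G \<eta>) (bG G \<eta>) H 0 x) \<le> norm (real H * (1 + ?c \<eta>))"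
      unfolding real_norm_def by (intro AE_I2) (rule order_trans[OF _ abs_ge_self])
  qed
qed

text \<open>Layers are exchanged from the first to the last: the values that the backup at \<open>s\<close> reads are then
  still true values, so they lie in \<open>[0, H]\<close> and are independent of the coordinate \<open>s\<close>.\<close>
lemma hybrid_step:
  assumes s: "s \<in> sa_space H" "s \<notin> G" and later: "\<And>s'. s' \<in> G \<Longrightarrow> fst s' \<le> fst s"
  shows "(\<integral>\<eta>. bv (wG G \<eta>) (bG G \<eta>) H 0 x \<partial>PiM (sa_space H) K) \<le>
    (\<integral>\<eta>. bv (wG (insert s G) \<eta>) (bG (insert s G) \<eta>) H 0 x \<partial>PiM (sa_space H) K)"
proof -
  define U where "U = (\<lambda>G \<eta>. bv (wG G \<eta>) (bG G \<eta>) H 0 x)"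
  define J where "J = sa_space H - {s}"
  have J: "sa_space H = insert s J" "finite J" "s \<notin> J" using s by (auto simp: J_def)
  have U: "integrable (PiM (sa_space H) K) (U G)" for G
    unfolding U_def by (rule integrable_hybrid)
  have pD: "prob_space (dirichlet (\<alpha> s))" by (rule prob_space_dirichlet[OF admissibleD[OF \<alpha> s(1)]])
  have lt: "fst s < H" using s by (auto simp: sa_space_def)
  have rep: "bv w b H 0 x = bv (w(s := (\<lambda>_. 0))) (b(s := backup w b (bv w b (H - Suc (fst s)) (Suc (fst s))) s)) H 0 x" for w b
    using bv_replace[of 0 s H w b x] lt by (simp del: fun_upd_apply)
  \<comment> \<open>All coordinates except the one at \<open>s\<close> are frozen. Both hybrids
    become the same convex nondecreasing function \<open>\<phi>\<close> of their respective backup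
    at \<open>s\<close>.\<close>
  have inner: "0 \<le> (\<integral>c. U (insert s G) (\<eta>(s := c)) - U G (\<eta>(s := c)) \<partial>(K s))" for \<eta>
  proof -
    define V where "V = bv (wG G \<eta>) (bG G \<eta>) (H - Suc (fst s)) (Suc (fst s))"
    define v where "v = (\<lambda>y. of_bool (fst y) + V (snd y) :: real)"
    define \<phi> where "\<phi> = (\<lambda>u. bv ((wG G \<eta>)(s := (\<lambda>_. 0))) ((bG G \<eta>)(s := u)) H 0 x)"
    have sub: "substochastic ((wG G \<eta>)(s := (\<lambda>_. 0)))"
      using substochastic_wG[of G \<eta>] by (auto simp: substochastic_def)
    have \<phi>: "1-lipschitz_on UNIV \<phi>" "convex_on UNIV \<phi>"
      unfolding \<phi>_def by (rule lipschitz_bv_upd[OF sub], rule convex_bv_upd[OF sub])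
    have mono: "\<phi> u \<le> \<phi> u'" if "u \<le> u'" for u u'
      unfolding \<phi>_def using that by (intro bv_mono[OF sub]) auto
    have Vb: "0 \<le> V x \<and> V x \<le> real (H - Suc (fst s))" for x
      unfolding V_def using later by (intro bv_true_bounds[where P = "\<lambda>s. fst (\<eta> s)"]) force+
    have v: "0 \<le> v y" "v y \<le> real H" for y
      using Vb[of "snd y"] lt by (auto simp: v_def of_bool_def)
    have U_eq: "U G' (\<eta>(s := c)) = \<phi> (backup (wG G' (\<eta>(s := c))) (bG G' (\<eta>(s := c))) V s)"
      if "\<And>s'. s' \<noteq> s \<Longrightarrow> s' \<in> G' \<longleftrightarrow> s' \<in> G" for G' c
    proof -
      have V': "bv (wG G' (\<eta>(s := c))) (bG G' (\<eta>(s := c))) (H - Suc (fst s)) (Suc (fst s)) = V"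
        unfolding V_def using that by (intro ext bv_cong) auto
      have "U G' (\<eta>(s := c)) = bv ((wG G' (\<eta>(s := c)))(s := (\<lambda>_. 0)))
          ((bG G' (\<eta>(s := c)))(s := backup (wG G' (\<eta>(s := c))) (bG G' (\<eta>(s := c))) V s)) H 0 x"
        unfolding U_def V'[symmetric] by (rule rep)
      also have "(wG G' (\<eta>(s := c)))(s := (\<lambda>_. 0)) = (wG G \<eta>)(s := (\<lambda>_. 0))"
        using that by (auto simp: fun_eq_iff)
      also have "(bG G' (\<eta>(s := c)))(s := u) = (bG G \<eta>)(s := u)" for u
        using that by (auto simp: fun_eq_iff)
      finally show ?thesis unfolding \<phi>_def .
    qed
    have UG: "U G (\<eta>(s := c)) = \<phi> (\<Sum>y\<in>UNIV. pmf (outcome_pmf (fst c)) y * v y)" for c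
      using s U_eq[of G c] by (simp add: backup_def v_def)
    have UsG: "U (insert s G) (\<eta>(s := c)) = \<phi> (((\<Sum>y\<in>UNIV. w s y * v y) + b0 s) + m s * snd c)" for c
      using U_eq[of "insert s G" c] by (simp add: backup_def v_def add.assoc)
    note [measurable] = lipschitz_on_measurable[OF \<phi>(1)] measurable_outcome
    let ?f = "\<lambda>p. \<phi> (\<Sum>y\<in>UNIV. pmf (outcome_pmf p) y * v y)"
    let ?g = "\<lambda>p. \<phi> (\<Sum>y\<in>UNIV. p y * v y)"
    have ae: "AE p in dirichlet (\<alpha> s). ?f p = ?g p"
      using AE_dirichlet_simplex[OF admissibleD[OF \<alpha> s(1)]] by eventually_elim (simp add: pmf_outcome_pmf)
    have f_meas: "?f \<in> borel_measurable (dirichlet (\<alpha> s))" "?g \<in> borel_measurable (dirichlet (\<alpha> s))" by measurable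
    have g_int: "integrable (dirichlet (\<alpha> s)) ?g"
      using integrable_dirichlet_dot[where v = v and B = "real H", OF v _ admissibleD[OF \<alpha> s(1)] \<phi>(1)] H by simp
    have f_int: "integrable (dirichlet (\<alpha> s)) ?f"
      using g_int integrable_cong_AE[OF f_meas ae] by simp
    have fst_K: "distr (K s) (dirichlet (\<alpha> s)) fst = dirichlet (\<alpha> s)" by (rule gauss.distr_pair_fst)
    have snd_K: "distr (K s) gauss snd = gauss"
      by (rule distr_pair_snd) (auto intro: pD gauss.sigma_finite_measure_axioms)
    have UG_int: "integrable (K s) (\<lambda>c. U G (\<eta>(s := c)))"
      unfolding UG using f_int f_meas by (subst (asm) fst_K[symmetric], subst (asm) integrable_distr_eq) auto
    have UG_eq: "(\<integral>c. U G (\<eta>(s := c)) \<partial>(K s)) = (\<integral>p. ?g p \<partial>dirichlet (\<alpha> s))"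
    proof -
      have "(\<integral>c. U G (\<eta>(s := c)) \<partial>(K s)) = (\<integral>p. ?f p \<partial>distr (K s) (dirichlet (\<alpha> s)) fst)"
        unfolding UG using f_meas by (subst integral_distr) auto
      also have "\<dots> = (\<integral>p. ?g p \<partial>dirichlet (\<alpha> s))"
        unfolding fst_K using f_meas ae by (intro integral_cong_AE)
      finally show ?thesis .
    qed
    let ?u = "(\<Sum>y\<in>UNIV. w s y * v y) + b0 s"
    have UsG_int: "integrable (K s) (\<lambda>c. U (insert s G) (\<eta>(s := c)))"
      unfolding UsG using integrable_smooth[OF \<phi>(1), of ?u "m s"]
      by (subst (asm) snd_K[symmetric], subst (asm) integrable_distr_eq) auto
    have UsG_eq: "(\<integral>c. U (insert s G) (\<eta>(s := c)) \<partial>(K s)) = smooth (m s) \<phi> ?u"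
      unfolding UsG smooth_def by (subst (2) snd_K[symmetric], subst integral_distr) auto
    \<comment> \<open>Three moves: the Dirichlet law is exchanged for a Gaussian with the same mean,
      the scale is widened by convexity, and the mean is raised by monotonicity.\<close>
    have "(\<integral>p. ?g p \<partial>dirichlet (\<alpha> s)) \<le> smooth (sqrt (3 / sum (\<alpha> s) UNIV) * real H) \<phi> (wmean (\<alpha> s) v)"
      using H by (intro dirichlet_le_smooth[OF v _ admissibleD[OF \<alpha> s(1)] \<phi>]) auto
    also have "\<dots> \<le> smooth (m s) \<phi> (wmean (\<alpha> s) v)"
      using scale_le[OF s(1)] admissibleD[OF \<alpha> s(1)] by (intro smooth_mono_scale[OF \<phi>]) auto
    also have "\<dots> \<le> smooth (m s) \<phi> ?u"
      unfolding smooth_def using mean_le[OF s(1), of v] v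
      by (intro integral_mono integrable_smooth[OF \<phi>(1)] mono) auto
    finally show ?thesis
      using UG_int UsG_int by (simp add: UG_eq UsG_eq)
  qed
  have "0 \<le> (\<integral>\<eta>. (\<integral>c. U (insert s G) (\<eta>(s := c)) - U G (\<eta>(s := c)) \<partial>(K s)) \<partial>PiM J K)"
    using inner by (intro integral_nonneg_AE) auto
  also have "\<dots> = (\<integral>\<eta>. U (insert s G) \<eta> - U G \<eta> \<partial>PiM (sa_space H) K)"
    unfolding J(1) using J(2,3) U[unfolded J(1)] prob_space_K[unfolded J(1)]
    by (intro integral_PiM_insert[symmetric] Bochner_Integration.integrable_diff) auto
  also have "\<dots> = (\<integral>\<eta>. U (insert s G) \<eta> \<partial>PiM (sa_space H) K) - (\<integral>\<eta>. U G \<eta> \<partial>PiM (sa_space H) K)"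
    by (intro Bochner_Integration.integral_diff U)
  finally show ?thesis by (simp add: U_def)
qed

text \<open>Triples of one layer do not read each other, so they are exchanged one after the other
  in any order.\<close>

lemma hybrid_layer:
  fixes x :: 'x
  assumes "finite T" "T \<subseteq> {s \<in> sa_space H. fst s = n}"
  defines "I \<equiv> \<lambda>G. \<integral>\<eta>. bv (wG G \<eta>) (bG G \<eta>) H 0 x \<partial>PiM (sa_space H) K"
  shows "I {s \<in> sa_space H. fst s < n} \<le> I ({s \<in> sa_space H. fst s < n} \<union> T)"
  using assms(1,2)
proof (induction T rule: finite_induct)
  case (insert s T)
  let ?G = "{s \<in> sa_space H. fst s < n} \<union> T"
  have "I ?G \<le> I (insert s ?G)"
    unfolding I_def using insert.hyps insert.prems by (intro hybrid_step) auto
  moreover have "I {s \<in> sa_space H. fst s < n} \<le> I ?G"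
    using insert.prems by (intro insert.IH) auto
  ultimately show ?case by simp
qed simp

text \<open>The two extreme hybrids are the true Bellman recursion and the recursion of the
  algorithm. Each ignores one half of every coordinate, and projecting that half away recovers
  \<open>dirichlet_prior\<close> and \<open>wtd_noise\<close>.\<close>

lemma optimism:
  "(\<integral>P. model_bv P H 0 x \<partial>dirichlet_prior H \<alpha>) \<le>
    (\<integral>z. bv w (\<lambda>s. b0 s + m s * z s) H 0 x \<partial>wtd_noise H)"
proof -
  define I where "I = (\<lambda>G. \<integral>\<eta>. bv (wG G \<eta>) (bG G \<eta>) H 0 x \<partial>PiM (sa_space H) K)"
  have layers: "I {} \<le> I {s \<in> sa_space H. fst s < n}" for n
  proof (induction n)
    case (Suc n)
    have eq: "{s \<in> sa_space H. fst s < n} \<union> {s \<in> sa_space H. fst s = n} = {s \<in> sa_space H. fst s < Suc n}"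
      by auto
    have "I {s \<in> sa_space H. fst s < n} \<le> I {s \<in> sa_space H. fst s < Suc n}"
      unfolding I_def eq[symmetric] by (intro hybrid_layer) auto
    with Suc.IH show ?case by simp
  qed (simp add: I_def)
  have all: "{s \<in> sa_space H. fst s < H} = sa_space H" by (auto simp: sa_space_def)
  have in_space: "(h, x, a) \<in> sa_space H" if "h < H" for h and x :: 'x and a :: 'a
    using that by (auto simp: sa_space_def)
  have fst_K: "distr (K s) (dirichlet (\<alpha> s)) fst = dirichlet (\<alpha> s)" for s by (rule gauss.distr_pair_fst)
  have pD: "prob_space (dirichlet (\<alpha> s))" if "s \<in> sa_space H" for s
    by (rule prob_space_dirichlet[OF admissibleD[OF \<alpha> that]])
  have snd_K: "distr (K s) gauss snd = gauss" if "s \<in> sa_space H" for s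
    by (rule distr_pair_snd) (auto intro: pD[OF that] gauss.sigma_finite_measure_axioms)
  have "I {} = (\<integral>P. model_bv P H 0 x \<partial>dirichlet_prior H \<alpha>)"
  proof -
    have D: "distr (PiM (sa_space H) K) (PiM (sa_space H) (\<lambda>s. dirichlet (\<alpha> s))) (compose (sa_space H) fst)
        = PiM (sa_space H) (\<lambda>s. dirichlet (\<alpha> s))"
      by (intro distr_PiM_compose_prob fst_K prob_space_K pD) auto
    have meas: "(\<lambda>P. model_bv P H 0 x) \<in> borel_measurable (dirichlet_prior H \<alpha>)"
      unfolding measurable_cong_sets[OF sets_dirichlet_prior refl]
      by (intro measurable_bv measurable_pmf_outcome_pmf in_space) auto
    have cmp: "compose (sa_space H) fst \<in> measurable (PiM (sa_space H) K) (PiM (sa_space H) (\<lambda>s. dirichlet (\<alpha> s)))"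
      unfolding compose_def
      by (intro measurable_restrict) (rule measurable_compose[OF measurable_component_singleton], auto)
    have "(\<integral>P. model_bv P H 0 x \<partial>dirichlet_prior H \<alpha>)
      = (\<integral>\<eta>. bv (\<lambda>s. pmf (outcome_pmf (compose (sa_space H) fst \<eta> s))) (\<lambda>_. 0) H 0 x \<partial>PiM (sa_space H) K)"
      using meas unfolding dirichlet_prior_def
      by (subst D[symmetric], subst integral_distr[OF cmp]) auto
    also have "\<dots> = I {}"
      unfolding I_def by (intro Bochner_Integration.integral_cong refl bv_cong) (auto simp: compose_def in_space)
    finally show ?thesis ..
  qed
  moreover have "I (sa_space H) = (\<integral>z. bv w (\<lambda>s. b0 s + m s * z s) H 0 x \<partial>wtd_noise H)"
  proof -
    have D: "distr (PiM (sa_space H) K) (PiM (sa_space H) (\<lambda>_. gauss)) (compose (sa_space H) snd) = PiM (sa_space H) (\<lambda>_. gauss)"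
      by (intro distr_PiM_compose_prob snd_K prob_space_K gauss.prob_space_axioms) auto
    have meas: "(\<lambda>z. bv w (\<lambda>s. b0 s + m s * z s) H 0 x) \<in> borel_measurable (wtd_noise H)"
    proof (rule measurable_bv)
      fix h' :: nat and x' :: 'x and a :: 'a assume "h' < 0 + H"
      then have "(\<lambda>z. z (h', x', a)) \<in> borel_measurable (wtd_noise H)"
        by (intro measurable_noise_component) (simp add: in_space)
      then show "(\<lambda>z. b0 (h', x', a) + m (h', x', a) * z (h', x', a)) \<in> borel_measurable (wtd_noise H)"
        by measurable
    qed simp
    have cmp: "compose (sa_space H) snd \<in> measurable (PiM (sa_space H) K) (PiM (sa_space H) (\<lambda>_. gauss))"
      unfolding compose_def
      by (intro measurable_restrict) (rule measurable_compose[OF measurable_component_singleton], auto)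
    have "(\<integral>z. bv w (\<lambda>s. b0 s + m s * z s) H 0 x \<partial>wtd_noise H)
      = (\<integral>\<eta>. bv w (\<lambda>s. b0 s + m s * compose (sa_space H) snd \<eta> s) H 0 x \<partial>PiM (sa_space H) K)"
      using meas unfolding wtd_noise_def
      by (subst D[symmetric], subst integral_distr[OF cmp]) auto
    also have "\<dots> = I (sa_space H)"
      unfolding I_def by (intro Bochner_Integration.integral_cong refl bv_cong) (auto simp: compose_def in_space)
    finally show ?thesis ..
  qed
  ultimately show ?thesis using layers[of H] unfolding all by simp
qed

end

subsection \<open>Runs and the predictive process\<close>

lemma expectation_bind_pmf:
  fixes f :: "_ \<Rightarrow> real"
  assumes "finite (set_pmf p)" "\<And>x. x \<in> set_pmf p \<Longrightarrow> finite (set_pmf (q x))"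
  shows "expect (bind_pmf p q) f = expect p (\<lambda>x. expect (q x) f)"
  using assms
  by (subst pmf_expectation_bind[of "set_pmf p"]) (auto simp: integral_measure_pmf[of "set_pmf p"])

lemma integral_expectation_pmf_swap:
  fixes F :: "'b \<Rightarrow> 'c \<Rightarrow> real"
  assumes "finite (set_pmf p)" "\<And>y. y \<in> set_pmf p \<Longrightarrow> integrable M (F y)"
  shows "(\<integral>x. expect p (\<lambda>y. F y x) \<partial>M) = expect p (\<lambda>y. \<integral>x. F y x \<partial>M)"
  using assms by (simp add: integral_measure_pmf[of "set_pmf p"])

lemma measurable_expectation_pmf:
  fixes F :: "'b \<Rightarrow> 'c \<Rightarrow> real"
  assumes "finite (set_pmf p)" "\<And>y. F y \<in> borel_measurable M"
  shows "(\<lambda>x. expect p (\<lambda>y. F y x)) \<in> borel_measurable M"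
proof -
  have "(\<lambda>x. expect p (\<lambda>y. F y x)) = (\<lambda>x. \<Sum>y\<in>set_pmf p. pmf p y * F y x)"
    using assms(1) by (simp add: integral_measure_pmf[of "set_pmf p"])
  then show ?thesis using assms(2) by simp
qed

lemma expectation_mono_pmf:
  fixes f g :: "_ \<Rightarrow> real"
  assumes "finite (set_pmf p)" "\<And>x. x \<in> set_pmf p \<Longrightarrow> f x \<le> g x"
  shows "expect p f \<le> expect p g"
  using assms by (intro integral_mono_AE integrable_measure_pmf_finite) (auto simp: AE_measure_pmf_iff)

lemma expectation_add_pmf:
  fixes f g :: "_ \<Rightarrow> real"
  assumes "finite (set_pmf p)"
  shows "expect p (\<lambda>x. f x + g x) = expect p f + expect p g"
  using assms by (intro Bochner_Integration.integral_add integrable_measure_pmf_finite)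

lemma expectation_cong_pmf:
  fixes f g :: "_ \<Rightarrow> real"
  assumes "\<And>x. x \<in> set_pmf p \<Longrightarrow> f x = g x"
  shows "expect p f = expect p g"
  using assms by (intro integral_cong_AE) (auto simp: AE_measure_pmf_iff)

definition hist :: "('x, 'a) episode list \<Rightarrow> ('x, 'a) transition list" where
  "hist es = concat (map (\<lambda>(g, x0, \<tau>). \<tau>) es)"

lemma hist_Nil [simp]: "hist [] = []"
  by (simp add: hist_def)

lemma hist_snoc [simp]: "hist (es @ [(g, x0, \<tau>)]) = hist es @ \<tau>"
  by (simp add: hist_def)

text \<open>The noise acts only through the greedy policy, so the law \<open>q\<close> of the policy
  stands for it. This law depends on the data but not on the model.\<close>

definition episode_pmf ::
    "nat \<Rightarrow> 'x pmf \<Rightarrow> (nat \<Rightarrow> 'x \<Rightarrow> 'a) pmf \<Rightarrow> ('x::finite, 'a) model \<Rightarrow> ('x, 'a) episode pmf" where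
  "episode_pmf H \<rho> q P = bind_pmf q (\<lambda>g. bind_pmf \<rho> (\<lambda>x0. map_pmf (\<lambda>\<tau>. (g, x0, \<tau>)) (rollout P (determ g) H 0 x0)))"

text \<open>\<open>Q D\<close> is the law of the policy and \<open>M D\<close> the model of the next episode given the data \<open>D\<close>: the
  constant \<open>M\<close> gives the law of a run given the model, \<open>M D = mean_model (posterior D \<alpha>)\<close> the law of
  the run with the model integrated out.\<close>
primrec run_pmf ::
    "nat \<Rightarrow> 'x pmf \<Rightarrow> (('x, 'a) transition list \<Rightarrow> (nat \<Rightarrow> 'x \<Rightarrow> 'a) pmf) \<Rightarrow>
      (('x, 'a) transition list \<Rightarrow> ('x::finite, 'a) model) \<Rightarrow> nat \<Rightarrow> ('x, 'a) episode list pmf" where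
  "run_pmf H \<rho> Q M 0 = return_pmf []"
| "run_pmf H \<rho> Q M (Suc l) = bind_pmf (run_pmf H \<rho> Q M l)
     (\<lambda>es. map_pmf (\<lambda>e. es @ [e]) (episode_pmf H \<rho> (Q (hist es)) (M (hist es))))"

context
  fixes H :: nat and \<rho> :: "'x::finite pmf"
    and Q :: "('x, 'a::finite) transition list \<Rightarrow> (nat \<Rightarrow> 'x \<Rightarrow> 'a) pmf"
  assumes Q: "\<And>D. finite (set_pmf (Q D))"
begin

lemma finite_episode_pmf: "finite (set_pmf (episode_pmf H \<rho> (Q D) P))"
  using Q by (auto simp: episode_pmf_def)

lemma finite_run_pmf: "finite (set_pmf (run_pmf H \<rho> Q M l))"
  by (induction l) (auto intro: finite_episode_pmf)

lemma length_run_pmf: "es \<in> set_pmf (run_pmf H \<rho> Q M l) \<Longrightarrow> length es = l"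
  by (induction l arbitrary: es) auto

lemma expectation_episode_pmf:
  fixes f :: "_ \<Rightarrow> real"
  shows "expect (episode_pmf H \<rho> (Q D) P) f =
    expect (Q D) (\<lambda>g. expect \<rho> (\<lambda>x0.
      expect (rollout P (determ g) H 0 x0) (\<lambda>\<tau>. f (g, x0, \<tau>))))"
  unfolding episode_pmf_def using Q
  by (subst expectation_bind_pmf, simp, simp, subst expectation_bind_pmf) auto

lemma expectation_run_pmf_Suc:
  fixes f :: "_ \<Rightarrow> real"
  shows "expect (run_pmf H \<rho> Q M (Suc l)) f =
    expect (run_pmf H \<rho> Q M l) (\<lambda>es.
      expect (episode_pmf H \<rho> (Q (hist es)) (M (hist es))) (\<lambda>e. f (es @ [e])))"
  unfolding run_pmf.simps
  by (subst expectation_bind_pmf) (auto intro: finite_run_pmf finite_episode_pmf)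

lemma measurable_expectation_episode:
  fixes F :: "_ \<Rightarrow> ('x, 'a) model \<Rightarrow> real"
  assumes "\<And>e. F e \<in> borel_measurable (model_space H)"
  shows "(\<lambda>P. expect (episode_pmf H \<rho> (Q D) P) (\<lambda>e. F e P)) \<in> borel_measurable (model_space H)"
  unfolding expectation_episode_pmf
  by (intro measurable_expectation_pmf measurable_expectation_rollout assms Q) auto

lemma measurable_expectation_run:
  fixes F :: "_ \<Rightarrow> ('x, 'a) model \<Rightarrow> real"
  assumes "\<And>es. F es \<in> borel_measurable (model_space H)"
  shows "(\<lambda>P. expect (run_pmf H \<rho> Q (\<lambda>_. P) l) (\<lambda>es. F es P)) \<in> borel_measurable (model_space H)"
  using assms
proof (induction l arbitrary: F)
  case (Suc l)
  show ?case
    unfolding expectation_run_pmf_Suc by (intro Suc.IH measurable_expectation_episode Suc.prems)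
qed simp

text \<open>The policy and the initial element are drawn without looking at \<open>P\<close>, so the
  integral over the model moves inside their expectations and meets a single rollout.\<close>

lemma integral_prior_episode:
  fixes F :: "_ \<Rightarrow> ('x, 'a) model \<Rightarrow> real"
  assumes \<alpha>: "admissible H \<alpha>" and F: "\<And>e. F e \<in> borel_measurable (model_space H)"
    and bd: "\<And>g x0 \<tau> P. length \<tau> = H \<Longrightarrow> \<bar>F (g, x0, \<tau>) P\<bar> \<le> C"
  shows "(\<integral>P. expect (episode_pmf H \<rho> (Q D) P) (\<lambda>e. F e P) \<partial>dirichlet_prior H \<alpha>) =
    expect (episode_pmf H \<rho> (Q D) (mean_model \<alpha>))
      (\<lambda>(g, x0, \<tau>). \<integral>P. F (g, x0, \<tau>) P \<partial>dirichlet_prior H (posterior \<tau> \<alpha>))"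
proof -
  let ?R = "\<lambda>P g x0. expect (rollout P (determ g) H 0 x0) (\<lambda>\<tau>. F (g, x0, \<tau>) P)"
  have R_bd: "\<bar>?R P g x0\<bar> \<le> C" for P g x0
    using bd by (intro abs_expectation_pmf_le) (auto dest!: length_rollout)
  have R_meas: "(\<lambda>P. ?R P g x0) \<in> borel_measurable (model_space H)" for g x0
    by (intro measurable_expectation_rollout F) simp
  have E_bd: "\<bar>expect \<rho> (\<lambda>x0. ?R P g x0)\<bar> \<le> C" for P g
    by (intro abs_expectation_pmf_le R_bd) auto
  have "(\<integral>P. expect (episode_pmf H \<rho> (Q D) P) (\<lambda>e. F e P) \<partial>dirichlet_prior H \<alpha>)
    = expect (Q D) (\<lambda>g. \<integral>P. expect \<rho> (\<lambda>x0. ?R P g x0) \<partial>dirichlet_prior H \<alpha>)"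
    unfolding expectation_episode_pmf using Q
    by (intro integral_expectation_pmf_swap integrable_bounded_prior[OF \<alpha> _ E_bd] measurable_expectation_pmf R_meas) auto
  also have "\<dots> = expect (Q D) (\<lambda>g. expect \<rho> (\<lambda>x0. \<integral>P. ?R P g x0 \<partial>dirichlet_prior H \<alpha>))"
    by (intro Bochner_Integration.integral_cong refl integral_expectation_pmf_swap integrable_bounded_prior[OF \<alpha> _ R_bd] R_meas) auto
  also have "\<dots> = expect (Q D) (\<lambda>g. expect \<rho> (\<lambda>x0.
      expect (rollout (mean_model \<alpha>) (determ g) H 0 x0) (\<lambda>\<tau>. \<integral>P. F (g, x0, \<tau>) P \<partial>dirichlet_prior H (posterior \<tau> \<alpha>))))"
    by (intro Bochner_Integration.integral_cong refl integral_prior_rollout[OF \<alpha>, where C = C] F bd) auto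
  finally show ?thesis unfolding expectation_episode_pmf by simp
qed

text \<open>Conditioning on the data: drawing the model and then a run is the same as drawing a run
  of the predictive process and then the model from the posterior given its history.\<close>

lemma integral_prior_run:
  fixes F :: "_ \<Rightarrow> ('x, 'a) model \<Rightarrow> real"
  assumes \<alpha>: "admissible H \<alpha>" and F: "\<And>es. F es \<in> borel_measurable (model_space H)"
    and bd: "\<And>es P. length es = l \<Longrightarrow> \<bar>F es P\<bar> \<le> C"
  shows "(\<integral>P. expect (run_pmf H \<rho> Q (\<lambda>_. P) l) (\<lambda>es. F es P) \<partial>dirichlet_prior H \<alpha>) =
    expect (run_pmf H \<rho> Q (\<lambda>D. mean_model (posterior D \<alpha>)) l)
      (\<lambda>es. \<integral>P. F es P \<partial>dirichlet_prior H (posterior (hist es) \<alpha>))"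
  using F bd
proof (induction l arbitrary: F)
  case (Suc l)
  let ?F = "\<lambda>es P. expect (episode_pmf H \<rho> (Q (hist es)) P) (\<lambda>e. F (es @ [e]) P)"
  have "(\<integral>P. expect (run_pmf H \<rho> Q (\<lambda>_. P) (Suc l)) (\<lambda>es. F es P) \<partial>dirichlet_prior H \<alpha>)
    = expect (run_pmf H \<rho> Q (\<lambda>D. mean_model (posterior D \<alpha>)) l)
      (\<lambda>es. \<integral>P. ?F es P \<partial>dirichlet_prior H (posterior (hist es) \<alpha>))"
    unfolding expectation_run_pmf_Suc
    by (intro Suc.IH measurable_expectation_episode abs_expectation_pmf_le finite_episode_pmf Suc.prems) auto
  also have "\<dots> = expect (run_pmf H \<rho> Q (\<lambda>D. mean_model (posterior D \<alpha>)) l)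
      (\<lambda>es. expect (episode_pmf H \<rho> (Q (hist es)) (mean_model (posterior (hist es) \<alpha>)))
        (\<lambda>(g, x0, \<tau>). \<integral>P. F (es @ [(g, x0, \<tau>)]) P \<partial>dirichlet_prior H (posterior \<tau> (posterior (hist es) \<alpha>))))"
    by (intro expectation_cong_pmf integral_prior_episode[where C = C] admissible_posterior \<alpha> Suc.prems)
       (simp add: length_run_pmf)
  also have "\<dots> = expect (run_pmf H \<rho> Q (\<lambda>D. mean_model (posterior D \<alpha>)) (Suc l))
      (\<lambda>es. \<integral>P. F es P \<partial>dirichlet_prior H (posterior (hist es) \<alpha>))"
    unfolding expectation_run_pmf_Suc
    by (intro Bochner_Integration.integral_cong refl) (auto simp: posterior_posterior case_prod_unfold)
  finally show ?case .
qed simp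

end

section \<open>Values, their prior means and the Bellman upper bound\<close>

lemma abs_total_reward_le: "\<bar>total_reward \<tau>\<bar> \<le> real (length \<tau>)"
proof (induction \<tau>)
  case (Cons t \<tau>)
  then show ?case by (cases t) (auto simp: total_reward_def)
qed (simp add: total_reward_def)

lemma total_reward_Cons [simp]: "total_reward ((s, y) # \<tau>) = of_bool (fst y) + total_reward \<tau>"
  by (cases y) (simp add: total_reward_def)

lemma total_reward_Nil [simp]: "total_reward [] = 0"
  by (simp add: total_reward_def)

lemma measurable_val:
  fixes g :: "nat \<Rightarrow> 'x::finite \<Rightarrow> 'a::finite"
  shows "(\<lambda>P. val H P (determ g) 0 x) \<in> borel_measurable (model_space H)"
  unfolding val_def by (intro measurable_expectation_rollout) auto

lemma abs_val_le:
  fixes P :: "('x::finite, 'a::finite) model"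
  shows "\<bar>val H P \<pi> 0 x\<bar> \<le> real H"
  unfolding val_def
  by (intro abs_expectation_pmf_le) (auto dest!: length_rollout intro: order_trans[OF abs_total_reward_le])

text \<open>The total reward of a trajectory does not involve the model, so integrating the model
  out of the rollout leaves a value under the mean model.\<close>

lemma integral_prior_val:
  fixes \<alpha> :: "('x::finite, 'a::finite) model"
  assumes "admissible H \<alpha>"
  shows "(\<integral>P. val H P (determ g) 0 x \<partial>dirichlet_prior H \<alpha>) = val H (mean_model \<alpha>) (determ g) 0 x"
proof -
  have "(\<integral>P. val H P (determ g) 0 x \<partial>dirichlet_prior H \<alpha>) =
    expect (rollout (mean_model \<alpha>) (determ g) H 0 x) (\<lambda>\<tau>. \<integral>P. total_reward \<tau> \<partial>dirichlet_prior H (posterior \<tau> \<alpha>))"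
    unfolding val_def
    by (subst integral_prior_rollout[OF assms, where C = "real H"]) (auto intro: order_trans[OF abs_total_reward_le])
  also have "\<dots> = val H (mean_model \<alpha>) (determ g) 0 x"
    unfolding val_def
    by (intro Bochner_Integration.integral_cong)
       (auto simp: prob_space.prob_space[OF prob_space_dirichlet_prior[OF admissible_posterior[OF assms]]])
  finally show ?thesis .
qed

lemma rollout_value_le_bv:
  fixes P :: "('x::finite, 'a::finite) model"
  shows "expect (rollout P \<pi> k h x) total_reward \<le> model_bv P k h x"
proof (induction k arbitrary: h x)
  case (Suc k)
  let ?w = "\<lambda>s. pmf (outcome_pmf (P s))"
  have "expect (rollout P \<pi> (Suc k) h x) total_reward \<le> (\<Sum>a\<in>UNIV. pmf (\<pi> h x) a * bv ?w (\<lambda>_. 0) (Suc k) h x)"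
    unfolding expectation_rollout_Suc
  proof (intro sum_mono mult_left_mono)
    fix a
    have "(\<Sum>y\<in>UNIV. ?w (h, x, a) y * expect (rollout P \<pi> k (Suc h) (snd y)) (\<lambda>\<tau>. total_reward (((h, x, a), y) # \<tau>)))
       = (\<Sum>y\<in>UNIV. ?w (h, x, a) y * (of_bool (fst y) + expect (rollout P \<pi> k (Suc h) (snd y)) total_reward))"
      by (intro sum.cong refl arg_cong2[where f = "(*)"])
         (simp add: expectation_add_pmf)
    also have "\<dots> \<le> backup ?w (\<lambda>_. 0) (bv ?w (\<lambda>_. 0) k (Suc h)) (h, x, a)"
      unfolding backup_def using Suc.IH by (auto intro!: sum_mono mult_left_mono)
    also have "\<dots> \<le> bv ?w (\<lambda>_. 0) (Suc k) h x"
      by (auto intro: Max_ge)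
    finally show "(\<Sum>y\<in>UNIV. ?w (h, x, a) y * expect (rollout P \<pi> k (Suc h) (snd y)) (\<lambda>\<tau>. total_reward (((h, x, a), y) # \<tau>)))
        \<le> bv ?w (\<lambda>_. 0) (Suc k) h x" .
  qed simp
  also have "\<dots> = bv ?w (\<lambda>_. 0) (Suc k) h x"
    by (simp only: sum_distrib_right[symmetric] sum_pmf_UNIV mult_1)
  finally show ?case .
qed simp

text \<open>One direction of the Bellman optimality equation suffices, since the regret is bounded
  from above.\<close>

lemma opt_val_le_bv:
  fixes P :: "('x::finite, 'a::finite) model"
  shows "opt_val H P 0 x \<le> model_bv P H 0 x"
  unfolding opt_val_def val_def by (intro cSUP_least) (auto intro: rollout_value_le_bv)

subsection \<open>The value iterates and the greedy policy\<close>

lemma sum_mset_eq_sum_count: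
  fixes f :: "'o::finite \<Rightarrow> real"
  shows "(\<Sum>y\<in>#M. f y) = (\<Sum>y\<in>UNIV. real (count M y) * f y)"
proof (induction M)
  case (add x M)
  have "(\<Sum>y\<in>UNIV. real (count (add_mset x M) y) * f y) = (\<Sum>y\<in>UNIV. real (count M y) * f y + (if y = x then f y else 0))"
    by (intro sum.cong) (auto simp: algebra_simps)
  with add show ?case by (simp add: sum.distrib)
qed simp

definition data_weight :: "real \<Rightarrow> ('x, 'a) transition list \<Rightarrow> ('x, 'a) sa \<Rightarrow> 'x outcome \<Rightarrow> real" where
  "data_weight \<beta> D s y = real (count (buffer D s) y) / (real (size (buffer D s)) + \<beta>)"

definition prior_shift :: "real \<Rightarrow> real \<Rightarrow> ('x, 'a) transition list \<Rightarrow> ('x, 'a) sa \<Rightarrow> real" where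
  "prior_shift \<beta> \<theta> D s = \<beta> * \<theta> / (real (size (buffer D s)) + \<beta>)"

lemma substochastic_data_weight:
  fixes D :: "('x::finite, 'a) transition list"
  assumes "0 < \<beta>"
  shows "substochastic (data_weight \<beta> D)"
  unfolding substochastic_def
proof (intro allI conjI)
  fix s :: "('x, 'a) sa"
  show "0 \<le> data_weight \<beta> D s y" for y using assms by (simp add: data_weight_def)
  show "(\<Sum>y\<in>UNIV. data_weight \<beta> D s y) \<le> 1"
    using assms by (simp add: data_weight_def sum_divide_distrib[symmetric] sum_count_buffer)
qed

context
  fixes H :: nat and \<theta> \<sigma> \<sigma>0 :: real and D :: "('x::finite, 'a::finite) transition list"
begin

private abbreviation (input) Q_values :: "(('x, 'a) sa \<Rightarrow> real) \<Rightarrow> nat \<Rightarrow> 'x \<Rightarrow> 'a \<Rightarrow> real" where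
  "Q_values \<equiv> wtd_Q H \<theta> \<sigma> \<sigma>0 D"
private abbreviation (input) beta :: real where "beta \<equiv> \<sigma>\<^sup>2 / \<sigma>0\<^sup>2"
private abbreviation (input) shift :: "(('x, 'a) sa \<Rightarrow> real) \<Rightarrow> ('x, 'a) sa \<Rightarrow> real" where
  "shift \<equiv> \<lambda>z s. prior_shift beta \<theta> D s + wtd_scale beta \<sigma> \<sigma>0 D s * z s"

lemma wtd_Q_step:
  assumes "h < H"
  shows "Q_values z h x a = backup (data_weight beta D) (shift z) (\<lambda>x'. MAX a'. Q_values z (Suc h) x' a') (h, x, a)"
proof -
  have "(\<Sum>(r, x')\<in>#buffer D (h, x, a). of_bool r + (MAX a'. Q_values z (Suc h) x' a')) / (real (size (buffer D (h, x, a))) + beta)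
    = (\<Sum>y\<in>UNIV. data_weight beta D (h, x, a) y * (of_bool (fst y) + (MAX a'. Q_values z (Suc h) (snd y) a')))"
    unfolding case_prod_unfold sum_mset_eq_sum_count data_weight_def by (simp add: sum_divide_distrib)
  then show ?thesis
    using assms by (subst wtd_Q.simps) (simp add: wtd_mean_def backup_def prior_shift_def add_divide_distrib)
qed

lemma Max_wtd_Q: "(MAX a. Q_values z h x a) = bv (data_weight beta D) (shift z) (H - h) h x"
proof (induction "H - h" arbitrary: h x)
  case 0
  then show ?case by (subst wtd_Q.simps) simp
next
  case (Suc k)
  then have h: "h < H" "H - h = Suc (H - Suc h)" by simp_all
  have "(\<lambda>x'. MAX a'. Q_values z (Suc h) x' a') = bv (data_weight beta D) (shift z) (H - Suc h) (Suc h)"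
    using Suc by (intro ext Suc(1)) simp
  then show ?case unfolding wtd_Q_step[OF h(1)] h(2) by simp
qed

lemma wtd_Q_eq_backup:
  assumes "h < H"
  shows "Q_values z h x a = backup (data_weight beta D) (shift z) (bv (data_weight beta D) (shift z) (H - Suc h) (Suc h)) (h, x, a)"
  unfolding wtd_Q_step[OF assms] Max_wtd_Q ..

lemma measurable_noise_bv:
  assumes "h + k \<le> H"
  shows "(\<lambda>z. bv (data_weight beta D) (shift z) k h x) \<in> borel_measurable (wtd_noise H)"
proof (rule measurable_bv)
  fix h' :: nat and x' :: 'x and a :: 'a assume "h' < h + k"
  then have "(h', x', a) \<in> sa_space H" using assms by (auto simp: sa_space_def)
  note [measurable] = measurable_noise_component[OF this]
  show "(\<lambda>z. shift z (h', x', a)) \<in> borel_measurable (wtd_noise H)" by measurable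
qed simp

lemma measurable_wtd_Q:
  assumes "h < H"
  shows "(\<lambda>z. Q_values z h x a) \<in> borel_measurable (wtd_noise H)"
proof -
  have "(h, x, a) \<in> sa_space H" using assms by (auto simp: sa_space_def)
  note [measurable] = measurable_noise_component[OF this]
  have [measurable]: "(\<lambda>z. bv (data_weight beta D) (shift z) (H - Suc h) (Suc h) x) \<in> borel_measurable (wtd_noise H)" for x
    using assms by (intro measurable_noise_bv) simp
  show ?thesis unfolding wtd_Q_eq_backup[OF assms] backup_def by measurable
qed

context
  fixes sel :: "('x, 'a) tie_rule"
  assumes sel: "\<And>D h x S. S \<noteq> {} \<Longrightarrow> sel D h x S \<in> S"
begin

lemma wtd_greedy_maximizes:
  "Q_values z h x (wtd_greedy H \<theta> \<sigma> \<sigma>0 sel D z h x) = (MAX a. Q_values z h x a)"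
proof -
  let ?S = "{a. \<forall>a'. Q_values z h x a' \<le> Q_values z h x a}"
  have "Max (range (Q_values z h x)) \<in> range (Q_values z h x)" by (intro Max_in) auto
  then obtain a where a: "Q_values z h x a = (MAX a. Q_values z h x a)" by (metis (no_types, lifting) imageE)
  have "a \<in> ?S" unfolding mem_Collect_eq a by (intro allI Max_ge_fun)
  then have "sel D h x ?S \<in> ?S" by (intro sel) blast
  then have "Q_values z h x a' \<le> Q_values z h x (wtd_greedy H \<theta> \<sigma> \<sigma>0 sel D z h x)" for a'
    by (simp add: wtd_greedy_def)
  then show ?thesis by (intro antisym Max_ge_fun) (simp add: Max_le_iff_fun)
qed

end

text \<open>The policy depends on the noise only through the sets \<open>A z h x\<close> of
  maximizers, which take finitely many values for \<open>h < H\<close> and are everything from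
  \<open>H\<close> on. Each such pattern is a measurable event, so an arbitrary tie rule applied
  afterwards does no harm.\<close>

lemma finite_range_wtd_greedy: "finite (range (wtd_greedy H \<theta> \<sigma> \<sigma>0 sel D))"
  and measurable_wtd_greedy: "wtd_greedy H \<theta> \<sigma> \<sigma>0 sel D \<in> measurable (wtd_noise H) (count_space UNIV)"
proof -
  define A where "A = (\<lambda>z h x. {a. \<forall>a'. Q_values z h x a' \<le> Q_values z h x a})"
  define G where "G = (\<lambda>T h x. sel D h x (T h x))"
  have greedy: "wtd_greedy H \<theta> \<sigma> \<sigma>0 sel D = (\<lambda>z. G (A z))"
    by (simp add: wtd_greedy_def A_def G_def fun_eq_iff)
  have late: "A z h x = UNIV" if "\<not> h < H" for z h x
    using that by (simp add: A_def wtd_Q.simps)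
  let ?S = "{..<H} \<times> (UNIV :: 'x set)"
  have fin: "finite (range A)"
  proof (rule finite_subset)
    show "range A \<subseteq> (\<lambda>S h x. if h < H then S (h, x) else UNIV) ` (\<Pi>\<^sub>E i\<in>?S. UNIV)"
    proof safe
      fix z
      have "A z = (\<lambda>S h x. if h < H then S (h, x) else UNIV) (\<lambda>i\<in>?S. A z (fst i) (snd i))"
        by (auto simp: fun_eq_iff late)
      moreover have "(\<lambda>i\<in>?S. A z (fst i) (snd i)) \<in> (\<Pi>\<^sub>E i\<in>?S. UNIV)" by simp
      ultimately show "A z \<in> (\<lambda>S h x. if h < H then S (h, x) else UNIV) ` (\<Pi>\<^sub>E i\<in>?S. UNIV)"
        by (rule image_eqI)
    qed
    show "finite ((\<lambda>S h x. if h < H then S (h, x) else (UNIV :: 'a set)) ` (\<Pi>\<^sub>E i\<in>?S. UNIV))"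
      by (intro finite_imageI finite_PiE) auto
  qed
  then show "finite (range (wtd_greedy H \<theta> \<sigma> \<sigma>0 sel D))"
    unfolding greedy using finite_imageI[OF fin, of G] by (simp add: image_image)
  have "A \<in> measurable (wtd_noise H) (count_space (range A))"
    unfolding measurable_count_space_eq2[OF fin]
  proof (intro conjI ballI)
    fix T assume "T \<in> range A"
    then have T: "T h x = UNIV" if "\<not> h < H" for h x using late that by auto
    have "A -` {T} \<inter> space (wtd_noise H) =
        {z \<in> space (wtd_noise H). \<forall>h\<in>{..<H}. \<forall>x a. (a \<in> T h x) = (\<forall>a'. Q_values z h x a' \<le> Q_values z h x a)}"
    proof (intro set_eqI iffI)
      fix z assume z: "z \<in> {z \<in> space (wtd_noise H). \<forall>h\<in>{..<H}. \<forall>x a. (a \<in> T h x) = (\<forall>a'. Q_values z h x a' \<le> Q_values z h x a)}"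
      have "A z h x = T h x" for h x
        using z late[of h z x] T[of h x] by (cases "h < H") (auto simp: A_def)
      with z show "z \<in> A -` {T} \<inter> space (wtd_noise H)" by (auto simp: fun_eq_iff)
    qed (auto simp: A_def)
    also have "\<dots> \<in> sets (wtd_noise H)"
    proof -
      have "Measurable.pred (wtd_noise H) (\<lambda>z. \<forall>x a. (a \<in> T h x) = (\<forall>a'. Q_values z h x a' \<le> Q_values z h x a))" if "h \<in> {..<H}" for h
      proof -
        have [measurable]: "Measurable.pred (wtd_noise H) (\<lambda>z. Q_values z h x a' \<le> Q_values z h x a)" for x a a'
          unfolding pred_def using that by (intro borel_measurable_le measurable_wtd_Q) auto
        show ?thesis by measurable
      qed
      then have "Measurable.pred (wtd_noise H) (\<lambda>z. \<forall>h\<in>{..<H}. \<forall>x a. (a \<in> T h x) = (\<forall>a'. Q_values z h x a' \<le> Q_values z h x a))"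
        by (intro pred_intros_finite) auto
      then show ?thesis by (rule predE)
    qed
    finally show "A -` {T} \<inter> space (wtd_noise H) \<in> sets (wtd_noise H)" .
  qed simp
  then show "wtd_greedy H \<theta> \<sigma> \<sigma>0 sel D \<in> measurable (wtd_noise H) (count_space UNIV)"
    unfolding greedy by (rule measurable_compose) simp
qed

end

section \<open>Greedy policies and runs as finitely supported laws\<close>

text \<open>Finite support turns every expectation over a run given the model into a finite sum, so
  exchanging it with integrals over models needs no Fubini argument.\<close>

lemma pmf_of_finite_range:
  assumes "prob_space M" "f \<in> measurable M (count_space UNIV)" "finite (range f)"
  shows "\<exists>p. measure_pmf p = distr M (count_space UNIV) f \<and> finite (set_pmf p)"
proof -
  let ?N = "distr M (count_space UNIV) f"
  interpret M: prob_space M by fact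
  interpret N: prob_space ?N by (rule M.prob_space_distr) fact
  have ae: "AE x in ?N. x \<in> range f"
    using assms(2) by (subst AE_distr_iff) auto
  have "AE x in ?N. measure ?N {x} \<noteq> 0"
    using ae assms(3) N.AE_support_countable by (auto intro: countable_finite)
  then have p: "measure_pmf (Abs_pmf ?N) = ?N"
    using N.prob_space_axioms by (intro Abs_pmf_inverse) auto
  have "set_pmf (Abs_pmf ?N) \<subseteq> range f"
  proof
    fix x assume "x \<in> set_pmf (Abs_pmf ?N)"
    moreover have "AE x in measure_pmf (Abs_pmf ?N). x \<in> range f" unfolding p by (rule ae)
    ultimately show "x \<in> range f" by (auto simp: AE_measure_pmf_iff)
  qed
  with p assms(3) show ?thesis by (meson finite_subset)
qed

definition greedy_pmf ::
    "nat \<Rightarrow> real \<Rightarrow> real \<Rightarrow> real \<Rightarrow> ('x::finite, 'a::finite) tie_rule \<Rightarrow> ('x, 'a) transition list \<Rightarrow> (nat \<Rightarrow> 'x \<Rightarrow> 'a) pmf" where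
  "greedy_pmf H \<theta> \<sigma> \<sigma>0 sel D = (SOME p. measure_pmf p = distr (wtd_noise H) (count_space UNIV) (wtd_greedy H \<theta> \<sigma> \<sigma>0 sel D) \<and> finite (set_pmf p))"

lemma prob_space_wtd_noise: "prob_space (wtd_noise H)"
  unfolding wtd_noise_def by (intro prob_space_PiM gauss.prob_space_axioms)

lemma measure_greedy_pmf: "measure_pmf (greedy_pmf H \<theta> \<sigma> \<sigma>0 sel D) = distr (wtd_noise H) (count_space UNIV) (wtd_greedy H \<theta> \<sigma> \<sigma>0 sel D)"
  and finite_greedy_pmf: "finite (set_pmf (greedy_pmf H \<theta> \<sigma> \<sigma>0 sel D))"
  using someI_ex[OF pmf_of_finite_range[OF prob_space_wtd_noise measurable_wtd_greedy finite_range_wtd_greedy]]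
  unfolding greedy_pmf_def by blast+

lemma expectation_greedy_pmf:
  fixes f :: "_ \<Rightarrow> real"
  shows "expect (greedy_pmf H \<theta> \<sigma> \<sigma>0 sel D) f = (\<integral>z. f (wtd_greedy H \<theta> \<sigma> \<sigma>0 sel D z) \<partial>wtd_noise H)"
  unfolding measure_greedy_pmf by (intro integral_distr measurable_wtd_greedy) simp

lemma wtd_episode_eq:
  "wtd_episode H \<theta> \<sigma> \<sigma>0 sel \<rho> P D = measure_pmf (episode_pmf H \<rho> (greedy_pmf H \<theta> \<sigma> \<sigma>0 sel D) P)"
proof -
  let ?K = "\<lambda>g. bind_pmf \<rho> (\<lambda>x0. map_pmf (\<lambda>\<tau>. (g, x0, \<tau>)) (rollout P (determ g) H 0 x0))"
  have "measure_pmf (episode_pmf H \<rho> (greedy_pmf H \<theta> \<sigma> \<sigma>0 sel D) P) =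
      distr (wtd_noise H) (count_space UNIV) (wtd_greedy H \<theta> \<sigma> \<sigma>0 sel D) \<bind> (\<lambda>g. measure_pmf (?K g))"
    unfolding episode_pmf_def measure_pmf_bind[of "greedy_pmf H \<theta> \<sigma> \<sigma>0 sel D"] measure_greedy_pmf ..
  also have "\<dots> = wtd_noise H \<bind> (\<lambda>z. measure_pmf (?K (wtd_greedy H \<theta> \<sigma> \<sigma>0 sel D z)))"
    using prob_space.not_empty[OF prob_space_wtd_noise]
    by (intro bind_distr[OF measurable_wtd_greedy measurable_measure_pmf]) auto
  finally show ?thesis unfolding wtd_episode_def Let_def ..
qed

lemma wtd_run_eq:
  "wtd_run H \<theta> \<sigma> \<sigma>0 sel \<rho> P l = measure_pmf (run_pmf H \<rho> (greedy_pmf H \<theta> \<sigma> \<sigma>0 sel) (\<lambda>_. P) l)"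
proof (induction l)
  case 0
  show ?case by (simp add: return_pmf.rep_eq)
next
  case (Suc l)
  have "measure_pmf (run_pmf H \<rho> (greedy_pmf H \<theta> \<sigma> \<sigma>0 sel) (\<lambda>_. P) (Suc l)) =
    measure_pmf (run_pmf H \<rho> (greedy_pmf H \<theta> \<sigma> \<sigma>0 sel) (\<lambda>_. P) l) \<bind> (\<lambda>es.
      measure_pmf (episode_pmf H \<rho> (greedy_pmf H \<theta> \<sigma> \<sigma>0 sel (hist es)) P) \<bind> (\<lambda>e. return (count_space UNIV) (es @ [e])))"
    by (simp add: measure_pmf_bind map_pmf_def return_pmf.rep_eq)
  then show ?case unfolding wtd_run.simps Suc.IH wtd_episode_eq hist_def by simp
qed

subsection \<open>Regret of one episode\<close>

lemma integrable_gauss_exp: "integrable gauss (\<lambda>z. exp (t * z))"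
  and integral_gauss_exp: "(\<integral>z. exp (t * z) \<partial>gauss) = exp (t\<^sup>2 / 2)"
proof -
  have eq: "std_normal_density z * exp (t * z) = exp (t\<^sup>2 / 2) * normal_density t 1 z" for z
  proof -
    have "- z\<^sup>2 / 2 + t * z = t\<^sup>2 / 2 + - (z - t)\<^sup>2 / 2"
      by (simp add: power2_eq_square field_simps)
    then have "exp (- z\<^sup>2 / 2) * exp (t * z) = exp (t\<^sup>2 / 2) * exp (- (z - t)\<^sup>2 / 2)"
      by (simp only: exp_add[symmetric])
    then show ?thesis by (simp add: normal_density_def)
  qed
  show "integrable gauss (\<lambda>z. exp (t * z))"
    by (subst integrable_density) (auto simp: eq intro!: integrable_mult_right integrable_normal_density)
  show "(\<integral>z. exp (t * z) \<partial>gauss) = exp (t\<^sup>2 / 2)"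
    by (subst integral_density) (auto simp: eq)
qed

lemma integrable_gauss_excess: "integrable gauss (\<lambda>z. max 0 (\<bar>z\<bar> - t))"
  using integrable_gauss_abs by (intro integrable_max) auto

text \<open>Above the level, \<open>t \<ge> 1\<close> and \<open>x \<le> exp (x - 1)\<close> bound
  the excess by an exponential. The Gaussian moment generating function at \<open>t\<close> and
  \<open>- t\<close> then leaves the factor 2/e, which is at most 1.\<close>

lemma integral_gauss_excess_le:
  assumes t: "1 \<le> t"
  shows "(\<integral>z. max 0 (\<bar>z\<bar> - t) \<partial>gauss) \<le> exp (- t\<^sup>2 / 2)"
proof -
  have bd: "max 0 (\<bar>z\<bar> - t) \<le> exp (- t\<^sup>2 - 1) * exp (t * z) + exp (- t\<^sup>2 - 1) * exp ((- t) * z)" for z :: real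
  proof (cases "\<bar>z\<bar> \<le> t")
    case False
    then have "\<bar>z\<bar> - t \<le> t * (\<bar>z\<bar> - t)" using t mult_right_mono[of 1 t "\<bar>z\<bar> - t"] by simp
    also have "\<dots> \<le> exp (t * (\<bar>z\<bar> - t) - 1)" using exp_ge_add_one_self[of "t * (\<bar>z\<bar> - t) - 1"] by simp
    also have "\<dots> = exp (- t\<^sup>2 - 1) * exp (t * \<bar>z\<bar>)"
      by (simp add: exp_add[symmetric] power2_eq_square algebra_simps)
    also have "\<dots> \<le> exp (- t\<^sup>2 - 1) * exp (t * z) + exp (- t\<^sup>2 - 1) * exp ((- t) * z)"
      by (cases "0 \<le> z") auto
    finally show ?thesis using False by simp
  qed (auto intro!: add_nonneg_nonneg)
  have "(\<integral>z. max 0 (\<bar>z\<bar> - t) \<partial>gauss) \<le> (\<integral>z. exp (- t\<^sup>2 - 1) * exp (t * z) + exp (- t\<^sup>2 - 1) * exp ((- t) * z) \<partial>gauss)"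
    by (intro integral_mono integrable_gauss_excess bd Bochner_Integration.integrable_add integrable_mult_right integrable_gauss_exp)
  also have "\<dots> = 2 * (exp (- t\<^sup>2 - 1) * exp (t\<^sup>2 / 2))"
    using integrable_gauss_exp[of t] integrable_gauss_exp[of "- t"] integral_gauss_exp[of t] integral_gauss_exp[of "- t"]
    by simp
  also have "\<dots> = 2 * exp (- 1) * exp (- t\<^sup>2 / 2)"
    by (simp add: exp_add[symmetric])
  also have "\<dots> \<le> 1 * exp (- t\<^sup>2 / 2)"
  proof (intro mult_right_mono)
    have "2 \<le> exp (1::real)" using exp_ge_add_one_self[of 1] by simp
    then show "2 * exp (- 1) \<le> (1::real)" by (simp add: exp_minus field_simps)
  qed simp
  finally show ?thesis by simp
qed

text \<open>Summing over all triples gives |z s| at most \<open>\<kappa>\<close> plus this quantity,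
  for all triples at once and for every noise, while the expectation is controlled coordinate by
  coordinate.\<close>

definition noise_excess :: "nat \<Rightarrow> real \<Rightarrow> (('x::finite, 'a::finite) sa \<Rightarrow> real) \<Rightarrow> real" where
  "noise_excess H \<kappa> z = (\<Sum>s\<in>sa_space H. max 0 (\<bar>z s\<bar> - \<kappa>))"

text \<open>The first term is \<open>\<kappa>\<close> times an upper bound for the noise scale. The
  second is the prior's share \<open>\<beta> / (n + \<beta>)\<close> of a backup times the largest
  error there: \<open>\<theta> = H\<close> is used where the values may be as low as
  \<open>- H * cap * \<kappa>\<close>, with \<open>cap = sqrt 6 * H / sqrt \<beta>\<close> the bound
  for the scale at an empty buffer.\<close>

definition bonus :: "nat \<Rightarrow> real \<Rightarrow> real \<Rightarrow> ('x, 'a) transition list \<Rightarrow> ('x, 'a) sa \<Rightarrow> real" where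
  "bonus H \<beta> \<kappa> D s = \<kappa> * sqrt 6 * real H / sqrt (real (size (buffer D s)) + \<beta>)
     + (real H + real H * (sqrt 6 * real H / sqrt \<beta>) * \<kappa>) * (\<beta> / (real (size (buffer D s)) + \<beta>))"

context
  fixes H :: nat and \<beta> \<sigma> \<sigma>0 \<kappa> :: real and D :: "('x::finite, 'a::finite) transition list"
    and \<alpha> :: "('x, 'a) model" and sel :: "('x, 'a) tie_rule" and \<rho> :: "'x pmf"
  assumes H: "0 < H" and \<alpha>_nonneg: "\<And>s y. s \<in> sa_space H \<Longrightarrow> 0 \<le> \<alpha> s y"
    and \<alpha>_sum: "\<And>s. s \<in> sa_space H \<Longrightarrow> sum (\<alpha> s) UNIV = \<beta>"
    and \<beta>: "3 \<le> \<beta>" and \<sigma>: "0 < \<sigma>" "0 < \<sigma>0" "\<sigma>\<^sup>2 = 3 * (real H)\<^sup>2" and ratio: "\<sigma>\<^sup>2 / \<sigma>0\<^sup>2 = \<beta>"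
    and \<kappa>: "1 \<le> \<kappa>"
    and sel: "\<And>D h x S. S \<noteq> {} \<Longrightarrow> sel D h x S \<in> S"
begin

private abbreviation (input) n where "n \<equiv> \<lambda>s. real (size (buffer D s))"

lemma admissible_prior: "admissible H \<alpha>"
  using \<alpha>_nonneg \<alpha>_sum \<beta> by (simp add: admissible_def)

text \<open>The relation \<open>\<sigma>\<^sup>2 = \<beta> * \<sigma>0\<^sup>2\<close> turns
  \<open>\<beta> * \<sigma>0\<close> into \<open>sqrt \<beta> * \<sigma>\<close>, so the prior
  enters the scale like \<open>\<beta>\<close> further observations.\<close>

lemma wtd_scale_eq: "wtd_scale \<beta> \<sigma> \<sigma>0 D s = sqrt 3 * real H * ((sqrt (n s) + sqrt \<beta>) / (n s + \<beta>))"
proof -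
  have s: "\<sigma> = sqrt 3 * real H"
    using \<sigma> by (metis less_imp_le of_nat_0_le_iff real_sqrt_abs abs_of_nonneg real_sqrt_mult real_sqrt_unique)
  have eq: "\<sigma>\<^sup>2 = \<beta> * \<sigma>0\<^sup>2" using ratio \<sigma> by (auto simp: field_simps)
  have "\<sigma> = sqrt (\<sigma>\<^sup>2)" using \<sigma>(1) by simp
  also have "\<dots> = sqrt \<beta> * \<sigma>0" unfolding eq using \<sigma>(2) by (simp add: real_sqrt_mult)
  finally have "sqrt \<beta> * \<sigma> = sqrt \<beta> * sqrt \<beta> * \<sigma>0" by simp
  also have "\<dots> = \<beta> * \<sigma>0" using \<beta> by simp
  finally have "\<beta> * \<sigma>0 = sqrt \<beta> * \<sigma>" ..
  then have "sqrt (n s) * \<sigma> + \<beta> * \<sigma>0 = \<sigma> * (sqrt (n s) + sqrt \<beta>)" by (simp add: algebra_simps)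
  then show ?thesis unfolding wtd_scale_def by (simp add: s)
qed

text \<open>The left side is the standard deviation that optimism demands for a posterior of mass
  \<open>n + \<beta>\<close> and values in \<open>[0, H]\<close>; subadditivity of the square root
  supplies it.\<close>

lemma wtd_scale_lower: "sqrt (3 / (n s + \<beta>)) * real H \<le> wtd_scale \<beta> \<sigma> \<sigma>0 D s"
proof -
  have p: "0 < n s + \<beta>" using \<beta> by (simp add: add_nonneg_pos)
  have "sqrt (n s + \<beta>) \<le> sqrt (n s) + sqrt \<beta>"
    using \<beta> by (intro sqrt_add_le_add_sqrt) auto
  then have "sqrt (n s + \<beta>) / (n s + \<beta>) \<le> (sqrt (n s) + sqrt \<beta>) / (n s + \<beta>)"
    using p by (intro divide_right_mono) auto
  moreover have "sqrt (n s + \<beta>) / (n s + \<beta>) = 1 / sqrt (n s + \<beta>)"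
    using p by (simp add: real_div_sqrt field_simps)
  ultimately have "sqrt 3 * real H * (1 / sqrt (n s + \<beta>)) \<le> sqrt 3 * real H * ((sqrt (n s) + sqrt \<beta>) / (n s + \<beta>))"
    by (intro mult_left_mono) auto
  then show ?thesis unfolding wtd_scale_eq by (simp add: real_sqrt_divide mult_ac)
qed

text \<open>The square of a sum of two terms is at most twice the sum of the squares, which costs
  \<open>sqrt 2\<close>; hence \<open>sqrt 6 = sqrt 3 * sqrt 2\<close>.\<close>

lemma wtd_scale_upper: "wtd_scale \<beta> \<sigma> \<sigma>0 D s \<le> sqrt 6 * real H / sqrt (n s + \<beta>)"
proof -
  have p: "0 < n s + \<beta>" using \<beta> by (simp add: add_nonneg_pos)
  have "(sqrt (n s) + sqrt \<beta>)\<^sup>2 \<le> 2 * (n s + \<beta>)"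
  proof -
    have "0 \<le> (sqrt (n s) - sqrt \<beta>)\<^sup>2" by simp
    then show ?thesis using \<beta> by (simp add: power2_eq_square algebra_simps)
  qed
  then have "sqrt (n s) + sqrt \<beta> \<le> sqrt (2 * (n s + \<beta>))" by (rule real_le_rsqrt)
  then have "(sqrt (n s) + sqrt \<beta>) / (n s + \<beta>) \<le> sqrt (2 * (n s + \<beta>)) / (n s + \<beta>)"
    using p by (intro divide_right_mono) auto
  also have "\<dots> = sqrt 2 / sqrt (n s + \<beta>)"
    using p by (simp only: real_sqrt_mult times_divide_eq_right[symmetric] sqrt_divide_self_eq less_imp_le) (simp add: divide_inverse)
  finally have "sqrt 3 * real H * ((sqrt (n s) + sqrt \<beta>) / (n s + \<beta>)) \<le> sqrt 3 * real H * (sqrt 2 / sqrt (n s + \<beta>))"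
    by (intro mult_left_mono) auto
  moreover have "sqrt 6 = sqrt 3 * sqrt 2" by (simp add: real_sqrt_mult[symmetric])
  ultimately show ?thesis unfolding wtd_scale_eq by (simp add: mult_ac)
qed

lemma wtd_scale_nonneg: "0 \<le> wtd_scale \<beta> \<sigma> \<sigma>0 D s"
  using \<beta> unfolding wtd_scale_eq by (auto intro!: mult_nonneg_nonneg divide_nonneg_nonneg add_nonneg_nonneg)

private abbreviation (input) cap where "cap \<equiv> sqrt 6 * real H / sqrt \<beta>"

lemma wtd_scale_le_M: "wtd_scale \<beta> \<sigma> \<sigma>0 D s \<le> cap"
  using \<beta> by (intro order_trans[OF wtd_scale_upper] divide_left_mono mult_pos_pos) (auto simp: add_nonneg_pos)

private abbreviation (input) wD where "wD \<equiv> data_weight \<beta> D"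
private abbreviation (input) bD where "bD \<equiv> \<lambda>z s. prior_shift \<beta> (real H) D s + wtd_scale \<beta> \<sigma> \<sigma>0 D s * z s"
private abbreviation (input) \<alpha>D where "\<alpha>D \<equiv> posterior D \<alpha>"

text \<open>The counts agree in the posterior mean and in the update. The remaining prior weights
  have total mass \<open>\<beta>\<close> and meet values of at most \<open>H\<close>, which
  \<open>\<theta> = H\<close> dominates.\<close>

lemma optimism_wtd:
  "(\<integral>P. model_bv P H 0 x \<partial>dirichlet_prior H \<alpha>D) \<le> (\<integral>z. bv wD (bD z) H 0 x \<partial>wtd_noise H)"
proof (intro optimism H admissible_posterior admissible_prior substochastic_data_weight)
  fix s :: "('x, 'a) sa" assume s: "s \<in> sa_space H"
  have sum: "sum (\<alpha>D s) UNIV = n s + \<beta>" by (simp add: sum_posterior \<alpha>_sum[OF s])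
  show "sqrt (3 / sum (\<alpha>D s) UNIV) * real H \<le> wtd_scale \<beta> \<sigma> \<sigma>0 D s"
    unfolding sum by (rule wtd_scale_lower)
  fix v :: "'x outcome \<Rightarrow> real" assume v: "\<And>y. 0 \<le> v y" "\<And>y. v y \<le> real H"
  have p: "0 < n s + \<beta>" using \<beta> by (simp add: add_nonneg_pos)
  have "(\<Sum>y\<in>UNIV. \<alpha> s y * v y) \<le> (\<Sum>y\<in>UNIV. \<alpha> s y * real H)"
    using \<alpha>_nonneg[OF s] v by (intro sum_mono mult_left_mono) auto
  also have "\<dots> = \<beta> * real H" by (simp add: sum_distrib_right[symmetric] \<alpha>_sum[OF s])
  finally have "(\<Sum>y\<in>UNIV. \<alpha>D s y * v y) \<le> (\<Sum>y\<in>UNIV. real (count (buffer D s) y) * v y) + \<beta> * real H"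
    by (simp add: posterior_def distrib_right sum.distrib)
  then have "wmean (\<alpha>D s) v \<le> ((\<Sum>y\<in>UNIV. real (count (buffer D s) y) * v y) + \<beta> * real H) / (n s + \<beta>)"
    unfolding wmean_def sum using p by (intro divide_right_mono) auto
  then show "wmean (\<alpha>D s) v \<le> (\<Sum>y\<in>UNIV. wD s y * v y) + prior_shift \<beta> (real H) D s"
    by (simp add: data_weight_def prior_shift_def add_divide_distrib sum_divide_distrib)
qed (use \<beta> in auto)

private abbreviation (input) excess :: "(('x, 'a) sa \<Rightarrow> real) \<Rightarrow> real" where "excess \<equiv> noise_excess H \<kappa>"
private abbreviation (input) bonusD where "bonusD \<equiv> bonus H \<beta> \<kappa> D"

lemma excess_nonneg: "0 \<le> excess z"
  unfolding noise_excess_def by (intro sum_nonneg) auto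

lemma abs_noise_le:
  assumes "s \<in> sa_space H"
  shows "\<bar>z s\<bar> \<le> \<kappa> + excess z"
proof -
  have "max 0 (\<bar>z s\<bar> - \<kappa>) \<le> excess z"
    unfolding noise_excess_def using assms by (intro member_le_sum) auto
  then show ?thesis by simp
qed

lemma integrable_excess: "integrable (wtd_noise H) excess"
  and integral_excess_le: "(\<integral>z. excess z \<partial>wtd_noise H) \<le> real (card (sa_space H :: ('x, 'a) sa set)) * exp (- \<kappa>\<^sup>2 / 2)"
proof -
  have comp: "integrable (wtd_noise H) (\<lambda>z. max 0 (\<bar>z s\<bar> - \<kappa>))"
    "(\<integral>z. max 0 (\<bar>z s\<bar> - \<kappa>) \<partial>wtd_noise H) \<le> exp (- \<kappa>\<^sup>2 / 2)" if s: "s \<in> sa_space H" for s :: "('x, 'a) sa"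
  proof -
    have d: "distr (wtd_noise H) gauss (\<lambda>z. z s) = gauss"
      unfolding wtd_noise_def using s by (intro distr_PiM_component gauss.prob_space_axioms)
    have m: "(\<lambda>z. z s) \<in> measurable (wtd_noise H) gauss"
      unfolding wtd_noise_def using s by (rule measurable_component_singleton)
    have "integrable (distr (wtd_noise H) gauss (\<lambda>z. z s)) (\<lambda>u. max 0 (\<bar>u\<bar> - \<kappa>))"
      unfolding d by (rule integrable_gauss_excess)
    then show "integrable (wtd_noise H) (\<lambda>z. max 0 (\<bar>z s\<bar> - \<kappa>))"
      using m by (subst (asm) integrable_distr_eq) auto
    have "(\<integral>z. max 0 (\<bar>z s\<bar> - \<kappa>) \<partial>wtd_noise H) = (\<integral>u. max 0 (\<bar>u\<bar> - \<kappa>) \<partial>distr (wtd_noise H) gauss (\<lambda>z. z s))"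
      using m by (subst integral_distr) auto
    then show "(\<integral>z. max 0 (\<bar>z s\<bar> - \<kappa>) \<partial>wtd_noise H) \<le> exp (- \<kappa>\<^sup>2 / 2)"
      unfolding d using integral_gauss_excess_le[OF \<kappa>] by simp
  qed
  show "integrable (wtd_noise H) excess"
    unfolding noise_excess_def using comp by (intro Bochner_Integration.integrable_sum)
  have "(\<integral>z. excess z \<partial>wtd_noise H) = (\<Sum>s\<in>(sa_space H :: ('x, 'a) sa set). \<integral>z. max 0 (\<bar>z s\<bar> - \<kappa>) \<partial>wtd_noise H)"
    unfolding noise_excess_def using comp by (intro Bochner_Integration.integral_sum)
  also have "\<dots> \<le> (\<Sum>s\<in>(sa_space H :: ('x, 'a) sa set). exp (- \<kappa>\<^sup>2 / 2))"
    using comp by (intro sum_mono)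
  finally show "(\<integral>z. excess z \<partial>wtd_noise H) \<le> real (card (sa_space H :: ('x, 'a) sa set)) * exp (- \<kappa>\<^sup>2 / 2)"
    by simp
qed

lemma prior_shift_bounds: "0 \<le> prior_shift \<beta> (real H) D s" "prior_shift \<beta> (real H) D s \<le> real H"
proof -
  have p: "0 < n s + \<beta>" using \<beta> by (simp add: add_nonneg_pos)
  show "0 \<le> prior_shift \<beta> (real H) D s" using \<beta> by (simp add: prior_shift_def)
  have "\<beta> * real H \<le> real H * (n s + \<beta>)" by (simp add: algebra_simps)
  then show "prior_shift \<beta> (real H) D s \<le> real H" using p by (simp add: prior_shift_def divide_le_eq)
qed

lemma abs_scaled_noise_le:
  assumes "s \<in> sa_space H"
  shows "\<bar>wtd_scale \<beta> \<sigma> \<sigma>0 D s * z s\<bar> \<le> cap * (\<kappa> + excess z)"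
  unfolding abs_mult using wtd_scale_nonneg wtd_scale_le_M abs_noise_le[OF assms] \<beta>
  by (intro mult_mono) auto

lemma M_nonneg: "0 \<le> cap" using \<beta> by simp

text \<open>The counts cancel between the update and the posterior mean. There remain the prior term
  \<open>\<beta> * H\<close>, from which the prior weights applied to possibly negative values are
  subtracted, and the noise. In the last summand, \<open>cap\<close> comes from the excess in the
  noise at \<open>s\<close> and \<open>H * cap\<close> from the excess in the lower bound of
  \<open>V\<close>.\<close>

lemma backup_gap:
  assumes s: "s \<in> sa_space H" and V: "\<And>x. - (real H * (cap * (\<kappa> + excess z))) \<le> V x"
  shows "backup wD (bD z) V s \<le> backup (\<lambda>s. pmf (outcome_pmf (mean_model \<alpha>D s))) (\<lambda>_. 0) V s + bonusD s + (real H + 1) * cap * excess z"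
proof -
  define N where "N = n s + \<beta>"
  define \<zeta> where "\<zeta> = \<kappa> + excess z"
  define v where "v = (\<lambda>y. of_bool (fst y) + V (snd y) :: real)"
  define e where "e = excess z"
  have N: "0 < N" "\<beta> \<le> N" using \<beta> by (auto simp: N_def add_nonneg_pos)
  have e: "0 \<le> e" unfolding e_def by (rule excess_nonneg)
  have sum: "sum (\<alpha>D s) UNIV = N" by (simp add: sum_posterior \<alpha>_sum[OF s] N_def)
  have p: "backup (\<lambda>s. pmf (outcome_pmf (mean_model \<alpha>D s))) (\<lambda>_. 0) V s = (\<Sum>y\<in>UNIV. \<alpha>D s y * v y) / N"
    unfolding backup_def pmf_outcome_mean_model[OF admissible_posterior[OF admissible_prior] s] v_def[symmetric]
    by (simp add: mean_model_def sum sum_divide_distrib v_def)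
  have q: "backup wD (bD z) V s = ((\<Sum>y\<in>UNIV. real (count (buffer D s) y) * v y) + \<beta> * real H) / N + wtd_scale \<beta> \<sigma> \<sigma>0 D s * z s"
    unfolding backup_def data_weight_def prior_shift_def by (simp add: v_def N_def add_divide_distrib sum_divide_distrib)
  have \<zeta>: "0 \<le> \<zeta>" using \<kappa> e by (simp add: \<zeta>_def e_def)
  have vl: "- (real H * (cap * \<zeta>)) \<le> v y" for y
    using V[of "snd y"] by (simp add: v_def \<zeta>_def of_bool_def)
  \<comment> \<open>The weights \<open>\<alpha> s\<close> have total mass \<open>\<beta>\<close>, so
    they can lower the posterior backup by at most \<open>\<beta> / N\<close> times the depth of the
    negative values.\<close>
  have "\<beta> * (- (real H * (cap * \<zeta>))) = (\<Sum>y\<in>UNIV. \<alpha> s y * (- (real H * (cap * \<zeta>))))"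
    by (simp only: sum_distrib_right[symmetric] \<alpha>_sum[OF s])
  also have "\<dots> \<le> (\<Sum>y\<in>UNIV. \<alpha> s y * v y)"
    using \<alpha>_nonneg[OF s] vl by (intro sum_mono mult_left_mono) auto
  finally have "(\<Sum>y\<in>UNIV. real (count (buffer D s) y) * v y) + \<beta> * real H \<le> (\<Sum>y\<in>UNIV. \<alpha>D s y * v y) + \<beta> * (real H + real H * (cap * \<zeta>))"
    by (simp add: posterior_def distrib_right sum.distrib algebra_simps)
  then have f1: "((\<Sum>y\<in>UNIV. real (count (buffer D s) y) * v y) + \<beta> * real H) / N \<le> (\<Sum>y\<in>UNIV. \<alpha>D s y * v y) / N + \<beta> / N * (real H + real H * (cap * \<zeta>))"
    using N by (simp add: divide_right_mono add_divide_distrib[symmetric])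
  have f2: "wtd_scale \<beta> \<sigma> \<sigma>0 D s * z s \<le> \<kappa> * sqrt 6 * real H / sqrt N + cap * e"
  proof -
    have "wtd_scale \<beta> \<sigma> \<sigma>0 D s * z s \<le> wtd_scale \<beta> \<sigma> \<sigma>0 D s * (\<kappa> + e)"
      using abs_noise_le[OF s, of z] wtd_scale_nonneg by (intro mult_left_mono) (auto simp: e_def)
    also have "\<dots> = wtd_scale \<beta> \<sigma> \<sigma>0 D s * \<kappa> + wtd_scale \<beta> \<sigma> \<sigma>0 D s * e" by (simp add: distrib_left)
    also have "\<dots> \<le> sqrt 6 * real H / sqrt N * \<kappa> + cap * e"
      using \<kappa> e wtd_scale_upper[of s] wtd_scale_le_M[of s] unfolding N_def by (intro add_mono mult_right_mono) auto
    finally show ?thesis by (simp add: mult_ac)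
  qed
  have f3: "\<beta> / N * (real H + real H * (cap * \<zeta>)) \<le> (real H + real H * cap * \<kappa>) * (\<beta> / N) + real H * cap * e"
  proof -
    have "\<beta> / N * (real H * cap * e) \<le> 1 * (real H * cap * e)"
      using N e \<beta> by (intro mult_right_mono) auto
    moreover have "r * (a + a * (b * (k + e))) = (a + a * b * k) * r + r * (a * b * e)" for r a b k :: real
      by (simp add: algebra_simps)
    ultimately show ?thesis
      unfolding \<zeta>_def e_def[symmetric] mult_1 by (metis add_left_mono)
  qed
  have f4: "(real H + 1) * cap * e = real H * cap * e + cap * e"
    by (simp only: distrib_right mult_1)
  have comb: "a + d \<le> b + (f + h) + j" if "a \<le> b + c" "d \<le> f + g" "c \<le> h + i" "j = i + g" for a b c d f g h i j :: real
    using that by linarith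
  show ?thesis
    unfolding p q bonus_def N_def[symmetric] e_def[symmetric] by (rule comb[OF f1 f2 f3 f4])
qed

lemma abs_shift_le:
  assumes "s \<in> sa_space H"
  shows "- (cap * (\<kappa> + excess z)) \<le> bD z s" "\<bar>bD z s\<bar> \<le> real H + cap * (\<kappa> + excess z)"
  using abs_scaled_noise_le[OF assms, of z] prior_shift_bounds[of s] by (auto simp: abs_le_iff)

text \<open>The greedy action attains the maximum in the recursion, so under the same noise
  \<open>z\<close> the value is a backup at the visited triple. Replacing its weights by the mean
  model costs one bonus and one excess term, and the difference telescopes along the
  rollout.\<close>

lemma bv_le_rollout:
  assumes "h + k = H"
  shows "bv wD (bD z) k h x \<le>
    expect (rollout (mean_model \<alpha>D) (determ (wtd_greedy H (real H) \<sigma> \<sigma>0 sel D z)) k h x)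
      (\<lambda>\<tau>. total_reward \<tau> + (\<Sum>t\<leftarrow>\<tau>. bonusD (fst t))) + real k * ((real H + 1) * cap * excess z)"
  using assms
proof (induction k arbitrary: h x)
  case (Suc k)
  define g where "g = wtd_greedy H (real H) \<sigma> \<sigma>0 sel D z"
  define s where "s = (h, x, g h x)"
  define V where "V = bv wD (bD z) k (Suc h)"
  define E where "E = (real H + 1) * cap * excess z"
  define w where "w = (\<lambda>s. pmf (outcome_pmf (mean_model \<alpha>D s)))"
  let ?R = "\<lambda>x'. expect (rollout (mean_model \<alpha>D) (determ g) k (Suc h) x') (\<lambda>\<tau>. total_reward \<tau> + (\<Sum>t\<leftarrow>\<tau>. bonusD (fst t)))"
  have h: "h < H" "H - h = Suc k" "H - Suc h = k" using Suc.prems by auto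
  have s: "s \<in> sa_space H" using h by (simp add: s_def sa_space_def)
  have sub: "substochastic wD" using \<beta> by (intro substochastic_data_weight) simp
  have nn: "0 \<le> cap * (\<kappa> + excess z)" using M_nonneg \<kappa> excess_nonneg[of z] by (intro mult_nonneg_nonneg) auto
  have Vl: "- (real H * (cap * (\<kappa> + excess z))) \<le> V x" for x
  proof -
    have "- (real k * (cap * (\<kappa> + excess z))) \<le> V x"
      unfolding V_def using Suc.prems nn
      by (intro bv_lower[OF sub] abs_shift_le) (auto simp: sa_space_def)
    moreover have "real k * (cap * (\<kappa> + excess z)) \<le> real H * (cap * (\<kappa> + excess z))"
      using nn Suc.prems by (intro mult_right_mono) auto
    ultimately show ?thesis by linarith
  qed
  have "bv wD (bD z) (Suc k) h x = wtd_Q H (real H) \<sigma> \<sigma>0 D z h x (g h x)"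
    using Max_wtd_Q[of H "real H" \<sigma> \<sigma>0 D z h x] ratio h wtd_greedy_maximizes[OF sel, of H "real H" \<sigma> \<sigma>0 D z h x]
    by (simp add: g_def)
  also have "\<dots> = backup wD (bD z) V s"
    unfolding wtd_Q_eq_backup[OF h(1)] unfolding ratio h V_def s_def ..
  also have "\<dots> \<le> backup w (\<lambda>_. 0) V s + bonusD s + E"
    unfolding w_def E_def by (rule backup_gap[OF s Vl])
  finally have c1: "bv wD (bD z) (Suc k) h x \<le> backup w (\<lambda>_. 0) V s + bonusD s + E" .
  have c2: "backup w (\<lambda>_. 0) V s \<le> (\<Sum>y\<in>UNIV. w s y * (of_bool (fst y) + ?R (snd y))) + real k * E"
  proof -
    have E: "0 \<le> real k * E"
      unfolding E_def using M_nonneg excess_nonneg[of z] by (intro mult_nonneg_nonneg) auto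
    have "V x' \<le> ?R x' + real k * E" for x'
      using Suc.IH[of "Suc h" x'] Suc.prems by (simp add: V_def g_def E_def)
    then show ?thesis
      unfolding backup_def add_0_right w_def
      by (intro weighted_sum_le substochasticD[OF substochastic_outcome] E) (simp add: add.assoc)
  qed
  have c3: "(\<Sum>y\<in>UNIV. w s y * (of_bool (fst y) + ?R (snd y))) + bonusD s
     = expect (rollout (mean_model \<alpha>D) (determ g) (Suc k) h x) (\<lambda>\<tau>. total_reward \<tau> + (\<Sum>t\<leftarrow>\<tau>. bonusD (fst t)))"
  proof -
    have "expect (rollout (mean_model \<alpha>D) (determ g) (Suc k) h x) (\<lambda>\<tau>. total_reward \<tau> + (\<Sum>t\<leftarrow>\<tau>. bonusD (fst t)))
      = (\<Sum>y\<in>UNIV. w s y * ((of_bool (fst y) + bonusD s) + ?R (snd y)))"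
      unfolding expectation_rollout_det_Suc s_def[symmetric] w_def
    proof (intro sum.cong refl arg_cong2[where f = "(*)"])
      fix y
      have "expect (rollout (mean_model \<alpha>D) (determ g) k (Suc h) (snd y)) (\<lambda>\<tau>. total_reward ((s, y) # \<tau>) + (\<Sum>t\<leftarrow>(s, y) # \<tau>. bonusD (fst t)))
        = expect (rollout (mean_model \<alpha>D) (determ g) k (Suc h) (snd y)) (\<lambda>\<tau>. (of_bool (fst y) + bonusD s) + (total_reward \<tau> + (\<Sum>t\<leftarrow>\<tau>. bonusD (fst t))))"
        by (intro Bochner_Integration.integral_cong refl) simp
      then show "expect (rollout (mean_model \<alpha>D) (determ g) k (Suc h) (snd y)) (\<lambda>\<tau>. total_reward ((s, y) # \<tau>) + (\<Sum>t\<leftarrow>(s, y) # \<tau>. bonusD (fst t)))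
         = (of_bool (fst y) + bonusD s) + ?R (snd y)"
        by (simp only: expectation_add_pmf[OF finite_set_rollout]) simp
    qed
    also have "\<dots> = (\<Sum>y\<in>UNIV. w s y * (of_bool (fst y) + ?R (snd y))) + sum (w s) UNIV * bonusD s"
      by (simp only: sum_distrib_right sum.distrib[symmetric]) (intro sum.cong refl, simp add: algebra_simps)
    also have "sum (w s) UNIV = 1" by (simp add: w_def)
    finally show ?thesis by simp
  qed
  have "real (Suc k) * E = real k * E + E" by (simp add: algebra_simps)
  with c1 c2 c3 show ?case unfolding g_def[symmetric] E_def[symmetric] by linarith
qed simp

lemma integrable_noise_bv: "integrable (wtd_noise H) (\<lambda>z. bv wD (bD z) H 0 x)"
proof (rule Bochner_Integration.integrable_bound)
  interpret prob_space "wtd_noise H" by (rule prob_space_wtd_noise)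
  show "integrable (wtd_noise H) (\<lambda>z. real H * (1 + (real H + cap * (\<kappa> + excess z))))"
    using integrable_excess by simp
  show "(\<lambda>z. bv wD (bD z) H 0 x) \<in> borel_measurable (wtd_noise H)"
    using measurable_noise_bv[of 0 H H \<sigma> \<sigma>0 D "real H" x] unfolding ratio by simp
  show "AE z in wtd_noise H. norm (bv wD (bD z) H 0 x) \<le> norm (real H * (1 + (real H + cap * (\<kappa> + excess z))))"
  proof (intro AE_I2)
    fix z :: "('x, 'a) sa \<Rightarrow> real"
    have nn: "0 \<le> real H + cap * (\<kappa> + excess z)"
      using M_nonneg \<kappa> excess_nonneg[of z] by (intro add_nonneg_nonneg mult_nonneg_nonneg) auto
    have "\<bar>bv wD (bD z) H 0 x\<bar> \<le> real H * (1 + (real H + cap * (\<kappa> + excess z)))"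
      using \<beta> nn by (intro bv_abs_bound substochastic_data_weight abs_shift_le) (auto simp: sa_space_def)
    also have "\<dots> \<le> \<bar>real H * (1 + (real H + cap * (\<kappa> + excess z)))\<bar>" by (rule abs_ge_self)
    finally show "norm (bv wD (bD z) H 0 x) \<le> norm (real H * (1 + (real H + cap * (\<kappa> + excess z))))"
      unfolding real_norm_def .
  qed
qed

text \<open>The optimistic expectation does not depend on the policy, so it can be rewritten with
  the very noise that generates the policy. The pointwise bound for that noise then produces the
  value of the greedy policy in the mean model, which cancels.\<close>

lemma episode_regret_le:
  "expect (greedy_pmf H (real H) \<sigma> \<sigma>0 sel D) (\<lambda>g. expect \<rho> (\<lambda>x0.
      \<integral>P. model_bv P H 0 x0 - val H P (determ g) 0 x0 \<partial>dirichlet_prior H \<alpha>D))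
    \<le> expect (episode_pmf H \<rho> (greedy_pmf H (real H) \<sigma> \<sigma>0 sel D) (mean_model \<alpha>D)) (\<lambda>(g, x0, \<tau>). \<Sum>t\<leftarrow>\<tau>. bonusD (fst t))
      + real H * ((real H + 1) * cap) * (real (card (sa_space H :: ('x, 'a) sa set)) * exp (- \<kappa>\<^sup>2 / 2))"
proof -
  let ?q = "greedy_pmf H (real H) \<sigma> \<sigma>0 sel D" and ?g = "wtd_greedy H (real H) \<sigma> \<sigma>0 sel D"
  let ?A = "\<lambda>P x0. model_bv P H 0 x0"
  let ?B = "\<lambda>g x0. expect (rollout (mean_model \<alpha>D) (determ g) H 0 x0) (\<lambda>\<tau>. \<Sum>t\<leftarrow>\<tau>. bonusD (fst t))"
  let ?v = "\<lambda>g x0. val H (mean_model \<alpha>D) (determ g) 0 x0"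
  let ?E = "\<lambda>z. real H * ((real H + 1) * cap) * excess z"
  interpret N: prob_space "wtd_noise H" by (rule prob_space_wtd_noise)
  have adm: "admissible H \<alpha>D" by (intro admissible_posterior admissible_prior)
  have A_int: "integrable (dirichlet_prior H \<alpha>D) (\<lambda>P. ?A P x0)" for x0
  proof (intro integrable_bounded_prior[OF adm, of _ "real H"] measurable_bv measurable_pmf_outcome_pmf)
    show "\<bar>?A P x0\<bar> \<le> real H" for P
      using bv_true_bounds[of 0 H "\<lambda>s. pmf (outcome_pmf (P s))" P "\<lambda>_. 0" x0] by simp
  qed (auto simp: sa_space_def)
  have v_int: "integrable (dirichlet_prior H \<alpha>D) (\<lambda>P. val H P (determ g) 0 x0)" for g x0
    by (intro integrable_bounded_prior[OF adm, of _ "real H"] measurable_val abs_val_le)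
  have inner: "(\<integral>P. ?A P x0 - val H P (determ g) 0 x0 \<partial>dirichlet_prior H \<alpha>D) \<le> (\<integral>z. bv wD (bD z) H 0 x0 \<partial>wtd_noise H) - ?v g x0" for g x0
    using optimism_wtd[of x0] A_int v_int integral_prior_val[OF adm] by simp
  have greedy_int: "integrable (wtd_noise H) (\<lambda>z. f (?g z))" for f :: "_ \<Rightarrow> real"
  proof -
    have "integrable (measure_pmf ?q) f" by (intro integrable_measure_pmf_finite finite_greedy_pmf)
    then show ?thesis
      unfolding measure_greedy_pmf by (subst (asm) integrable_distr_eq) (auto intro: measurable_wtd_greedy)
  qed
  have "expect ?q (\<lambda>g. expect \<rho> (\<lambda>x0. \<integral>P. ?A P x0 - val H P (determ g) 0 x0 \<partial>dirichlet_prior H \<alpha>D))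
    \<le> expect ?q (\<lambda>g. expect \<rho> (\<lambda>x0. (\<integral>z. bv wD (bD z) H 0 x0 \<partial>wtd_noise H) - ?v g x0))"
    by (intro expectation_mono_pmf inner finite_greedy_pmf) auto
  also have "\<dots> = expect ?q (\<lambda>g. expect \<rho> (\<lambda>x0. \<integral>z. bv wD (bD z) H 0 x0 \<partial>wtd_noise H) - expect \<rho> (?v g))"
    by (intro Bochner_Integration.integral_cong refl Bochner_Integration.integral_diff integrable_measure_pmf_finite) auto
  also have "\<dots> = expect \<rho> (\<lambda>x0. \<integral>z. bv wD (bD z) H 0 x0 \<partial>wtd_noise H) - expect ?q (\<lambda>g. expect \<rho> (?v g))"
    by (subst Bochner_Integration.integral_diff) (auto intro!: integrable_measure_pmf_finite finite_greedy_pmf)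
  also have "expect \<rho> (\<lambda>x0. \<integral>z. bv wD (bD z) H 0 x0 \<partial>wtd_noise H) = (\<integral>z. expect \<rho> (\<lambda>x0. bv wD (bD z) H 0 x0) \<partial>wtd_noise H)"
    by (intro integral_expectation_pmf_swap[symmetric] integrable_noise_bv) auto
  also have "\<dots> \<le> (\<integral>z. (expect \<rho> (?v (?g z)) + expect \<rho> (?B (?g z))) + ?E z \<partial>wtd_noise H)"
  proof (intro integral_mono Bochner_Integration.integrable_add greedy_int integrable_mult_right integrable_excess)
    show "integrable (wtd_noise H) (\<lambda>z. expect \<rho> (\<lambda>x0. bv wD (bD z) H 0 x0))"
    proof -
      have "(\<lambda>z. expect \<rho> (\<lambda>x0. bv wD (bD z) H 0 x0)) = (\<lambda>z. \<Sum>x0\<in>UNIV. pmf \<rho> x0 * bv wD (bD z) H 0 x0)"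
        by (simp add: integral_measure_pmf[of UNIV])
      then show ?thesis using integrable_noise_bv by simp
    qed
    fix z :: "('x, 'a) sa \<Rightarrow> real"
    have "bv wD (bD z) H 0 x0 \<le> ?v (?g z) x0 + ?B (?g z) x0 + ?E z" for x0
    proof -
      have "bv wD (bD z) H 0 x0 \<le> expect (rollout (mean_model \<alpha>D) (determ (?g z)) H 0 x0)
          (\<lambda>\<tau>. total_reward \<tau> + (\<Sum>t\<leftarrow>\<tau>. bonusD (fst t))) + real H * ((real H + 1) * cap * excess z)"
        by (rule bv_le_rollout) simp
      then show ?thesis
        by (simp add: expectation_add_pmf[OF finite_set_rollout] val_def mult.assoc)
    qed
    then have "expect \<rho> (\<lambda>x0. bv wD (bD z) H 0 x0) \<le> expect \<rho> (\<lambda>x0. ?v (?g z) x0 + ?B (?g z) x0 + ?E z)"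
      by (intro expectation_mono_pmf) auto
    also have "\<dots> = (expect \<rho> (?v (?g z)) + expect \<rho> (?B (?g z))) + ?E z"
      by (simp add: expectation_add_pmf)
    finally show "expect \<rho> (\<lambda>x0. bv wD (bD z) H 0 x0) \<le> \<dots>" .
  qed
  also have "\<dots> = expect ?q (\<lambda>g. expect \<rho> (?v g)) + expect ?q (\<lambda>g. expect \<rho> (?B g))
      + real H * ((real H + 1) * cap) * (\<integral>z. excess z \<partial>wtd_noise H)"
    unfolding expectation_greedy_pmf
    by (subst Bochner_Integration.integral_add, intro Bochner_Integration.integrable_add greedy_int, intro integrable_mult_right integrable_excess,
        subst Bochner_Integration.integral_add, rule greedy_int, rule greedy_int, simp)
  also have "\<dots> \<le> expect ?q (\<lambda>g. expect \<rho> (?v g)) + expect ?q (\<lambda>g. expect \<rho> (?B g))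
      + real H * ((real H + 1) * cap) * (real (card (sa_space H :: ('x, 'a) sa set)) * exp (- \<kappa>\<^sup>2 / 2))"
    using \<beta> by (intro add_left_mono mult_left_mono integral_excess_le) auto
  finally show ?thesis
    by (simp add: expectation_episode_pmf[where Q = "greedy_pmf H (real H) \<sigma> \<sigma>0 sel", OF finite_greedy_pmf])
qed

end

subsection \<open>Counting visits\<close>

lemma rollout_steps: "\<tau> \<in> set_pmf (rollout P \<pi> k h x) \<Longrightarrow> map (\<lambda>t. fst (fst t)) \<tau> = [h..<h + k]"
proof (induction k arbitrary: h x \<tau>)
  case (Suc k)
  then show ?case by (auto simp: upt_rec[of h])
qed simp

lemma size_buffer_append_distinct:
  assumes "distinct (map fst \<tau>)"
  shows "size (buffer (D @ \<tau>) s) = size (buffer D s) + (if s \<in> fst ` set \<tau> then 1 else 0)"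
proof -
  have "size (buffer \<tau> s) = (if s \<in> fst ` set \<tau> then 1 else 0)"
    using assms by (induction \<tau>) (auto simp: image_iff)
  then show ?thesis by simp
qed

lemma sum_layer_size_buffer:
  fixes D :: "('x::finite, 'a::finite) transition list"
  shows "(\<Sum>xa\<in>UNIV. real (size (buffer D (h, xa)))) = real (count_list (map (\<lambda>t. fst (fst t)) D) h)"
proof (induction D)
  case (Cons t D)
  obtain h' xa' y where t: "t = ((h', xa'), y)" by (metis prod.collapse)
  have "(\<Sum>xa\<in>UNIV. real (size (buffer (t # D) (h, xa)))) =
      (\<Sum>xa\<in>UNIV. real (size (buffer D (h, xa))) + (if h' = h \<and> xa = xa' then 1 else 0))"
    by (intro sum.cong) (auto simp: t)
  with Cons show ?case by (auto simp: sum.distrib t)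
qed simp

text \<open>The (j+1)-st visit to a triple is charged \<open>f j\<close>, where \<open>j\<close> is
  the number of earlier visits.\<close>

definition potential :: "nat \<Rightarrow> (nat \<Rightarrow> real) \<Rightarrow> ('x::finite, 'a::finite) transition list \<Rightarrow> real" where
  "potential H f D = (\<Sum>s\<in>sa_space H. \<Sum>j<size (buffer D s). f j)"

text \<open>The triples of an episode are distinct, as they lie in different layers. The buffer size
  at the start of the episode is therefore still current at the moment of the visit, and the
  increment is exact.\<close>

lemma potential_append:
  fixes D :: "('x::finite, 'a::finite) transition list"
  assumes "map (\<lambda>t. fst (fst t)) \<tau> = [0..<H]"
  shows "potential H f (D @ \<tau>) = potential H f D + (\<Sum>t\<leftarrow>\<tau>. f (size (buffer D (fst t))))"
proof -
  have "map (\<lambda>t. fst (fst t)) \<tau> = map fst (map fst \<tau>)" by simp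
  with assms have "distinct (map fst (map fst \<tau>))" by (metis distinct_upt)
  then have d: "distinct (map fst \<tau>)" using distinct_map by blast
  have "h < H" if "t \<in> set \<tau>" "fst (fst t) = h" for t h
  proof -
    have "h \<in> set (map (\<lambda>t. fst (fst t)) \<tau>)" using that by auto
    then show ?thesis unfolding assms by simp
  qed
  then have sub: "fst ` set \<tau> \<subseteq> sa_space H" by (auto simp: sa_space_def)
  have "potential H f (D @ \<tau>) = (\<Sum>s\<in>sa_space H. (\<Sum>j<size (buffer D s). f j) + (if s \<in> fst ` set \<tau> then f (size (buffer D s)) else 0))"
    unfolding potential_def size_buffer_append_distinct[OF d] by (intro sum.cong) auto
  also have "\<dots> = potential H f D + (\<Sum>s\<in>fst ` set \<tau>. f (size (buffer D s)))"
    using sub by (simp add: sum.distrib potential_def sum.inter_restrict[symmetric] Int_absorb1)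
  also have "(\<Sum>s\<in>fst ` set \<tau>. f (size (buffer D s))) = (\<Sum>s\<leftarrow>map fst \<tau>. f (size (buffer D s)))"
    using d by (subst sum_list_distinct_conv_sum_set) simp_all
  finally show ?thesis by (simp add: o_def)
qed

section \<open>Elementary sums over visit counts\<close>

lemma sum_inverse_sqrt_le:
  assumes "1 \<le> b"
  shows "(\<Sum>j<N. 1 / sqrt (real j + b)) \<le> 2 * sqrt (real N)"
proof (induction N)
  case (Suc N)
  have "1 / sqrt (real N + b) \<le> 1 / sqrt (real N + 1)"
    using assms by (intro divide_left_mono mult_pos_pos) auto
  also have "\<dots> \<le> 2 * (sqrt (real N + 1) - sqrt (real N))"
  proof -
    let ?a = "sqrt (real N)" and ?b = "sqrt (real N + 1)"
    have b: "0 < ?b" by simp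
    have "0 \<le> (?b - ?a)\<^sup>2" by simp
    moreover have "?b\<^sup>2 = real N + 1" "?a\<^sup>2 = real N" by simp_all
    ultimately have "1 \<le> 2 * (?b - ?a) * ?b"
      by (simp add: power2_eq_square algebra_simps)
    then show ?thesis using b by (simp add: divide_le_eq)
  qed
  finally show ?case using Suc by (simp add: add.commute)
qed simp

text \<open>Starting at 2 makes the sum telescope against \<open>ln (N + 2) - ln (N + 1)\<close>
  with no additive constant; \<open>\<beta> \<ge> 3\<close> provides this start.\<close>

lemma sum_inverse_le_ln:
  assumes "2 \<le> b"
  shows "(\<Sum>j<N. 1 / (real j + b)) \<le> ln (1 + real N)"
proof (induction N)
  case (Suc N)
  have "1 / (real N + b) \<le> 1 / (real N + 2)"
    using assms by (intro divide_left_mono mult_pos_pos) auto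
  also have "\<dots> = 1 - (real N + 1) / (real N + 2)" by (simp add: field_simps)
  also have "\<dots> \<le> - ln ((real N + 1) / (real N + 2))"
    using ln_le_minus_one[of "(real N + 1) / (real N + 2)"] by simp
  also have "\<dots> = ln (real N + 2) - ln (real N + 1)" by (simp add: ln_div)
  finally show ?case using Suc by (simp add: add_ac)
qed simp

lemma sum_sqrt_le:
  fixes c :: "'c::finite \<Rightarrow> real"
  assumes "\<And>i. 0 \<le> c i"
  shows "(\<Sum>i\<in>UNIV. sqrt (c i)) \<le> sqrt (real CARD('c) * sum c UNIV)"
proof (rule real_le_rsqrt)
  have "(\<Sum>i\<in>UNIV. sqrt (c i) * 1)\<^sup>2 \<le> (\<Sum>i\<in>UNIV. (sqrt (c i))\<^sup>2) * (\<Sum>i\<in>(UNIV :: 'c set). 1\<^sup>2)"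
    by (rule Cauchy_Schwarz_ineq_sum)
  then show "(\<Sum>i\<in>UNIV. sqrt (c i))\<^sup>2 \<le> real CARD('c) * sum c UNIV"
    using assms by (simp add: mult.commute)
qed

text \<open>Jensen for the logarithm, by its tangent at the average \<open>y\<close> of the terms
  \<open>1 + c i\<close>; the linear deviations sum to 0.\<close>

lemma sum_ln_le:
  fixes c :: "'c::finite \<Rightarrow> real"
  assumes c: "\<And>i. 0 \<le> c i"
  defines "K \<equiv> real CARD('c)"
  shows "(\<Sum>i\<in>UNIV. ln (1 + c i)) \<le> K * ln (1 + sum c UNIV / K)"
proof -
  define y where "y = 1 + sum c UNIV / K"
  have K: "0 < K" by (simp add: K_def)
  have y: "1 \<le> y" using K c by (simp add: y_def sum_nonneg)
  have "ln (1 + c i) \<le> ln y + ((1 + c i) / y - 1)" for i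
  proof -
    have "ln ((1 + c i) / y) \<le> (1 + c i) / y - 1"
      using c[of i] y by (intro ln_le_minus_one divide_pos_pos) auto
    then show ?thesis using c[of i] y by (simp add: ln_div)
  qed
  then have "(\<Sum>i\<in>UNIV. ln (1 + c i)) \<le> (\<Sum>i\<in>UNIV. ln y + ((1 + c i) / y - 1))"
    by (intro sum_mono)
  also have "\<dots> = K * ln y + ((K + sum c UNIV) / y - K)"
    by (simp add: sum.distrib sum_subtractf sum_divide_distrib[symmetric] K_def)
  also have "K + sum c UNIV = K * y" using K by (simp add: y_def distrib_left)
  finally show ?thesis using y by (simp add: y_def)
qed

text \<open>Every layer receives exactly \<open>L\<close> visits, so concavity is used layer by
  layer over its |X| |A| triples, and the layers add up to the factor \<open>H\<close>.\<close>

lemma potential_le: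
  fixes D :: "('x::finite, 'a::finite) transition list"
  assumes count: "\<And>h. h < H \<Longrightarrow> count_list (map (\<lambda>t. fst (fst t)) D) h = L"
    and b: "2 \<le> b" and c: "0 \<le> c1" "0 \<le> c2"
  defines "K \<equiv> real CARD('x) * real CARD('a)"
  shows "potential H (\<lambda>j. c1 / sqrt (real j + b) + c2 * (b / (real j + b))) D
    \<le> real H * (c1 * (2 * sqrt (K * real L)) + c2 * b * (K * ln (1 + real L / K)))"
proof -
  let ?f = "\<lambda>j. c1 / sqrt (real j + b) + c2 * (b / (real j + b))"
  let ?n = "\<lambda>h xa. real (size (buffer D (h, xa)))"
  have card: "real CARD('x \<times> 'a) = K" by (simp add: K_def)
  have F: "(\<Sum>j<N. ?f j) \<le> c1 * (2 * sqrt (real N)) + c2 * b * ln (1 + real N)" for N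
  proof -
    have "(\<Sum>j<N. ?f j) = c1 * (\<Sum>j<N. 1 / sqrt (real j + b)) + c2 * b * (\<Sum>j<N. 1 / (real j + b))"
      by (simp add: sum.distrib sum_distrib_left)
    also have "\<dots> \<le> c1 * (2 * sqrt (real N)) + c2 * b * ln (1 + real N)"
      using b c by (intro add_mono mult_left_mono sum_inverse_sqrt_le sum_inverse_le_ln) auto
    finally show ?thesis .
  qed
  have "potential H ?f D = (\<Sum>h<H. \<Sum>xa\<in>UNIV. \<Sum>j<size (buffer D (h, xa)). ?f j)"
    unfolding potential_def sa_space_def by (simp add: sum.cartesian_product)
  also have "\<dots> \<le> (\<Sum>h<H. c1 * (2 * sqrt (K * real L)) + c2 * b * (K * ln (1 + real L / K)))"
  proof (intro sum_mono)
    fix h assume "h \<in> {..<H}"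
    then have L: "(\<Sum>xa\<in>UNIV. ?n h xa) = real L" unfolding sum_layer_size_buffer using count by simp
    have "(\<Sum>xa\<in>UNIV. \<Sum>j<size (buffer D (h, xa)). ?f j) \<le> (\<Sum>xa\<in>UNIV. c1 * (2 * sqrt (?n h xa)) + c2 * b * ln (1 + ?n h xa))"
      by (intro sum_mono F)
    also have "\<dots> = c1 * (2 * (\<Sum>xa\<in>UNIV. sqrt (?n h xa))) + c2 * b * (\<Sum>xa\<in>UNIV. ln (1 + ?n h xa))"
      by (simp add: sum.distrib sum_distrib_left)
    also have "\<dots> \<le> c1 * (2 * sqrt (K * real L)) + c2 * b * (K * ln (1 + real L / K))"
      using sum_sqrt_le[of "?n h"] sum_ln_le[of "?n h"] b c unfolding L card
      by (intro add_mono mult_left_mono) auto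
    finally show "(\<Sum>xa\<in>UNIV. \<Sum>j<size (buffer D (h, xa)). ?f j) \<le> c1 * (2 * sqrt (K * real L)) + c2 * b * (K * ln (1 + real L / K))" .
  qed
  finally show ?thesis by simp
qed

section \<open>Arithmetic of the final bound\<close>

lemma log_plus_ge: "1 \<le> log_plus x" "ln x \<le> log_plus x"
  by (simp_all add: log_plus_def)

text \<open>If the bound is smaller than the trivial bound \<open>H L\<close>, then \<open>\<surd>L\<close> exceeds \<open>5 H \<surd>(\<beta> K l) \<Lambda>\<close>, which
  makes the terms of lower order in \<open>L\<close> small compared to the leading one.\<close>
lemma regret_arithmetic:
  fixes H \<beta> K L l \<Lambda> R :: real
  assumes H: "1 \<le> H" and \<beta>: "3 \<le> \<beta>" and K: "1 \<le> K" and L: "1 \<le> L" and l: "1 \<le> l" and \<Lambda>: "1 \<le> \<Lambda>"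
    and triv: "R \<le> H * L"
    and R: "R \<le> H * ((sqrt (2 * l) * sqrt 6 * H) * (2 * sqrt (K * L)) + (H + H * (sqrt 6 * H / sqrt \<beta>) * sqrt (2 * l)) * \<beta> * (K * \<Lambda>))
      + H * ((H + 1) * (sqrt 6 * H / sqrt \<beta>)) / 2"
  shows "R \<le> 5 * H\<^sup>2 * sqrt (\<beta> * K * L * l) * \<Lambda>"
proof (cases "H * L \<le> 5 * H\<^sup>2 * sqrt (\<beta> * K * L * l) * \<Lambda>")
  case True
  with triv show ?thesis by simp
next
  case False
  define a b e r where "a = sqrt K" and "b = sqrt \<beta>" and "e = sqrt l" and "r = sqrt L"
  have sq: "K = a\<^sup>2" "\<beta> = b\<^sup>2" "l = e\<^sup>2" "L = r\<^sup>2"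
    using K \<beta> l L by (simp_all add: a_def b_def e_def r_def)
  have a: "1 \<le> a" and e: "1 \<le> e" and r: "1 \<le> r" using K l L by (simp_all add: a_def e_def r_def)
  have b: "sqrt 3 \<le> b" using \<beta> by (simp add: b_def)
  have s3: "1 \<le> sqrt 3" "sqrt 3 * sqrt 3 = (3::real)" by simp_all
  have b1: "1 \<le> b" using b s3 by linarith
  \<comment> \<open>The target is \<open>5 * W\<close>. The terms \<open>T1\<close> to
    \<open>T4\<close> below receive the shares 4, 1/5, 2/5 and 2/5.\<close>
  define W where "W = H\<^sup>2 * (b * a * r * e) * \<Lambda>"
  have rW: "sqrt (\<beta> * K * L * l) = b * a * r * e"
    by (simp add: a_def b_def e_def r_def real_sqrt_mult)
  have pos: "0 < H" "0 < a" "0 < b" "0 < e" "0 < r" "0 < \<Lambda>" using H a b1 e r \<Lambda> by simp_all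
  have "5 * (H\<^sup>2 * (b * a * r * e) * \<Lambda>) < H * r\<^sup>2"
    using False unfolding rW by (simp add: sq)
  then have "(H * r) * (5 * (H * (b * a * e) * \<Lambda>)) < (H * r) * r"
    by (simp add: power2_eq_square mult_ac)
  then have small: "5 * (H * (b * a * e) * \<Lambda>) < r"
    using pos by (simp only: mult_less_cancel_left_pos[OF mult_pos_pos[OF pos(1) pos(5)]])
  have s12: "sqrt 6 * sqrt 2 = 2 * sqrt (3::real)"
    by (simp add: real_sqrt_mult[symmetric] real_sqrt_mult[of 4 3, simplified])
  have sqrt_l: "sqrt (2 * l) = sqrt 2 * e" by (simp add: e_def real_sqrt_mult)
  have sqrt_KL: "sqrt (K * L) = a * r" by (simp add: a_def r_def real_sqrt_mult)
  have T1: "H * ((sqrt (2 * l) * sqrt 6 * H) * (2 * sqrt (K * L))) \<le> 4 * W"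
  proof -
    have "H * ((sqrt (2 * l) * sqrt 6 * H) * (2 * sqrt (K * L))) = 2 * H\<^sup>2 * (sqrt 6 * sqrt 2) * (a * r * e)"
      unfolding sqrt_l sqrt_KL by (simp add: power2_eq_square)
    also have "\<dots> = 4 * H\<^sup>2 * (a * r * e) * sqrt 3" unfolding s12 by simp
    \<comment> \<open>The hypothesis \<open>3 \<le> \<beta>\<close> lets \<open>sqrt \<beta>\<close>
      absorb the \<open>sqrt 3\<close> left over from \<open>sqrt 6 * sqrt 2\<close>.\<close>
    also have "\<dots> \<le> 4 * H\<^sup>2 * (a * r * e) * (b * \<Lambda>)"
    proof (rule mult_left_mono)
      have "sqrt 3 * 1 \<le> b * \<Lambda>" using b \<Lambda> pos by (intro mult_mono) auto
      then show "sqrt 3 \<le> b * \<Lambda>" by simp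
    qed (use pos in auto)
    finally show ?thesis by (simp add: W_def mult_ac)
  qed
  have T2: "H * (H * \<beta> * (K * \<Lambda>)) \<le> W / 5"
  proof -
    have "5 * (H * (b * a) * \<Lambda>) \<le> 5 * (H * (b * a * e) * \<Lambda>)"
      using pos e by simp
    with small have "5 * (H * (b * a) * \<Lambda>) \<le> r" by simp
    then have "(H * b * a) * (5 * (H * (b * a) * \<Lambda>)) \<le> (H * b * a) * r"
      using pos by (intro mult_left_mono) auto
    also have "\<dots> \<le> (H * b * a) * r * (H * e * \<Lambda>)"
    proof -
      have "1 * 1 \<le> H * e" using H e by (intro mult_mono) auto
      then have "1 * 1 \<le> H * e * \<Lambda>" using \<Lambda> pos by (intro mult_mono) auto
      then have "(H * b * a) * r * 1 \<le> (H * b * a) * r * (H * e * \<Lambda>)"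
        using pos by (intro mult_left_mono) auto
      then show ?thesis by simp
    qed
    finally show ?thesis by (simp add: W_def sq power2_eq_square mult_ac)
  qed
  have T3: "H * (H * (sqrt 6 * H / sqrt \<beta>) * sqrt (2 * l) * \<beta> * (K * \<Lambda>)) \<le> 2 / 5 * W"
  proof -
    have "H * (H * (sqrt 6 * H / sqrt \<beta>) * sqrt (2 * l) * \<beta> * (K * \<Lambda>)) = (sqrt 6 * sqrt 2) * (H\<^sup>2 * a) * (H * (b * a * e) * \<Lambda>)"
      unfolding sqrt_l b_def[symmetric] using pos by (simp add: sq power2_eq_square)
    also have "\<dots> = 2 * sqrt 3 * (H\<^sup>2 * a) * (H * (b * a * e) * \<Lambda>)" unfolding s12 ..
    also have "\<dots> \<le> 2 * b * (H\<^sup>2 * a) * (r / 5)"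
      using small b pos by (intro mult_mono) auto
    also have "\<dots> \<le> 2 * b * (H\<^sup>2 * a) * (r / 5) * (e * \<Lambda>)"
    proof -
      have "1 * 1 \<le> e * \<Lambda>" using e \<Lambda> by (intro mult_mono) auto
      then have "2 * b * (H\<^sup>2 * a) * (r / 5) * 1 \<le> 2 * b * (H\<^sup>2 * a) * (r / 5) * (e * \<Lambda>)"
        using pos by (intro mult_left_mono) auto
      then show ?thesis by simp
    qed
    finally show ?thesis by (simp add: W_def mult_ac)
  qed
  have T4: "H * ((H + 1) * (sqrt 6 * H / sqrt \<beta>)) / 2 \<le> 2 / 5 * W"
  proof -
    have "sqrt 6 = sqrt 2 * sqrt 3" by (simp add: real_sqrt_mult[symmetric])
    also have "\<dots> \<le> 2 * b" using b pos sqrt2_less_2 by (intro mult_mono) auto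
    finally have "sqrt 6 / b \<le> 2" using pos by (simp add: divide_le_eq)
    then have le: "(sqrt 6 / b) * (H * H) \<le> 2 * (H * H)" by (rule mult_right_mono) simp
    have "H * ((H + 1) * (sqrt 6 * H / sqrt \<beta>)) / 2 = (sqrt 6 / b) * (H * H) * ((H + 1) / 2)"
      by (simp add: b_def)
    also have "\<dots> \<le> 2 * (H * H) * H"
      using H pos by (intro mult_mono[OF le]) auto
    also have "\<dots> = 2 * H\<^sup>2 * H" by (simp add: power2_eq_square)
    \<comment> \<open>This term is cubic in \<open>H\<close> and free of \<open>L\<close>;
      \<open>small\<close> implies \<open>H \<le> r / 5\<close>, which trades the surplus factor
      \<open>H\<close> for \<open>sqrt L\<close>.\<close>
    also have "\<dots> \<le> 2 * H\<^sup>2 * (r / 5)"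
    proof (rule mult_left_mono)
      have "1 * 1 \<le> b * a" using b1 a by (intro mult_mono) auto
      then have "1 * 1 \<le> b * a * e" using e pos by (intro mult_mono) auto
      then have "1 * 1 \<le> (b * a * e) * \<Lambda>" using \<Lambda> pos by (intro mult_mono) auto
      then have "H * 1 \<le> H * ((b * a * e) * \<Lambda>)" using pos by (intro mult_left_mono) auto
      with small show "H \<le> r / 5" by (simp add: mult.assoc)
    qed simp
    also have "\<dots> \<le> 2 * H\<^sup>2 * (r / 5) * (b * a * e * \<Lambda>)"
    proof -
      have "1 * 1 \<le> b * a" using b1 a by (intro mult_mono) auto
      then have "1 * 1 \<le> b * a * e" using e pos by (intro mult_mono) auto
      then have "1 * 1 \<le> (b * a * e) * \<Lambda>" using \<Lambda> pos by (intro mult_mono) auto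
      then have "2 * H\<^sup>2 * (r / 5) * 1 \<le> 2 * H\<^sup>2 * (r / 5) * (b * a * e * \<Lambda>)"
        using pos by (intro mult_left_mono) auto
      then show ?thesis by simp
    qed
    finally show ?thesis by (simp add: W_def mult_ac)
  qed
  have "R \<le> H * ((sqrt (2 * l) * sqrt 6 * H) * (2 * sqrt (K * L))) + H * (H * \<beta> * (K * \<Lambda>))
      + H * (H * (sqrt 6 * H / sqrt \<beta>) * sqrt (2 * l) * \<beta> * (K * \<Lambda>)) + H * ((H + 1) * (sqrt 6 * H / sqrt \<beta>)) / 2"
    using R by (simp only: distrib_left distrib_right)
  with T1 T2 T3 T4 have "R \<le> 4 * W + W / 5 + 2 / 5 * W + 2 / 5 * W" by linarith
  then show ?thesis unfolding rW by (simp add: W_def mult_ac)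
qed

subsection \<open>Regret of a run\<close>

lemma count_list_upt: "count_list [0..<H] h = (if h < H then 1 else 0)"
  by (induction H) auto

lemma count_list_hist:
  fixes M :: "('x::finite, 'a::finite) transition list \<Rightarrow> ('x, 'a) model"
  assumes "es \<in> set_pmf (run_pmf H \<rho> Q M l)" "h < H"
  shows "count_list (map (\<lambda>t. fst (fst t)) (hist es)) h = l"
  using assms(1)
proof (induction l arbitrary: es)
  case (Suc l)
  then obtain es' g x0 \<tau> where es: "es' \<in> set_pmf (run_pmf H \<rho> Q M l)" "es = es' @ [(g, x0, \<tau>)]"
    and \<tau>: "\<tau> \<in> set_pmf (rollout (M (hist es')) (determ g) H 0 x0)"
    by (auto simp: episode_pmf_def)
  have "map (\<lambda>t. fst (fst t)) \<tau> = [0..<H]" using rollout_steps[OF \<tau>] by simp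
  then show ?case using Suc.IH[OF es(1)] es(2) assms(2) by (simp add: count_list_upt)
qed simp

text \<open>The Bellman recursion replaces the supremum over all policies: it bounds the optimal
  value and is measurable in the model, being built from finite sums and maxima.\<close>

definition gap :: "nat \<Rightarrow> ('x::finite, 'a::finite) episode \<Rightarrow> ('x, 'a) model \<Rightarrow> real" where
  "gap H e P = model_bv P H 0 (fst (snd e)) - val H P (determ (fst e)) 0 (fst (snd e))"

lemma gap_nonneg: "0 \<le> gap H e P"
  using rollout_value_le_bv[of P "determ (fst e)" H 0 "fst (snd e)"] by (simp add: gap_def val_def)

lemma measurable_gap: "gap H e \<in> borel_measurable (model_space H)"
  for e :: "('x::finite, 'a::finite) episode"
proof -
  have 1: "(\<lambda>P :: ('x, 'a) model. model_bv P H 0 (fst (snd e))) \<in> borel_measurable (model_space H)"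
    by (intro measurable_bv measurable_pmf_outcome_pmf) (auto simp: sa_space_def)
  have 2: "(\<lambda>P. val H P (determ (fst e)) 0 (fst (snd e))) \<in> borel_measurable (model_space H)"
    by (rule measurable_val)
  have "gap H e = (\<lambda>P. model_bv P H 0 (fst (snd e)) - val H P (determ (fst e)) 0 (fst (snd e)))"
    by (simp add: gap_def fun_eq_iff)
  then show ?thesis using borel_measurable_diff[OF 1 2] by simp
qed

lemma total_reward_nonneg: "0 \<le> total_reward \<tau>"
  by (induction \<tau>) (auto simp: total_reward_def case_prod_unfold)

lemma gap_le: "gap H e P \<le> real H"
  for P :: "('x::finite, 'a::finite) model"
proof -
  have "0 \<le> val H P (determ (fst e)) 0 (fst (snd e))"
    unfolding val_def by (intro integral_nonneg_AE) (simp add: total_reward_nonneg)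
  moreover have "model_bv P H 0 (fst (snd e)) \<le> real H"
    using bv_true_bounds[of 0 H "\<lambda>s. pmf (outcome_pmf (P s))" P "\<lambda>_. 0"] by simp
  ultimately show ?thesis by (simp add: gap_def)
qed

lemma abs_gap_le: "\<bar>gap H e P\<bar> \<le> real H"
  for P :: "('x::finite, 'a::finite) model"
  using gap_nonneg[of H e P] gap_le[of H e P] by simp

definition run_gap :: "nat \<Rightarrow> ('x::finite, 'a::finite) episode list \<Rightarrow> ('x, 'a) model \<Rightarrow> real" where
  "run_gap H es P = (\<Sum>e\<leftarrow>es. gap H e P)"

lemma run_gap_snoc [simp]: "run_gap H (es @ [e]) P = run_gap H es P + gap H e P"
  by (simp add: run_gap_def)

lemma measurable_run_gap: "run_gap H es \<in> borel_measurable (model_space H)"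
proof -
  have "(\<lambda>P. \<Sum>e\<leftarrow>es. gap H e P) \<in> borel_measurable (model_space H)"
  proof (induction es)
    case (Cons e es)
    then show ?case using borel_measurable_add[OF measurable_gap[of H e] Cons] by simp
  qed simp
  moreover have "run_gap H es = (\<lambda>P. \<Sum>e\<leftarrow>es. gap H e P)" by (simp add: run_gap_def fun_eq_iff)
  ultimately show ?thesis by simp
qed

lemma run_gap_bounds: "0 \<le> run_gap H es P" "run_gap H es P \<le> real H * real (length es)"
proof (induction es)
  case (Cons e es)
  { case 1 show ?case using Cons gap_nonneg[of H e P] by (simp add: run_gap_def) }
  { case 2 show ?case using Cons gap_le[of H e P] by (simp add: run_gap_def algebra_simps) }
qed (simp_all add: run_gap_def)

lemma cum_regret_le_run_gap: "cum_regret H P es \<le> run_gap H es P"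
  for P :: "('x::finite, 'a::finite) model"
proof (induction es)
  case (Cons e es)
  then show ?case
    using opt_val_le_bv[of H P "fst (snd e)"] by (simp add: cum_regret_def run_gap_def gap_def case_prod_unfold)
qed (simp add: cum_regret_def run_gap_def)

context
  fixes H :: nat and \<beta> \<sigma> \<sigma>0 \<kappa> :: real
    and \<alpha> :: "('x::finite, 'a::finite) model" and sel :: "('x, 'a) tie_rule" and \<rho> :: "'x pmf"
  assumes H: "0 < H" and \<alpha>_nonneg: "\<And>s y. s \<in> sa_space H \<Longrightarrow> 0 \<le> \<alpha> s y"
    and \<alpha>_sum: "\<And>s. s \<in> sa_space H \<Longrightarrow> sum (\<alpha> s) UNIV = \<beta>"
    and \<beta>: "3 \<le> \<beta>" and \<sigma>: "0 < \<sigma>" "0 < \<sigma>0" "\<sigma>\<^sup>2 = 3 * (real H)\<^sup>2" and ratio: "\<sigma>\<^sup>2 / \<sigma>0\<^sup>2 = \<beta>"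
    and \<kappa>: "1 \<le> \<kappa>"
    and sel: "\<And>D h x S. S \<noteq> {} \<Longrightarrow> sel D h x S \<in> S"
  fixes err :: real
  defines "err \<equiv> real H * ((real H + 1) * (sqrt 6 * real H / sqrt \<beta>)) * (real (card (sa_space H :: ('x, 'a) sa set)) * exp (- \<kappa>\<^sup>2 / 2))"
begin

private abbreviation (input) mcap where "mcap \<equiv> sqrt 6 * real H / sqrt \<beta>"
private abbreviation (input) Q where "Q \<equiv> greedy_pmf H (real H) \<sigma> \<sigma>0 sel"
private abbreviation (input) f where
  "f \<equiv> \<lambda>j. (\<kappa> * sqrt 6 * real H) / sqrt (real j + \<beta>) + (real H + real H * mcap * \<kappa>) * (\<beta> / (real j + \<beta>))"
private abbreviation (input) mean_run where
  "mean_run \<equiv> run_pmf H \<rho> Q (\<lambda>D. mean_model (posterior D \<alpha>))"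
private abbreviation (input) total where
  "total l \<equiv> \<integral>P. expect (run_pmf H \<rho> Q (\<lambda>_. P) l) (\<lambda>es. run_gap H es P) \<partial>dirichlet_prior H \<alpha>"

lemma admissible_\<alpha>: "admissible H \<alpha>"
  using \<alpha>_nonneg \<alpha>_sum \<beta> by (simp add: admissible_def)

lemma integrable_run_gap:
  "integrable (dirichlet_prior H \<alpha>) (\<lambda>P. expect (run_pmf H \<rho> Q (\<lambda>_. P) l) (\<lambda>es. run_gap H es P))"
proof (intro integrable_bounded_prior[OF admissible_\<alpha>, of _ "real H * real l"] measurable_expectation_run measurable_run_gap abs_expectation_pmf_le finite_run_pmf finite_greedy_pmf)
  fix P es assume "es \<in> set_pmf (run_pmf H \<rho> Q (\<lambda>_. P) l)"
  then have "length es = l" by (rule length_run_pmf[OF finite_greedy_pmf])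
  then show "\<bar>run_gap H es P\<bar> \<le> real H * real l" using run_gap_bounds[of H es P] by simp
qed

lemma total_le_trivial: "total l \<le> real H * real l"
proof -
  interpret prob_space "dirichlet_prior H \<alpha>" by (rule prob_space_dirichlet_prior[OF admissible_\<alpha>])
  have "total l \<le> (\<integral>P. real H * real l \<partial>dirichlet_prior H \<alpha>)"
  proof (intro integral_mono integrable_run_gap)
    fix P :: "('x, 'a) model"
    have "expect (run_pmf H \<rho> Q (\<lambda>_. P) l) (\<lambda>es. run_gap H es P)
      \<le> expect (run_pmf H \<rho> Q (\<lambda>_. P) l) (\<lambda>_. real H * real l)"
    proof (intro expectation_mono_pmf finite_run_pmf finite_greedy_pmf)
      fix es assume "es \<in> set_pmf (run_pmf H \<rho> Q (\<lambda>_. P) l)"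
      then have "length es = l" by (rule length_run_pmf[OF finite_greedy_pmf])
      then show "run_gap H es P \<le> real H * real l" using run_gap_bounds[of H es P] by simp
    qed
    then show "expect (run_pmf H \<rho> Q (\<lambda>_. P) l) (\<lambda>es. run_gap H es P) \<le> real H * real l" by simp
  qed simp
  then show ?thesis using prob_space by simp
qed

text \<open>Each episode is bounded given the data before it. Its bonuses, taken along a rollout of
  the posterior mean model, are exactly the increment of the potential under the predictive
  process.\<close>

lemma total_le_potential:
  "total l \<le> expect (mean_run l) (\<lambda>es. potential H f (hist es)) + real l * err"
proof (induction l)
  case 0
  show ?case by (simp add: run_gap_def potential_def)
next
  case (Suc l)
  let ?E = "\<lambda>D P. expect (episode_pmf H \<rho> (Q D) P)"
  have fin: "finite (set_pmf (run_pmf H \<rho> Q N l))" "finite (set_pmf (episode_pmf H \<rho> (Q D) P))" for N D P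
    by (intro finite_run_pmf finite_episode_pmf finite_greedy_pmf)+
  have gap_bd: "\<bar>?E D P (\<lambda>e. gap H e P)\<bar> \<le> real H" for D P
    by (intro abs_expectation_pmf_le fin abs_gap_le)
  have gap_meas: "(\<lambda>P. ?E D P (\<lambda>e. gap H e P)) \<in> borel_measurable (model_space H)" for D
    by (intro measurable_expectation_episode finite_greedy_pmf measurable_gap)
  have step: "expect (run_pmf H \<rho> Q (\<lambda>_. P) (Suc l)) (\<lambda>es. run_gap H es P) =
     expect (run_pmf H \<rho> Q (\<lambda>_. P) l) (\<lambda>es. run_gap H es P) +
     expect (run_pmf H \<rho> Q (\<lambda>_. P) l) (\<lambda>es. ?E (hist es) P (\<lambda>e. gap H e P))" for P
    unfolding expectation_run_pmf_Suc[where Q = Q, OF finite_greedy_pmf] run_gap_snoc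
    by (simp add: expectation_add_pmf[OF fin(1)] expectation_add_pmf[OF fin(2)])
  have int2: "integrable (dirichlet_prior H \<alpha>) (\<lambda>P. expect (run_pmf H \<rho> Q (\<lambda>_. P) l) (\<lambda>es. ?E (hist es) P (\<lambda>e. gap H e P)))"
    by (intro integrable_bounded_prior[OF admissible_\<alpha>, of _ "real H"] measurable_expectation_run gap_meas abs_expectation_pmf_le[OF fin(1)] gap_bd finite_greedy_pmf)
  let ?Z = "\<integral>P. expect (run_pmf H \<rho> Q (\<lambda>_. P) l) (\<lambda>es. ?E (hist es) P (\<lambda>e. gap H e P)) \<partial>dirichlet_prior H \<alpha>"
  let ?Y = "expect (mean_run l) (\<lambda>es. ?E (hist es) (mean_model (posterior (hist es) \<alpha>)) (\<lambda>e. \<Sum>t\<leftarrow>snd (snd e). f (size (buffer (hist es) (fst t)))))"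
  let ?A = "\<lambda>l. expect (mean_run l) (\<lambda>es. potential H f (hist es))"
  have c1: "total (Suc l) = total l + ?Z"
    unfolding step by (intro Bochner_Integration.integral_add integrable_run_gap int2)
  have "?Z
     = expect (mean_run l) (\<lambda>es. \<integral>P. ?E (hist es) P (\<lambda>e. gap H e P) \<partial>dirichlet_prior H (posterior (hist es) \<alpha>))"
    by (intro integral_prior_run[where C = "real H"] finite_greedy_pmf admissible_\<alpha> gap_meas gap_bd)
  also have "\<dots> \<le> expect (mean_run l) (\<lambda>es. ?E (hist es) (mean_model (posterior (hist es) \<alpha>)) (\<lambda>e. \<Sum>t\<leftarrow>snd (snd e). f (size (buffer (hist es) (fst t)))) + err)"
  proof (intro expectation_mono_pmf fin)
    fix es :: "('x, 'a) episode list"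
    let ?D = "hist es"
    have adm: "admissible H (posterior ?D \<alpha>)" by (intro admissible_posterior admissible_\<alpha>)
    have gap_int: "integrable (dirichlet_prior H (posterior ?D \<alpha>)) (gap H e)" for e
      by (intro integrable_bounded_prior[OF adm, of _ "real H"] measurable_gap abs_gap_le)
    \<comment> \<open>The gap of an episode ignores its trajectory, so the empty list stands for
      it.\<close>
    have rho_int: "integrable (dirichlet_prior H (posterior ?D \<alpha>)) (\<lambda>P. expect \<rho> (\<lambda>x0. gap H (g, x0, []) P))" for g
      by (intro integrable_bounded_prior[OF adm, of _ "real H"] measurable_expectation_pmf measurable_gap abs_expectation_pmf_le abs_gap_le) auto
    have "?E ?D P (\<lambda>e. gap H e P) = expect (Q ?D) (\<lambda>g. expect \<rho> (\<lambda>x0. gap H (g, x0, []) P))" for P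
      unfolding expectation_episode_pmf[where Q = Q, OF finite_greedy_pmf] by (simp add: gap_def)
    then have "(\<integral>P. ?E ?D P (\<lambda>e. gap H e P) \<partial>dirichlet_prior H (posterior ?D \<alpha>))
      = expect (Q ?D) (\<lambda>g. \<integral>P. expect \<rho> (\<lambda>x0. gap H (g, x0, []) P) \<partial>dirichlet_prior H (posterior ?D \<alpha>))"
      by (simp add: integral_expectation_pmf_swap[OF finite_greedy_pmf rho_int])
    also have "\<dots> = expect (Q ?D) (\<lambda>g. expect \<rho> (\<lambda>x0. \<integral>P. gap H (g, x0, []) P \<partial>dirichlet_prior H (posterior ?D \<alpha>)))"
      by (intro Bochner_Integration.integral_cong refl integral_expectation_pmf_swap gap_int) auto
    also have "\<dots> \<le> ?E ?D (mean_model (posterior ?D \<alpha>)) (\<lambda>e. \<Sum>t\<leftarrow>snd (snd e). f (size (buffer ?D (fst t)))) + err"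
      using episode_regret_le[where \<alpha> = \<alpha> and sel = sel and \<rho> = \<rho> and D = ?D, OF H \<alpha>_nonneg \<alpha>_sum \<beta> \<sigma> ratio \<kappa> sel]
      unfolding bonus_def case_prod_unfold err_def gap_def fst_conv snd_conv .
    finally show "(\<integral>P. ?E ?D P (\<lambda>e. gap H e P) \<partial>dirichlet_prior H (posterior ?D \<alpha>))
      \<le> ?E ?D (mean_model (posterior ?D \<alpha>)) (\<lambda>e. \<Sum>t\<leftarrow>snd (snd e). f (size (buffer ?D (fst t)))) + err" .
  qed
  also have "\<dots> = ?Y + err"
    by (subst expectation_add_pmf[OF fin(1)]) simp
  finally have c2: "?Z \<le> ?Y + err" .
  have "?A (Suc l) =
      expect (mean_run l) (\<lambda>es. ?E (hist es) (mean_model (posterior (hist es) \<alpha>)) (\<lambda>e. potential H f (hist es) + (\<Sum>t\<leftarrow>snd (snd e). f (size (buffer (hist es) (fst t))))))"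
    unfolding expectation_run_pmf_Suc[where Q = Q, OF finite_greedy_pmf]
  proof (intro expectation_cong_pmf)
    fix es e assume "e \<in> set_pmf (episode_pmf H \<rho> (Q (hist es)) (mean_model (posterior (hist es) \<alpha>)))"
    then obtain g x0 \<tau> where e: "e = (g, x0, \<tau>)"
      and \<tau>: "\<tau> \<in> set_pmf (rollout (mean_model (posterior (hist es) \<alpha>)) (determ g) H 0 x0)"
      by (auto simp: episode_pmf_def)
    have steps: "map (\<lambda>t. fst (fst t)) \<tau> = [0..<H]" using rollout_steps[OF \<tau>] by simp
    show "potential H f (hist (es @ [e])) = potential H f (hist es) + (\<Sum>t\<leftarrow>snd (snd e). f (size (buffer (hist es) (fst t))))"
      unfolding e hist_snoc snd_conv by (rule potential_append[OF steps])
  qed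
  also have "\<dots> = expect (mean_run l) (\<lambda>es. potential H f (hist es) +
      ?E (hist es) (mean_model (posterior (hist es) \<alpha>)) (\<lambda>e. \<Sum>t\<leftarrow>snd (snd e). f (size (buffer (hist es) (fst t)))))"
    unfolding expectation_add_pmf[OF fin(2)] by simp
  also have "\<dots> = ?A l + ?Y" by (rule expectation_add_pmf[OF fin(1)])
  finally have c3: "?A (Suc l) = ?A l + ?Y" .
  have comb: "t' \<le> a' + real (Suc l) * err"
    if "t' = t + z" "z \<le> y + err" "a' = a + y" "t \<le> a + real l * err" for t t' z y a a' :: real
    using that by (simp add: algebra_simps)
  show ?case by (rule comb[OF c1 c2 c3 Suc.IH])
qed

text \<open>Integrability is established for the dominating integrand only. Should the regret fail
  to be integrable, its integral is 0 by convention, which is why the dominating integrand is also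
  shown to be nonnegative.\<close>

lemma bayes_regret_le_total:
  "wtd_bayes_regret H (real H) \<sigma> \<sigma>0 sel \<rho> \<alpha> l \<le> total l"
  unfolding wtd_bayes_regret_def wtd_run_eq
proof (rule integral_mono'[OF integrable_run_gap])
  fix P :: "('x, 'a) model"
  show "expect (run_pmf H \<rho> Q (\<lambda>_. P) l) (cum_regret H P) \<le> expect (run_pmf H \<rho> Q (\<lambda>_. P) l) (\<lambda>es. run_gap H es P)"
    by (intro expectation_mono_pmf finite_run_pmf finite_greedy_pmf cum_regret_le_run_gap)
  show "0 \<le> expect (run_pmf H \<rho> Q (\<lambda>_. P) l) (\<lambda>es. run_gap H es P)"
    by (intro integral_nonneg_AE) (simp add: run_gap_bounds)
qed

lemma total_le:
  defines "K \<equiv> real CARD('x) * real CARD('a)"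
  shows "total l \<le> real H * ((\<kappa> * sqrt 6 * real H) * (2 * sqrt (K * real l)) + (real H + real H * mcap * \<kappa>) * \<beta> * (K * ln (1 + real l / K)))
    + real l * err"
proof -
  have "expect (mean_run l) (\<lambda>es. potential H f (hist es)) \<le>
    expect (mean_run l) (\<lambda>_. real H * ((\<kappa> * sqrt 6 * real H) * (2 * sqrt (K * real l)) + (real H + real H * mcap * \<kappa>) * \<beta> * (K * ln (1 + real l / K))))"
  proof (intro expectation_mono_pmf finite_run_pmf finite_greedy_pmf)
    fix es assume es: "es \<in> set_pmf (mean_run l)"
    show "potential H f (hist es) \<le> real H * ((\<kappa> * sqrt 6 * real H) * (2 * sqrt (K * real l)) + (real H + real H * mcap * \<kappa>) * \<beta> * (K * ln (1 + real l / K)))"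
      unfolding K_def using \<beta> \<kappa> by (intro potential_le count_list_hist[OF es]) auto
  qed
  then show ?thesis using total_le_potential[of l] by simp
qed

end

section \<open>Asymptotic form and conclusion\<close>

lemma card_sa_space: "card (sa_space H :: ('x::finite, 'a::finite) sa set) = H * (CARD('x) * CARD('a))"
  by (simp add: sa_space_def card_cartesian_product)

text \<open>The truncation at 1 pays for the factor 2, because
  \<open>ln 2 < 1 \<le> log_plus y\<close>.\<close>

lemma log_plus_double_le:
  assumes "0 < x" "x \<le> 2 * y"
  shows "log_plus x \<le> 2 * log_plus y"
proof -
  have "ln x \<le> ln (2 * y)" using assms by simp
  also have "\<dots> = ln 2 + ln y" using assms by (intro ln_mult_pos) auto
  also have "\<dots> \<le> 2 * log_plus y"
    using ln_2_less_1 log_plus_ge[of y] by linarith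
  finally show ?thesis using log_plus_ge[of y] by (simp add: log_plus_def)
qed

lemma soft_bigo_regret_bound:
  assumes "0 \<le> \<beta>"
  shows "soft_bigo (regret_bound \<beta>) (\<lambda>H X A L. (real H)\<^sup>2 * sqrt (real X * real A * real L))"
  unfolding soft_bigo_def
proof (intro exI bigoI)
  let ?F = "principal {(H, X, A, L). 0 < H \<and> 0 < X \<and> 0 < A \<and> (0::nat) < (L::nat)}"
  \<comment> \<open>Both logarithms are at most \<open>2 * q\<close>, and the one under the root is
    bounded through \<open>sqrt (2 * q) \<le> 2 * q\<close>. Hence the exponent 2 and the constant
    20 = 5 * 2 * 2.\<close>
  have *: "norm (regret_bound \<beta> H X A L) \<le> (20 * sqrt \<beta>) * norm ((real H)\<^sup>2 * sqrt (real X * real A * real L) * log_plus (real H * real X * real A * real L) ^ 2)"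
    if pos: "0 < H" "0 < X" "0 < A" "0 < L" for H X A L
  proof -
    define q where "q = log_plus (real H * real X * real A * real L)"
    have q: "1 \<le> q" by (simp add: q_def log_plus_ge)
    have N: "1 \<le> real H" "1 \<le> real X * real A" "1 \<le> real L"
      using pos mult_mono[of 1 "real X" 1 "real A"] by auto
    have 1: "log_plus (2 * real X * real A * real H * real L) \<le> 2 * q"
      unfolding q_def using pos by (intro log_plus_double_le) (auto simp: mult_ac)
    have 2: "log_plus (1 + real L / (real X * real A)) \<le> 2 * q"
      unfolding q_def
    proof (rule log_plus_double_le)
      have "real L / (real X * real A) \<le> real L / 1" using N by (intro divide_left_mono) auto
      moreover have "1 * real L \<le> (real H * (real X * real A)) * real L"
        using N mult_mono[of 1 "real H" 1 "real X * real A"] by (intro mult_right_mono) auto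
      moreover have "real H * real X * real A * real L = (real H * (real X * real A)) * real L" by simp
      ultimately show "1 + real L / (real X * real A) \<le> 2 * (real H * real X * real A * real L)"
        using N by linarith
    qed (simp add: add_pos_nonneg)
    have "sqrt (\<beta> * real X * real A * real L * log_plus (2 * real X * real A * real H * real L)) \<le> sqrt \<beta> * sqrt (real X * real A * real L) * (2 * q)"
    proof -
      have "sqrt (log_plus (2 * real X * real A * real H * real L)) \<le> sqrt (2 * q)"
        using 1 by (rule real_sqrt_le_mono)
      also have "\<dots> \<le> 2 * q" using q by (intro real_le_lsqrt) (auto simp: power2_eq_square)
      finally have "sqrt \<beta> * sqrt (real X * real A * real L) * sqrt (log_plus (2 * real X * real A * real H * real L)) \<le> sqrt \<beta> * sqrt (real X * real A * real L) * (2 * q)"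
        using assms by (intro mult_left_mono) auto
      then show ?thesis by (simp add: real_sqrt_mult mult_ac)
    qed
    then have "5 * (real H)\<^sup>2 * sqrt (\<beta> * real X * real A * real L * log_plus (2 * real X * real A * real H * real L)) * log_plus (1 + real L / (real X * real A))
      \<le> 5 * (real H)\<^sup>2 * (sqrt \<beta> * sqrt (real X * real A * real L) * (2 * q)) * (2 * q)"
      using 2 q assms log_plus_ge[of "1 + real L / (real X * real A)"]
      by (intro mult_mono mult_left_mono) auto
    moreover have "0 \<le> regret_bound \<beta> H X A L"
      unfolding regret_bound_def using assms log_plus_ge(1)[of "2 * real X * real A * real H * real L"] log_plus_ge(1)[of "1 + real L / (real X * real A)"]
      by (intro mult_nonneg_nonneg) auto
    ultimately show ?thesis
      unfolding q_def[symmetric] using q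
      by (simp add: regret_bound_def abs_mult power2_eq_square mult_ac)
  qed
  then show "\<forall>\<^sub>F x in ?F. norm (case x of (H, X, A, L) \<Rightarrow> regret_bound \<beta> H X A L) \<le> (20 * sqrt \<beta>) *
      norm (case x of (H, X, A, L) \<Rightarrow> (real H)\<^sup>2 * sqrt (real X * real A * real L) * log_plus (real H * real X * real A * real L) ^ 2)"
    unfolding eventually_principal by auto
qed

theorem theorem1:
  fixes H :: nat and \<beta> \<theta> \<sigma> \<sigma>0 :: real
    and \<rho> :: "'x::finite pmf"
    and \<alpha> :: "('x, 'a::finite) sa \<Rightarrow> 'x outcome \<Rightarrow> real"
    and sel :: "('x, 'a) tie_rule"
    and L :: nat
  assumes "0 < H"
    and alpha_nonneg: "\<And>s y. s \<in> sa_space H \<Longrightarrow> 0 \<le> \<alpha> s y"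
    and alpha_sum: "\<And>s. s \<in> sa_space H \<Longrightarrow> (\<Sum>y\<in>UNIV. \<alpha> s y) = \<beta>"
    and "3 \<le> \<beta>"
    and "0 < \<sigma>" and "0 < \<sigma>0"
    and "\<sigma>\<^sup>2 = 3 * (real H)\<^sup>2" and "\<theta> = real H" and "\<sigma>\<^sup>2 / \<sigma>0\<^sup>2 = \<beta>"
    and tie_rule: "\<And>D h x S. S \<noteq> {} \<Longrightarrow> sel D h x S \<in> S"
  shows "wtd_bayes_regret H \<theta> \<sigma> \<sigma>0 sel \<rho> \<alpha> L \<le> regret_bound \<beta> H CARD('x) CARD('a) L
    \<and> soft_bigo (regret_bound \<beta>) (\<lambda>H X A L. (real H)\<^sup>2 * sqrt (real X * real A * real L))"
proof
  show "soft_bigo (regret_bound \<beta>) (\<lambda>H X A L. (real H)\<^sup>2 * sqrt (real X * real A * real L))"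
    using \<open>3 \<le> \<beta>\<close> by (intro soft_bigo_regret_bound) simp
  define K where "K = real CARD('x) * real CARD('a)"
  define l where "l = log_plus (2 * real CARD('x) * real CARD('a) * real H * real L)"
  define \<Lambda> where "\<Lambda> = log_plus (1 + real L / K)"
  let ?R = "wtd_bayes_regret H (real H) \<sigma> \<sigma>0 sel \<rho> \<alpha> L" and ?M = "sqrt 6 * real H / sqrt \<beta>"
  have "1 * 1 \<le> K" unfolding K_def by (intro mult_mono) (auto simp: Suc_le_eq)
  then have K: "1 \<le> K" by simp
  have l: "1 \<le> l" and \<Lambda>: "1 \<le> \<Lambda>" by (simp_all add: l_def \<Lambda>_def log_plus_ge)
  \<comment> \<open>The truncation level is \<open>sqrt (2 * l)\<close>: then
    \<open>exp (- \<kappa>\<^sup>2 / 2) = exp (- l)\<close> is at most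
    \<open>1 / (2 * K * H * L)\<close>, which offsets the \<open>H * K\<close> triples and the
    \<open>L\<close> episodes and leaves 1/2.\<close>
  have \<kappa>: "1 \<le> sqrt (2 * l)" using l by simp
  note prems = assms(1) alpha_nonneg alpha_sum assms(4-7,9) \<kappa> tie_rule
  have triv: "?R \<le> real H * real L"
    using bayes_regret_le_total[where \<alpha> = \<alpha> and sel = sel and \<rho> = \<rho> and l = L, OF prems] total_le_trivial[where \<alpha> = \<alpha> and sel = sel and \<rho> = \<rho> and l = L, OF prems] by simp
  show "wtd_bayes_regret H \<theta> \<sigma> \<sigma>0 sel \<rho> \<alpha> L \<le> regret_bound \<beta> H CARD('x) CARD('a) L"
  proof (cases "L = 0")
    case True
    \<comment> \<open>Without episodes the trivial bound is already 0. In the other case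
      \<open>L > 0\<close> makes the argument of the logarithm positive.\<close>
    then show ?thesis using triv by (simp add: assms(8) regret_bound_def)
  next
    case False
    have err: "real L * (real H * ((real H + 1) * ?M) * (real (card (sa_space H :: ('x, 'a) sa set)) * exp (- (sqrt (2 * l))\<^sup>2 / 2)))
      \<le> real H * ((real H + 1) * ?M) / 2"
    proof -
      have pos: "0 < 2 * K * real H * real L" using K False \<open>0 < H\<close> by simp
      have "ln (2 * K * real H * real L) \<le> l" unfolding l_def K_def using log_plus_ge(2) by (simp add: mult.assoc)
      then have "exp (- l) \<le> exp (- ln (2 * K * real H * real L))" by simp
      also have "\<dots> = 1 / (2 * K * real H * real L)" using pos by (simp add: exp_minus inverse_eq_divide)
      finally have "real L * (real H * K) * exp (- l) \<le> real L * (real H * K) * (1 / (2 * K * real H * real L))"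
        using K by (intro mult_left_mono) auto
      also have "\<dots> = 1 / 2" using K False \<open>0 < H\<close> by (simp add: field_simps)
      finally have "real H * ((real H + 1) * ?M) * (real L * (real H * K) * exp (- l)) \<le> real H * ((real H + 1) * ?M) * (1 / 2)"
        using \<open>3 \<le> \<beta>\<close> by (intro mult_left_mono) auto
      moreover have "(sqrt (2 * l))\<^sup>2 / 2 = l" using l by simp
      ultimately show ?thesis by (simp add: card_sa_space K_def mult_ac)
    qed
    have ln_\<Lambda>: "ln (1 + real L / K) \<le> \<Lambda>" unfolding \<Lambda>_def by (rule log_plus_ge)
    have "?R \<le> real H * ((sqrt (2 * l) * sqrt 6 * real H) * (2 * sqrt (K * real L)) + (real H + real H * ?M * sqrt (2 * l)) * \<beta> * (K * ln (1 + real L / K)))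
      + real H * ((real H + 1) * ?M) / 2"
      using bayes_regret_le_total[where \<alpha> = \<alpha> and sel = sel and \<rho> = \<rho> and l = L, OF prems] total_le[where \<alpha> = \<alpha> and sel = sel and \<rho> = \<rho> and l = L, OF prems] err unfolding K_def[symmetric] by linarith
    also have "\<dots> \<le> real H * ((sqrt (2 * l) * sqrt 6 * real H) * (2 * sqrt (K * real L)) + (real H + real H * ?M * sqrt (2 * l)) * \<beta> * (K * \<Lambda>))
      + real H * ((real H + 1) * ?M) / 2"
      using K ln_\<Lambda> \<open>3 \<le> \<beta>\<close> l by (intro add_right_mono mult_left_mono add_left_mono) auto
    finally have "?R \<le> 5 * (real H)\<^sup>2 * sqrt (\<beta> * K * real L * l) * \<Lambda>"
      using \<open>0 < H\<close> \<open>3 \<le> \<beta>\<close> K False l \<Lambda> triv by (intro regret_arithmetic) auto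
    then show ?thesis by (simp add: assms(8) regret_bound_def K_def l_def \<Lambda>_def mult.assoc)
  qed
qed

end
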